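(* Let $Z$ be a central ideal of a finite-dimensional triassociative algebra $L$ over a field $\mathbb{F}$. Then the sequence $$\big(L/L'\otimes Z\oplus Z\otimes L/L'\big)^3\xrightarrow{\overline{\theta}}M(L)\xrightarrow{\beta}M(L/Z)\xrightarrow{\gamma}L'\cap Z\to0,$$ with the natural maps $\overline{\theta},\beta,\gamma$ defined in the context, is exact.
   Context: Fix a field $\mathbb{F}$. A triassociative algebra is an $\mathbb{F}$-vector space $L$ with three bilinear products $\vdash,\dashv,\perp:L\times L\to L$ satisfying, for all $x,y,z\in L$: $(x\vdash y)\vdash z=x\vdash(y\vdash z)$; $(x\dashv y)\dashv z=x\dashv(y\dashv z)$; $(x\dashv y)\vdash z=x\vdash(y\vdash z)$; $(x\dashv y)\dashv z=x\dashv(y\vdash z)$; $(x\vdash y)\dashv z=x\vdash(y\dashv z)$; $(x\perp y)\vdash z=x\vdash(y\vdash z)$; $(x\dashv y)\dashv z=x\dashv(y\perp z)$; $(x\vdash y)\perp z=x\vdash(y\perp z)$; $(x\perp y)\dashv z=x\perp(y\dashv z)$; $(x\dashv y)\perp z=x\perp(y\vdash z)$; $(x\perp y)\perp z=x\perp(y\perp z)$. Homomorphisms are linear maps preserving all three products; ideals and quotients are defined in the usual way. The center $Z(L)$ is the set of all $z\in L$ with $z*x=x*z=0$ for all $x\in L$ and $*\in\{\vdash,\dashv,\perp\}$; a central ideal is an ideal contained in $Z(L)$. For subalgebras $S,T$ of $L$, $S\lozenge T=S\vdash T+S\dashv T+S\perp T$, where $S*T$ is the span of all $s*t$; and $L'=L\lozenge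 L$. Multiplier: a defining pair for $L$ is a pair $(K,M)$ of triassociative algebras with $L\cong K/M$ and $M\subseteq Z(K)\cap K'$; if $\dim K$ is maximal among defining pairs, $M=M(L)$ is called the multiplier of $L$. For finite-dimensional $L$ and any free presentation $0\to R\to F\to L\to0$ ($F$ a free triassociative algebra, $R$ an ideal of $F$), $M(L)$ is identified with $\frac{R\cap F'}{F\lozenge R+R\lozenge F}$. Maps: let $F$ be a free triassociative algebra with ideals $R\subseteq T$ such that $L=F/R$ and $Z=T/R$, so that $L/Z\cong F/T$, $L/L'\cong F/(R+F')$, $M(L)=\frac{R\cap F'}{F\lozenge R+R\lozenge F}$ and $M(L/Z)=\frac{T\cap F'}{F\lozenge T+T\lozenge F}$; note that $F\lozenge T+T\lozenge F\subseteq R$. Then $\beta(x+(F\lozenge R+R\lozenge F))=x+(F\lozenge T+T\lozenge F)$ and $\gamma(x+(F\lozenge T+T\lozenge F))=x+R$. For $*\in\{\vdash,\dashv,\perp\}$ let $\overline{\theta_*}:\frac{T}{R}\otimes\frac{F}{R+F'}\to M(L)$ and $\overline{\alpha_*}:\frac{F}{R+F'}\otimes\frac{T}{R}\to M(L)$ be the (well-defined) linear maps $\overline{t}\otimes\overline{f}\mapsto t*f+(F\lozenge R+R\lozenge F)$ and $\overline{f}\otimes\overline{t}\mapsto f*t+(F\lozenge R+R\lozenge F)$; then $\overline{\theta}(a,b,c,d,e,f)=\overline{\alpha_\vdash}(a)+\overline{\theta_\vdash}(b)+\overline{\alpha_\dashv}(c)+\overline{\theta_\dashv}(d)+\overline{\alpha_\perp}(e)+\overline{\theta_\perp}(f)$.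 *)

theory Defs
  imports "Jordan_Normal_Form.Missing_VectorSpace" "HOL-Algebra.AbelCoset"
begin

text \<open>
  Vector spaces are the carrier-based ones of the theory VectorSpace, over a field given as a
  HOL-Algebra record. The fields \<open>mult\<close> and \<open>one\<close> that the \<open>module\<close> record inherits from
  \<open>ring\<close> carry no information.
\<close>

section \<open>Triassociative algebras\<close>

record ('a, 'v) triassoc = "('a, 'v) module" +
  vd :: "'v \<Rightarrow> 'v \<Rightarrow> 'v" (infixl \<open>\<turnstile>\<index>\<close> 70)
  dv :: "'v \<Rightarrow> 'v \<Rightarrow> 'v" (infixl \<open>\<stileturn>\<index>\<close> 70)
  pp :: "'v \<Rightarrow> 'v \<Rightarrow> 'v" (infixl \<open>\<bottom>\<index>\<close> 70)

definition tri_products :: "('a, 'v) triassoc \<Rightarrow> ('v \<Rightarrow> 'v \<Rightarrow> 'v) set" where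
  "tri_products L = {vd L, dv L, pp L}"

locale triassociative_algebra = vectorspace K L
  for K :: "('a, 'r) ring_scheme" and L :: "('a, 'v) triassoc" (structure) +
  assumes bilinear_right:
      "\<lbrakk>op \<in> tri_products L; x \<in> carrier L\<rbrakk> \<Longrightarrow> (\<lambda>y. op x y) \<in> module_hom K L L"
    and bilinear_left:
      "\<lbrakk>op \<in> tri_products L; y \<in> carrier L\<rbrakk> \<Longrightarrow> (\<lambda>x. op x y) \<in> module_hom K L L"
    and triassoc:
      "\<lbrakk>x \<in> carrier L; y \<in> carrier L; z \<in> carrier L\<rbrakk> \<Longrightarrow> (x \<turnstile> y) \<turnstile> z = x \<turnstile> (y \<turnstile> z)"
      "\<lbrakk>x \<in> carrier L; y \<in> carrier L; z \<in> carrier L\<rbrakk> \<Longrightarrow> (x \<stileturn> y) \<stileturn> z = x \<stileturn> (y \<stileturn> z)"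
      "\<lbrakk>x \<in> carrier L; y \<in> carrier L; z \<in> carrier L\<rbrakk> \<Longrightarrow> (x \<stileturn> y) \<turnstile> z = x \<turnstile> (y \<turnstile> z)"
      "\<lbrakk>x \<in> carrier L; y \<in> carrier L; z \<in> carrier L\<rbrakk> \<Longrightarrow> (x \<stileturn> y) \<stileturn> z = x \<stileturn> (y \<turnstile> z)"
      "\<lbrakk>x \<in> carrier L; y \<in> carrier L; z \<in> carrier L\<rbrakk> \<Longrightarrow> (x \<turnstile> y) \<stileturn> z = x \<turnstile> (y \<stileturn> z)"
      "\<lbrakk>x \<in> carrier L; y \<in> carrier L; z \<in> carrier L\<rbrakk> \<Longrightarrow> (x \<bottom> y) \<turnstile> z = x \<turnstile> (y \<turnstile> z)"
      "\<lbrakk>x \<in> carrier L; y \<in> carrier L; z \<in> carrier L\<rbrakk> \<Longrightarrow> (x \<stileturn> y) \<stileturn> z = x \<stileturn> (y \<bottom> z)"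
      "\<lbrakk>x \<in> carrier L; y \<in> carrier L; z \<in> carrier L\<rbrakk> \<Longrightarrow> (x \<turnstile> y) \<bottom> z = x \<turnstile> (y \<bottom> z)"
      "\<lbrakk>x \<in> carrier L; y \<in> carrier L; z \<in> carrier L\<rbrakk> \<Longrightarrow> (x \<bottom> y) \<stileturn> z = x \<bottom> (y \<stileturn> z)"
      "\<lbrakk>x \<in> carrier L; y \<in> carrier L; z \<in> carrier L\<rbrakk> \<Longrightarrow> (x \<stileturn> y) \<bottom> z = x \<bottom> (y \<turnstile> z)"
      "\<lbrakk>x \<in> carrier L; y \<in> carrier L; z \<in> carrier L\<rbrakk> \<Longrightarrow> (x \<bottom> y) \<bottom> z = x \<bottom> (y \<bottom> z)"

definition triassoc_hom ::
  "('a, 'r) ring_scheme \<Rightarrow> ('a, 'v) triassoc \<Rightarrow> ('a, 'w) triassoc \<Rightarrow> ('v \<Rightarrow> 'w) set" where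
  "triassoc_hom K A B = {f \<in> module_hom K A B. \<forall>x\<in>carrier A. \<forall>y\<in>carrier A.
     f (x \<turnstile>\<^bsub>A\<^esub> y) = f x \<turnstile>\<^bsub>B\<^esub> f y \<and>
     f (x \<stileturn>\<^bsub>A\<^esub> y) = f x \<stileturn>\<^bsub>B\<^esub> f y \<and>
     f (x \<bottom>\<^bsub>A\<^esub> y) = f x \<bottom>\<^bsub>B\<^esub> f y}"

definition triassoc_isomorphic ::
  "('a, 'r) ring_scheme \<Rightarrow> ('a, 'v) triassoc \<Rightarrow> ('a, 'w) triassoc \<Rightarrow> bool" where
  "triassoc_isomorphic K A B \<longleftrightarrow> (\<exists>f \<in> triassoc_hom K A B. bij_betw f (carrier A) (carrier B))"

definition tri_ideal :: "('a, 'r) ring_scheme \<Rightarrow> 'v set \<Rightarrow> ('a, 'v) triassoc \<Rightarrow> bool" where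
  "tri_ideal K I L \<longleftrightarrow> VectorSpace.subspace K I L \<and>
     (\<forall>op \<in> tri_products L. \<forall>x \<in> carrier L. \<forall>i \<in> I. op x i \<in> I \<and> op i x \<in> I)"

definition tri_center :: "('a, 'v) triassoc \<Rightarrow> 'v set" where
  "tri_center L = {z \<in> carrier L. \<forall>x \<in> carrier L. \<forall>op \<in> tri_products L.
     op z x = \<zero>\<^bsub>L\<^esub> \<and> op x z = \<zero>\<^bsub>L\<^esub>}"

definition central_ideal :: "('a, 'r) ring_scheme \<Rightarrow> 'v set \<Rightarrow> ('a, 'v) triassoc \<Rightarrow> bool" where
  "central_ideal K I L \<longleftrightarrow> tri_ideal K I L \<and> I \<subseteq> tri_center L"

definition product_span ::
  "('a, 'r) ring_scheme \<Rightarrow> ('a, 'v) triassoc \<Rightarrow> ('v \<Rightarrow> 'v \<Rightarrow> 'v) \<Rightarrow> 'v set \<Rightarrow> 'v set \<Rightarrow> 'v set" where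
  "product_span K L op S T = module.span K L {op s t | s t. s \<in> S \<and> t \<in> T}"

definition lozenge ::
  "('a, 'r) ring_scheme \<Rightarrow> ('a, 'v) triassoc \<Rightarrow> 'v set \<Rightarrow> 'v set \<Rightarrow> 'v set" where
  "lozenge K L S T =
     product_span K L (vd L) S T <+>\<^bsub>L\<^esub> product_span K L (dv L) S T <+>\<^bsub>L\<^esub> product_span K L (pp L) S T"

definition derived :: "('a, 'r) ring_scheme \<Rightarrow> ('a, 'v) triassoc \<Rightarrow> 'v set" where
  "derived K L = lozenge K L (carrier L) (carrier L)"

text \<open>
  Freeness on a subset. A formula cannot quantify over types, so the universal property is stated
  for target algebras carried by the type \<open>'c\<close>; a free algebra has it for every \<open>'c\<close>. Assuming it
  for particular types is therefore implied by freeness.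
\<close>

definition free_on ::
  "('a, 'r) ring_scheme \<Rightarrow> 'f set \<Rightarrow> ('a, 'f) triassoc \<Rightarrow> 'c itself \<Rightarrow> bool" where
  "free_on K X F (_ :: 'c itself) \<longleftrightarrow> triassociative_algebra K F \<and> X \<subseteq> carrier F \<and>
     (\<forall>(A :: ('a, 'c) triassoc) g. triassociative_algebra K A \<longrightarrow> g \<in> X \<rightarrow> carrier A \<longrightarrow>
       (\<exists>h \<in> triassoc_hom K F A. (\<forall>x\<in>X. h x = g x) \<and>
          (\<forall>h' \<in> triassoc_hom K F A. (\<forall>x\<in>X. h' x = g x) \<longrightarrow> (\<forall>y\<in>carrier F. h' y = h y))))"


section \<open>Quotients\<close>

definition quot_space ::
  "('a, 'v, 'm) module_scheme \<Rightarrow> 'v set \<Rightarrow> ('a, 'v set) module" where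
  "quot_space V U =
    \<lparr>carrier = a_rcosets\<^bsub>V\<^esub> U, mult = (\<lambda>A B. U), one = U, zero = U, add = set_add V,
     smult = (\<lambda>c A. \<Union>a\<in>A. U +>\<^bsub>V\<^esub> (c \<odot>\<^bsub>V\<^esub> a))\<rparr>"

definition coset_op :: "('a, 'v) triassoc \<Rightarrow> 'v set \<Rightarrow> ('v \<Rightarrow> 'v \<Rightarrow> 'v) \<Rightarrow> 'v set \<Rightarrow> 'v set \<Rightarrow> 'v set"
  where "coset_op L I op A B = (\<Union>a\<in>A. \<Union>b\<in>B. I +>\<^bsub>L\<^esub> op a b)"

definition quot_algebra :: "('a, 'v) triassoc \<Rightarrow> 'v set \<Rightarrow> ('a, 'v set) triassoc" where
  "quot_algebra L I = module.extend (quot_space L I)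
     (triassoc.fields (coset_op L I (vd L)) (coset_op L I (dv L)) (coset_op L I (pp L)))"

lemma quot_algebra_simps [simp]:
  "carrier (quot_algebra L I) = a_rcosets\<^bsub>L\<^esub> I"
  "zero (quot_algebra L I) = I"
  "add (quot_algebra L I) = set_add L"
  "smult (quot_algebra L I) = (\<lambda>c A. \<Union>a\<in>A. I +>\<^bsub>L\<^esub> (c \<odot>\<^bsub>L\<^esub> a))"
  "vd (quot_algebra L I) = coset_op L I (vd L)"
  "dv (quot_algebra L I) = coset_op L I (dv L)"
  "pp (quot_algebra L I) = coset_op L I (pp L)"
  by (simp_all add: quot_algebra_def quot_space_def module.defs triassoc.defs)

text \<open>The map on cosets induced by a map \<open>f\<close> on representatives that is constant on each coset.\<close>

definition induced_map :: "('v \<Rightarrow> 'w) \<Rightarrow> 'v set \<Rightarrow> 'w" where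
  "induced_map f A = the_elem (f ` A)"


section \<open>Tensor products\<close>

text \<open>The tensor product is the free vector space on pairs modulo the bilinearity relations.\<close>

definition free_space :: "('a, 'r) ring_scheme \<Rightarrow> 's set \<Rightarrow> ('a, 's \<Rightarrow> 'a) module" where
  "free_space K S = (ring.func_space K S)
     \<lparr>carrier := {p \<in> S \<rightarrow>\<^sub>E carrier K. finite {s \<in> S. p s \<noteq> \<zero>\<^bsub>K\<^esub>}}\<rparr>"

definition free_gen :: "('a, 'r) ring_scheme \<Rightarrow> 's set \<Rightarrow> 's \<Rightarrow> 's \<Rightarrow> 'a" where
  "free_gen K S s = (\<lambda>t\<in>S. if t = s then \<one>\<^bsub>K\<^esub> else \<zero>\<^bsub>K\<^esub>)"

definition bilinear_relations ::
  "('a, 'r) ring_scheme \<Rightarrow> ('a, 'v, 'm) module_scheme \<Rightarrow> ('a, 'w, 'n) module_scheme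
    \<Rightarrow> ('v \<times> 'w \<Rightarrow> 'a) set" where
  "bilinear_relations K V W =
    (let S = carrier V \<times> carrier W; P = free_space K S; e = free_gen K S in
      {e (v \<oplus>\<^bsub>V\<^esub> v', w) \<ominus>\<^bsub>P\<^esub> (e (v, w) \<oplus>\<^bsub>P\<^esub> e (v', w)) | v v' w.
         v \<in> carrier V \<and> v' \<in> carrier V \<and> w \<in> carrier W} \<union>
      {e (v, w \<oplus>\<^bsub>W\<^esub> w') \<ominus>\<^bsub>P\<^esub> (e (v, w) \<oplus>\<^bsub>P\<^esub> e (v, w')) | v w w'.
         v \<in> carrier V \<and> w \<in> carrier W \<and> w' \<in> carrier W} \<union>
      {e (c \<odot>\<^bsub>V\<^esub> v, w) \<ominus>\<^bsub>P\<^esub> c \<odot>\<^bsub>P\<^esub> e (v, w) | c v w.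
         c \<in> carrier K \<and> v \<in> carrier V \<and> w \<in> carrier W} \<union>
      {e (v, c \<odot>\<^bsub>W\<^esub> w) \<ominus>\<^bsub>P\<^esub> c \<odot>\<^bsub>P\<^esub> e (v, w) | c v w.
         c \<in> carrier K \<and> v \<in> carrier V \<and> w \<in> carrier W})"

definition tensor ::
  "('a, 'r) ring_scheme \<Rightarrow> ('a, 'v, 'm) module_scheme \<Rightarrow> ('a, 'w, 'n) module_scheme
    \<Rightarrow> ('a, ('v \<times> 'w \<Rightarrow> 'a) set) module" where
  "tensor K V W = (let P = free_space K (carrier V \<times> carrier W) in
     quot_space P (module.span K P (bilinear_relations K V W)))"

text \<open>The linear map out of \<open>tensor K V W\<close> with \<open>v \<otimes> w \<mapsto> b v w\<close>, for a bilinear \<open>b\<close>.\<close>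

definition tensor_lift ::
  "('a, 'r) ring_scheme \<Rightarrow> ('a, 'v, 'm) module_scheme \<Rightarrow> ('a, 'w, 'n) module_scheme
    \<Rightarrow> ('a, 'u, 'l) module_scheme \<Rightarrow> ('v \<Rightarrow> 'w \<Rightarrow> 'u) \<Rightarrow> ('v \<times> 'w \<Rightarrow> 'a) set \<Rightarrow> 'u" where
  "tensor_lift K V W U b = induced_map (\<lambda>p.
     \<Oplus>\<^bsub>U\<^esub>s \<in> {s \<in> carrier V \<times> carrier W. p s \<noteq> \<zero>\<^bsub>K\<^esub>}. p s \<odot>\<^bsub>U\<^esub> b (fst s) (snd s))"


section \<open>The multiplier\<close>

definition defining_pair ::
  "('a, 'r) ring_scheme \<Rightarrow> ('a, 'l) triassoc \<Rightarrow> ('a, 'e) triassoc \<Rightarrow> 'e set \<Rightarrow> bool" where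
  "defining_pair K L E M \<longleftrightarrow> triassociative_algebra K E \<and> tri_ideal K M E \<and>
     triassoc_isomorphic K (quot_algebra E M) L \<and> M \<subseteq> tri_center E \<inter> derived K E"

text \<open>
  Maximality ranges over the defining pairs carried by the type \<open>'k\<close>; maximality among all
  defining pairs is expressed by leaving \<open>'k\<close> a type variable in a conclusion. The library's \<open>dim\<close> is
  meaningful only for finite-dimensional spaces, hence the two \<open>fin_dim\<close> conditions.
\<close>

definition maximal_defining_pair ::
  "('a, 'r) ring_scheme \<Rightarrow> ('a, 'l) triassoc \<Rightarrow> ('a, 'e) triassoc \<Rightarrow> 'e set \<Rightarrow> 'k itself \<Rightarrow> bool" where
  "maximal_defining_pair K L E M (_ :: 'k itself) \<longleftrightarrow>
     defining_pair K L E M \<and> vectorspace.fin_dim K E \<and>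
     (\<forall>(E' :: ('a, 'k) triassoc) M'. defining_pair K L E' M' \<longrightarrow>
        vectorspace.fin_dim K E' \<and> vectorspace.dim K E' \<le> vectorspace.dim K E)"

text \<open>\<open>M\<close> is the multiplier of \<open>L\<close>, up to isomorphism, realised by a pair carried by \<open>'e\<close>.\<close>

definition is_multiplier ::
  "('a, 'r) ring_scheme \<Rightarrow> ('a, 'l) triassoc \<Rightarrow> ('a, 'm) triassoc \<Rightarrow> 'e itself \<Rightarrow> 'k itself \<Rightarrow> bool"
  where "is_multiplier K L M (_ :: 'e itself) (k :: 'k itself) \<longleftrightarrow>
    (\<exists>(E :: ('a, 'e) triassoc) N. maximal_defining_pair K L E N k \<and>
       triassoc_isomorphic K (E\<lparr>carrier := N\<rparr>) M)"

text \<open>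
  For a free presentation of an algebra with kernel \<open>R\<close>, the multiplier is taken as
  \<open>(R \<inter> F') / (F \<lozenge> R + R \<lozenge> F)\<close>. It is zero as an algebra, like every multiplier.
\<close>

definition comm_ideal :: "('a, 'r) ring_scheme \<Rightarrow> ('a, 'f) triassoc \<Rightarrow> 'f set \<Rightarrow> 'f set" where
  "comm_ideal K F R = lozenge K F (carrier F) R <+>\<^bsub>F\<^esub> lozenge K F R (carrier F)"

definition mult_of_presentation ::
  "('a, 'r) ring_scheme \<Rightarrow> ('a, 'f) triassoc \<Rightarrow> 'f set \<Rightarrow> ('a, 'f set) triassoc" where
  "mult_of_presentation K F R =
     quot_algebra (F\<lparr>carrier := R \<inter> derived K F\<rparr>) (comm_ideal K F R)"


section \<open>The maps of the sequence\<close>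

text \<open>
  Throughout, \<open>\<pi> : F \<rightarrow> L\<close> is a surjective homomorphism with kernel \<open>R\<close> and \<open>T\<close> is the
  preimage of \<open>Z\<close>; through \<open>\<pi>\<close>, \<open>L\<close> is identified with \<open>F/R\<close>, \<open>Z\<close> with \<open>T/R\<close>, and \<open>L/L'\<close> with
  \<open>F/(R + F')\<close>. The sets under \<open>the_elem\<close> below are singletons, by independence of representatives.
\<close>

definition abelianization :: "('a, 'r) ring_scheme \<Rightarrow> ('a, 'l) triassoc \<Rightarrow> ('a, 'l set) module" where
  "abelianization K L = quot_space L (derived K L)"

definition alpha_map ::
  "('a, 'r) ring_scheme \<Rightarrow> ('a, 'f) triassoc \<Rightarrow> ('a, 'l) triassoc \<Rightarrow> ('f \<Rightarrow> 'l) \<Rightarrow> 'f set \<Rightarrow> 'l set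
    \<Rightarrow> ('f \<Rightarrow> 'f \<Rightarrow> 'f) \<Rightarrow> ('l set \<times> 'l \<Rightarrow> 'a) set \<Rightarrow> 'f set" where
  "alpha_map K F L \<pi> R Z op =
     tensor_lift K (abelianization K L) (L\<lparr>carrier := Z\<rparr>) (mult_of_presentation K F R)
       (\<lambda>c z. the_elem {comm_ideal K F R +>\<^bsub>F\<^esub> op f t | f t.
          f \<in> carrier F \<and> t \<in> carrier F \<and> \<pi> f \<in> c \<and> \<pi> t = z})"

definition theta_map ::
  "('a, 'r) ring_scheme \<Rightarrow> ('a, 'f) triassoc \<Rightarrow> ('a, 'l) triassoc \<Rightarrow> ('f \<Rightarrow> 'l) \<Rightarrow> 'f set \<Rightarrow> 'l set
    \<Rightarrow> ('f \<Rightarrow> 'f \<Rightarrow> 'f) \<Rightarrow> ('l \<times> 'l set \<Rightarrow> 'a) set \<Rightarrow> 'f set" where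
  "theta_map K F L \<pi> R Z op =
     tensor_lift K (L\<lparr>carrier := Z\<rparr>) (abelianization K L) (mult_of_presentation K F R)
       (\<lambda>z c. the_elem {comm_ideal K F R +>\<^bsub>F\<^esub> op t f | t f.
          t \<in> carrier F \<and> f \<in> carrier F \<and> \<pi> t = z \<and> \<pi> f \<in> c})"

definition tensor_pair ::
  "('a, 'r) ring_scheme \<Rightarrow> ('a, 'l) triassoc \<Rightarrow> 'l set
    \<Rightarrow> ('a, ('l set \<times> 'l \<Rightarrow> 'a) set \<times> ('l \<times> 'l set \<Rightarrow> 'a) set) module" where
  "tensor_pair K L Z = direct_sum (tensor K (abelianization K L) (L\<lparr>carrier := Z\<rparr>))
                                  (tensor K (L\<lparr>carrier := Z\<rparr>) (abelianization K L))"

definition theta_bar where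
  "theta_bar K F L \<pi> R Z = (\<lambda>((a, b), (c, d), (e, f)).
     alpha_map K F L \<pi> R Z (vd F) a \<oplus>\<^bsub>mult_of_presentation K F R\<^esub>
     theta_map K F L \<pi> R Z (vd F) b \<oplus>\<^bsub>mult_of_presentation K F R\<^esub>
     alpha_map K F L \<pi> R Z (dv F) c \<oplus>\<^bsub>mult_of_presentation K F R\<^esub>
     theta_map K F L \<pi> R Z (dv F) d \<oplus>\<^bsub>mult_of_presentation K F R\<^esub>
     alpha_map K F L \<pi> R Z (pp F) e \<oplus>\<^bsub>mult_of_presentation K F R\<^esub>
     theta_map K F L \<pi> R Z (pp F) f)"

definition beta_map ::
  "('a, 'r) ring_scheme \<Rightarrow> ('a, 'f) triassoc \<Rightarrow> 'f set \<Rightarrow> 'f set \<Rightarrow> 'f set" where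
  "beta_map K F T = induced_map (\<lambda>x. comm_ideal K F T +>\<^bsub>F\<^esub> x)"

definition gamma_map :: "('f \<Rightarrow> 'l) \<Rightarrow> 'f set \<Rightarrow> 'l" where
  "gamma_map \<pi> = induced_map \<pi>"

definition exact_at ::
  "('a, 'r) ring_scheme \<Rightarrow> ('a, 'u, 'm1) module_scheme \<Rightarrow> ('u \<Rightarrow> 'v) \<Rightarrow> ('a, 'v, 'm2) module_scheme
    \<Rightarrow> ('v \<Rightarrow> 'w) \<Rightarrow> ('a, 'w, 'm3) module_scheme \<Rightarrow> bool" where
  "exact_at K U f V g W \<longleftrightarrow> linear_map K U V f \<and> linear_map K V W g \<and>
     f ` carrier U = {v \<in> carrier V. g v = \<zero>\<^bsub>W\<^esub>}"

end

theory Submission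
  imports Defs
begin

text \<open>
  Write \<open>C(R)\<close> for \<open>F \<lozenge> R + R \<lozenge> F\<close>. Since \<open>Z\<close> is central, \<open>C(R) \<subseteq> C(T) \<subseteq> R \<inter> F'\<close>, so the kernel of
  \<open>\<beta>\<close> is \<open>C(T)/C(R)\<close> and the kernel of \<open>\<gamma>\<close> is \<open>(R \<inter> F')/C(T)\<close>. The image of \<open>\<theta>\<close> is spanned by the
  classes of the generators of \<open>C(T)\<close>; the maps \<open>\<alpha>\<close> and \<open>\<theta>\<close> are well defined because the axioms move
  the brackets in a product of \<open>F'\<close> with \<open>T\<close> so that an element of \<open>C(T) \<subseteq> R\<close> appears as a factor.

  For the multiplier, Zorn's lemma yields a subspace \<open>S\<close> of \<open>R\<close> with \<open>S \<inter> F' = C(R)\<close> and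
  \<open>S + (R \<inter> F') = R\<close>. It is an ideal, and \<open>(F/S, R/S)\<close> is a defining pair with
  \<open>R/S \<cong> (R \<inter> F')/C(R)\<close>. It is maximal: for a defining pair \<open>(E, M)\<close>, a lift \<open>F \<rightarrow> E\<close> of the
  presentation maps \<open>(R \<inter> F')/C(R)\<close> onto \<open>M\<close>. All these algebras are finite-dimensional, because
  \<open>E \<lozenge> E\<close> is spanned by the products of lifts of a finite generating set of \<open>L\<close>.
\<close>

section \<open>Linear algebra\<close>

text \<open>The extension \<open>F / C(R)\<close> of \<open>L\<close> has the central kernel
  \<open>R / C(R)\<close>, but this kernel need not lie in the derived algebra. Dividing further by
  \<open>S\<close>, that is, by a complement of \<open>(R \<inter> F') / C(R)\<close> inside it,
  removes exactly the excess and keeps \<open>(R \<inter> F') / C(R)\<close> intact. Since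
  \<open>F\<close> may be infinite-dimensional, dimensions are compared only between defining pairs,
  and the complement cannot come from counting. A second obstacle is the typing: freeness is assumed
  for targets carried by \<open>'f\<close> and \<open>'k\<close>, while \<open>L\<close> is carried
  by \<open>'l\<close>. The lift \<open>F \<rightarrow> E\<close> uses \<open>'k\<close>; its
  compatibility with the maps to \<open>L\<close> needs uniqueness at \<open>'l\<close>, which is
  recovered from \<open>'f\<close>. The presentation of \<open>L / Z\<close> with kernel
  \<open>T\<close> is a second instance of the same locale. The maps \<alpha> and \<theta> differ
  only in the order of the factors, so one abstract pairing serves all six.\<close>

lemma linear_map_iff:
  "linear_map K V W f \<longleftrightarrow> vectorspace K V \<and> vectorspace K W \<and> f \<in> module_hom K V W"
  unfolding linear_map_def mod_hom_def mod_hom_axioms_def vectorspace_def by blast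

lemma module_homI:
  assumes "\<And>x. x \<in> carrier V \<Longrightarrow> f x \<in> carrier W"
    and "\<And>x y. \<lbrakk>x \<in> carrier V; y \<in> carrier V\<rbrakk> \<Longrightarrow> f (x \<oplus>\<^bsub>V\<^esub> y) = f x \<oplus>\<^bsub>W\<^esub> f y"
    and "\<And>c x. \<lbrakk>c \<in> carrier K; x \<in> carrier V\<rbrakk> \<Longrightarrow> f (c \<odot>\<^bsub>V\<^esub> x) = c \<odot>\<^bsub>W\<^esub> f x"
  shows "f \<in> module_hom K V W"
  using assms by (auto simp: module_hom_def)

lemma subspaceD:
  assumes "subspace K U V"
  shows "vectorspace K V" "U \<subseteq> carrier V" "\<zero>\<^bsub>V\<^esub> \<in> U"
    "\<And>u. u \<in> U \<Longrightarrow> u \<in> carrier V"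
    "\<And>u v. \<lbrakk>u \<in> U; v \<in> U\<rbrakk> \<Longrightarrow> u \<oplus>\<^bsub>V\<^esub> v \<in> U"
    "\<And>c u. \<lbrakk>c \<in> carrier K; u \<in> U\<rbrakk> \<Longrightarrow> c \<odot>\<^bsub>V\<^esub> u \<in> U"
    "vectorspace K (V\<lparr>carrier := U\<rparr>)"
  using assms vectorspace.subspace_is_vs[of K V U]
  by (auto simp: subspace_def submodule_def)

section \<open>Subspaces, spans and relative complements\<close>

context vectorspace
begin

lemma subspaceI:
  assumes "U \<subseteq> carrier V" "\<zero>\<^bsub>V\<^esub> \<in> U"
    "\<And>u v. \<lbrakk>u \<in> U; v \<in> U\<rbrakk> \<Longrightarrow> u \<oplus>\<^bsub>V\<^esub> v \<in> U"
    "\<And>c u. \<lbrakk>c \<in> carrier K; u \<in> U\<rbrakk> \<Longrightarrow> c \<odot>\<^bsub>V\<^esub> u \<in> U"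
  shows "subspace K U V"
  using assms vectorspace_axioms module_axioms
  by (auto simp: subspace_def submodule_def)

lemma carrier_subspace: "subspace K (carrier V) V"
  by (rule subspaceI) auto

lemma subspace_uminus:
  assumes "subspace K U V" "u \<in> U"
  shows "\<ominus>\<^bsub>V\<^esub> u \<in> U"
  using subspaceD(6)[OF assms(1), of "\<ominus>\<^bsub>K\<^esub> \<one>\<^bsub>K\<^esub>" u] subspaceD(4)[OF assms] assms(2)
  by (simp add: smult_minus_1)

lemma subspace_minus:
  assumes "subspace K U V" "u \<in> U" "v \<in> U"
  shows "u \<ominus>\<^bsub>V\<^esub> v \<in> U"
  unfolding a_minus_def using assms subspace_uminus subspaceD(5) by metis

lemma subspace_Int:
  assumes "subspace K A V" "subspace K B V"
  shows "subspace K (A \<inter> B) V"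
  using subspaceD[OF assms(1)] subspaceD[OF assms(2)] by (intro subspaceI) auto

lemma span_subspace: "S \<subseteq> carrier V \<Longrightarrow> subspace K (span S) V"
  by (rule span_is_subspace)

lemma span_le: "\<lbrakk>S \<subseteq> U; subspace K U V\<rbrakk> \<Longrightarrow> span S \<subseteq> U"
  by (rule span_is_subset) auto

lemma set_add_span:
  assumes "A \<subseteq> carrier V" "B \<subseteq> carrier V"
  shows "span A <+>\<^bsub>V\<^esub> span B = span (A \<union> B)"
  unfolding span_union_is_sum[OF assms] submodule_sum_def set_add_def'
  by auto

text \<open>A set independent in \<open>W\<close> stays independent in \<open>V\<close>, so its
  cardinality is bounded by the dimension of \<open>V\<close>; a maximal independent subset of
  \<open>W\<close> therefore exists, is finite, and is a basis.\<close>

lemma subspace_fin_dim: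
  assumes fd: "fin_dim" and W: "subspace K W V"
  shows "vectorspace.fin_dim K (vs W)"
proof -
  interpret W: vectorspace K "vs W" using W by (rule subspace_is_vs)
  have "\<exists>A. finite A \<and> maximal A (\<lambda>S. S \<subseteq> carrier (vs W) \<and> W.lin_indpt S)"
  proof (rule maximal_exists)
    fix A assume A: "A \<subseteq> carrier (vs W) \<and> W.lin_indpt A"
    then have "lin_indpt A"
      using span_li_not_depend(2)[of A W] W by simp
    then show "finite A \<and> card A \<le> dim"
      using li_le_dim[OF fd, of A] A subspaceD(2)[OF W] by auto
  next
    show "{} \<subseteq> carrier (vs W) \<and> W.lin_indpt {}"
      by (auto simp: W.lin_dep_def)
  qed
  then show ?thesis
    using W.max_li_is_basis unfolding W.fin_dim_def W.basis_def by blast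
qed

text \<open>Modulo \<open>C\<close>, \<open>S\<close> is a complement of \<open>U \<inter> D\<close>
  in \<open>U\<close>. Phrasing this inside \<open>V\<close> avoids passing to \<open>U / C\<close>
  and back. It is applied with \<open>U = R\<close>, \<open>D = F'\<close> and
  \<open>C = C(R)\<close>.\<close>

lemma relative_complement:
  assumes U: "subspace K U V" and D: "subspace K D V" and C: "subspace K C V"
    and CU: "C \<subseteq> U" and CD: "C \<subseteq> D"
  obtains S where "subspace K S V" "C \<subseteq> S" "S \<subseteq> U" "S \<inter> D = C"
    "\<And>u. u \<in> U \<Longrightarrow> \<exists>s\<in>S. \<exists>d\<in>U \<inter> D. u = s \<oplus>\<^bsub>V\<^esub> d"
proof -
  \<comment> \<open>Only one inclusion is demanded of \<open>S \<inter> D\<close>; the other holds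
    because \<open>C\<close> lies in both \<open>S\<close> and \<open>D\<close>.\<close>
  let ?\<A> = "{S. subspace K S V \<and> C \<subseteq> S \<and> S \<subseteq> U \<and> S \<inter> D \<subseteq> C}"
  have "\<exists>M\<in>?\<A>. \<forall>X\<in>?\<A>. M \<subseteq> X \<longrightarrow> X = M"
  proof (rule subset_Zorn_nonempty)
    show "?\<A> \<noteq> {}" using C CU by blast
  next
    fix \<C> assume ne: "\<C> \<noteq> {}" and ch: "subset.chain ?\<A> \<C>"
    have mem: "\<And>S. S \<in> \<C> \<Longrightarrow> S \<in> ?\<A>" using ch by (auto simp: subset.chain_def)
    have sub: "subspace K S V" if "S \<in> \<C>" for S using mem[OF that] by simp
    have "subspace K (\<Union>\<C>) V"
    proof (rule subspaceI)
      show "\<Union>\<C> \<subseteq> carrier V" using subspaceD(2)[OF sub] by blast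
      show "\<zero>\<^bsub>V\<^esub> \<in> \<Union>\<C>" using ne subspaceD(3)[OF sub] by blast
    next
      fix u v assume "u \<in> \<Union>\<C>" "v \<in> \<Union>\<C>"
      then obtain A B where AB: "A \<in> \<C>" "B \<in> \<C>" "u \<in> A" "v \<in> B" by blast
      then have "A \<subseteq> B \<or> B \<subseteq> A"
        using ch by (simp add: subset_chain_def)
      then obtain S where "S \<in> \<C>" "u \<in> S" "v \<in> S" using AB by blast
      then show "u \<oplus>\<^bsub>V\<^esub> v \<in> \<Union>\<C>" using subspaceD(5)[OF sub] by blast
    next
      fix c u assume "c \<in> carrier K" "u \<in> \<Union>\<C>"
      then show "c \<odot>\<^bsub>V\<^esub> u \<in> \<Union>\<C>" using subspaceD(6)[OF sub] by blast
    qed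
    moreover obtain S where "S \<in> \<C>" using ne by blast
    then have "C \<subseteq> \<Union>\<C>" using mem by blast
    moreover have "\<Union>\<C> \<subseteq> U" "\<Union>\<C> \<inter> D \<subseteq> C" using mem by auto
    ultimately show "\<Union>\<C> \<in> ?\<A>" by simp
  qed
  then obtain S where S: "subspace K S V" "C \<subseteq> S" "S \<subseteq> U" "S \<inter> D \<subseteq> C"
    and max: "\<And>X. \<lbrakk>subspace K X V; C \<subseteq> X; X \<subseteq> U; X \<inter> D \<subseteq> C; S \<subseteq> X\<rbrakk> \<Longrightarrow> X = S"
    by auto
  note s = subspaceD[OF S(1)] and u = subspaceD[OF U] and d = subspaceD[OF D]
  have "\<exists>s\<in>S. \<exists>d\<in>U \<inter> D. r = s \<oplus>\<^bsub>V\<^esub> d" if r: "r \<in> U" for r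
  proof (rule ccontr)
    assume no: "\<not> ?thesis"
    have rc: "r \<in> carrier V" using r u(4) by blast
    have rS: "r \<notin> S" using no d(3) u(3) rc M.r_zero[OF rc] by (metis IntI)
    \<comment> \<open>If \<open>r\<close> is not in \<open>S + (U \<inter> D)\<close>, adjoining the
      line through \<open>r\<close> to \<open>S\<close> stays within the family, which contradicts
      maximality.\<close>
    let ?X = "{s \<oplus>\<^bsub>V\<^esub> c \<odot>\<^bsub>V\<^esub> r | s c. s \<in> S \<and> c \<in> carrier K}"
    have X: "subspace K ?X V"
    proof (rule subspaceI)
      show "?X \<subseteq> carrier V" using s(4) rc by auto
      have "\<zero>\<^bsub>V\<^esub> = \<zero>\<^bsub>V\<^esub> \<oplus>\<^bsub>V\<^esub> \<zero>\<^bsub>K\<^esub> \<odot>\<^bsub>V\<^esub> r" using rc by simp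
      then show "\<zero>\<^bsub>V\<^esub> \<in> ?X" using s(3) by blast
    next
      fix x y assume "x \<in> ?X" "y \<in> ?X"
      then obtain a c b e where *: "x = a \<oplus>\<^bsub>V\<^esub> c \<odot>\<^bsub>V\<^esub> r" "a \<in> S" "c \<in> carrier K"
        "y = b \<oplus>\<^bsub>V\<^esub> e \<odot>\<^bsub>V\<^esub> r" "b \<in> S" "e \<in> carrier K" by blast
      have "x \<oplus>\<^bsub>V\<^esub> y = (a \<oplus>\<^bsub>V\<^esub> b) \<oplus>\<^bsub>V\<^esub> (c \<oplus>\<^bsub>K\<^esub> e) \<odot>\<^bsub>V\<^esub> r"
        using * rc s(4) by (simp add: smult_l_distr M.a_ac)
      then show "x \<oplus>\<^bsub>V\<^esub> y \<in> ?X" using * s(5) by blast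
    next
      fix c x assume c: "c \<in> carrier K" and "x \<in> ?X"
      then obtain a e where *: "x = a \<oplus>\<^bsub>V\<^esub> e \<odot>\<^bsub>V\<^esub> r" "a \<in> S" "e \<in> carrier K" by blast
      have "c \<odot>\<^bsub>V\<^esub> x = c \<odot>\<^bsub>V\<^esub> a \<oplus>\<^bsub>V\<^esub> (c \<otimes>\<^bsub>K\<^esub> e) \<odot>\<^bsub>V\<^esub> r"
        using * c rc s(4) by (simp add: smult_r_distr smult_assoc1)
      then show "c \<odot>\<^bsub>V\<^esub> x \<in> ?X" using * c s(6) by blast
    qed
    have SX: "S \<subseteq> ?X"
    proof
      fix x assume x: "x \<in> S"
      have "x = x \<oplus>\<^bsub>V\<^esub> \<zero>\<^bsub>K\<^esub> \<odot>\<^bsub>V\<^esub> r" using s(4)[OF x] rc by simp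
      then show "x \<in> ?X" using x by blast
    qed
    have "?X \<subseteq> U" using S(3) r u(5,6) by auto
    moreover have "?X \<inter> D \<subseteq> C"
    proof
      fix x assume "x \<in> ?X \<inter> D"
      then obtain a c where *: "x = a \<oplus>\<^bsub>V\<^esub> c \<odot>\<^bsub>V\<^esub> r" "a \<in> S" "c \<in> carrier K" "x \<in> D" by blast
      show "x \<in> C"
      proof (cases "c = \<zero>\<^bsub>K\<^esub>")
        case True
        then have "x = a" using * rc s(4) by simp
        then show ?thesis using * S(4) by blast
      next
        \<comment> \<open>This case is contradictory: with \<open>c\<close> invertible, solving
          \<open>x = a + c r\<close> for \<open>r\<close> writes it as an element of
          \<open>S\<close> plus an element of \<open>U \<inter> D\<close>, against
          \<open>no\<close>.\<close>
        case False
        then have inv: "inv\<^bsub>K\<^esub> c \<in> carrier K" "inv\<^bsub>K\<^esub> c \<otimes>\<^bsub>K\<^esub> c = \<one>\<^bsub>K\<^esub>"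
          using *(3) field_Units by auto
        have xU: "x \<in> U" using * S(3) r u(5,6) by blast
        have ac: "a \<in> carrier V" using * s(4) by blast
        have xa: "c \<odot>\<^bsub>V\<^esub> r = \<ominus>\<^bsub>V\<^esub> a \<oplus>\<^bsub>V\<^esub> x"
          using * ac rc by (simp add: M.r_neg1)
        have "r = inv\<^bsub>K\<^esub> c \<odot>\<^bsub>V\<^esub> (c \<odot>\<^bsub>V\<^esub> r)"
          using inv * rc by (simp flip: smult_assoc1)
        also have "\<dots> = inv\<^bsub>K\<^esub> c \<odot>\<^bsub>V\<^esub> (\<ominus>\<^bsub>V\<^esub> a) \<oplus>\<^bsub>V\<^esub> inv\<^bsub>K\<^esub> c \<odot>\<^bsub>V\<^esub> x"
          unfolding xa using inv ac u(4)[OF xU] by (simp add: smult_r_distr)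
        finally have "r = \<dots>" .
        moreover have "inv\<^bsub>K\<^esub> c \<odot>\<^bsub>V\<^esub> (\<ominus>\<^bsub>V\<^esub> a) \<in> S" using inv * s(6) subspace_uminus[OF S(1)] by blast
        moreover have "inv\<^bsub>K\<^esub> c \<odot>\<^bsub>V\<^esub> x \<in> U \<inter> D" using inv * xU u(6) d(6) by blast
        ultimately show ?thesis using no by blast
      qed
    qed
    ultimately have "?X = S" using max[OF X _ _ _ SX] S(2) SX by blast
    moreover have "r = \<zero>\<^bsub>V\<^esub> \<oplus>\<^bsub>V\<^esub> \<one>\<^bsub>K\<^esub> \<odot>\<^bsub>V\<^esub> r" using rc by simp
    then have "r \<in> ?X" using s(3) by blast
    ultimately show False using rS by blast
  qed
  then show ?thesis using that[OF S(1-3)] S(2,4) CD by blast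
qed

end

section \<open>Linear maps: images, kernels and dimension\<close>

lemma linear_mapD:
  assumes "linear_map K V W f"
  shows "vectorspace K V" "vectorspace K W" "f \<in> module_hom K V W"
    "\<And>x. x \<in> carrier V \<Longrightarrow> f x \<in> carrier W"
    "\<And>x y. \<lbrakk>x \<in> carrier V; y \<in> carrier V\<rbrakk> \<Longrightarrow> f (x \<oplus>\<^bsub>V\<^esub> y) = f x \<oplus>\<^bsub>W\<^esub> f y"
    "\<And>c x. \<lbrakk>c \<in> carrier K; x \<in> carrier V\<rbrakk> \<Longrightarrow> f (c \<odot>\<^bsub>V\<^esub> x) = c \<odot>\<^bsub>W\<^esub> f x"
    "f \<zero>\<^bsub>V\<^esub> = \<zero>\<^bsub>W\<^esub>"
    "\<And>x y. \<lbrakk>x \<in> carrier V; y \<in> carrier V\<rbrakk> \<Longrightarrow> f (x \<ominus>\<^bsub>V\<^esub> y) = f x \<ominus>\<^bsub>W\<^esub> f y"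
proof -
  interpret linear_map K V W f by fact
  show "vectorspace K V" "vectorspace K W" "f \<in> module_hom K V W"
    using assms by (auto simp: linear_map_iff)
  show "\<And>x. x \<in> carrier V \<Longrightarrow> f x \<in> carrier W"
    "\<And>x y. \<lbrakk>x \<in> carrier V; y \<in> carrier V\<rbrakk> \<Longrightarrow> f (x \<oplus>\<^bsub>V\<^esub> y) = f x \<oplus>\<^bsub>W\<^esub> f y"
    "\<And>c x. \<lbrakk>c \<in> carrier K; x \<in> carrier V\<rbrakk> \<Longrightarrow> f (c \<odot>\<^bsub>V\<^esub> x) = c \<odot>\<^bsub>W\<^esub> f x"
    "f \<zero>\<^bsub>V\<^esub> = \<zero>\<^bsub>W\<^esub>"
    "\<And>x y. \<lbrakk>x \<in> carrier V; y \<in> carrier V\<rbrakk> \<Longrightarrow> f (x \<ominus>\<^bsub>V\<^esub> y) = f x \<ominus>\<^bsub>W\<^esub> f y"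
    by simp_all
qed

text \<open>Transport of structure: every vector space axiom for \<open>W\<close> is pulled back to
  \<open>V\<close> through preimages. Quotient spaces are shown to be vector spaces this way, with
  no axiom checked on cosets.\<close>

lemma linear_map_onto:
  assumes V: "vectorspace K V" and img: "f ` carrier V = carrier W"
    and add: "\<And>x y. \<lbrakk>x \<in> carrier V; y \<in> carrier V\<rbrakk> \<Longrightarrow> f (x \<oplus>\<^bsub>V\<^esub> y) = f x \<oplus>\<^bsub>W\<^esub> f y"
    and zero: "f \<zero>\<^bsub>V\<^esub> = \<zero>\<^bsub>W\<^esub>"
    and smult: "\<And>c x. \<lbrakk>c \<in> carrier K; x \<in> carrier V\<rbrakk> \<Longrightarrow> f (c \<odot>\<^bsub>V\<^esub> x) = c \<odot>\<^bsub>W\<^esub> f x"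
  shows "linear_map K V W f"
proof -
  interpret vectorspace K V by fact
  have "vectorspace K W"
    unfolding vectorspace_def module_def module_axioms_def
  proof (intro conjI allI impI abelian_groupI)
    fix x y z
    assume "x \<in> carrier W" "y \<in> carrier W" "z \<in> carrier W"
    then obtain a b c where "x = f a" "y = f b" "z = f c"
      "a \<in> carrier V" "b \<in> carrier V" "c \<in> carrier V"
      unfolding img[symmetric] by blast
    then show "(x \<oplus>\<^bsub>W\<^esub> y) \<oplus>\<^bsub>W\<^esub> z = x \<oplus>\<^bsub>W\<^esub> (y \<oplus>\<^bsub>W\<^esub> z)"
      by (simp add: M.a_assoc flip: add)
  next
    fix x y assume "x \<in> carrier W" "y \<in> carrier W"
    then obtain a b where *: "x = f a" "y = f b" "a \<in> carrier V" "b \<in> carrier V"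
      unfolding img[symmetric] by blast
    then show "x \<oplus>\<^bsub>W\<^esub> y = y \<oplus>\<^bsub>W\<^esub> x" by (simp add: M.a_comm flip: add)
    show "x \<oplus>\<^bsub>W\<^esub> y \<in> carrier W" using * by (simp flip: add img)
    fix r assume "r \<in> carrier K"
    with * show "r \<odot>\<^bsub>W\<^esub> (x \<oplus>\<^bsub>W\<^esub> y) = r \<odot>\<^bsub>W\<^esub> x \<oplus>\<^bsub>W\<^esub> r \<odot>\<^bsub>W\<^esub> y"
      by (simp add: smult_r_distr flip: add smult)
  next
    fix x assume "x \<in> carrier W"
    then obtain a where *: "x = f a" "a \<in> carrier V" unfolding img[symmetric] by blast
    then show "\<zero>\<^bsub>W\<^esub> \<oplus>\<^bsub>W\<^esub> x = x" by (simp flip: add zero)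
    show "\<one>\<^bsub>K\<^esub> \<odot>\<^bsub>W\<^esub> x = x" using * by (simp flip: smult)
    have "f (\<ominus>\<^bsub>V\<^esub> a) \<oplus>\<^bsub>W\<^esub> x = \<zero>\<^bsub>W\<^esub>" using * by (simp add: M.l_neg zero flip: add)
    then show "\<exists>y\<in>carrier W. y \<oplus>\<^bsub>W\<^esub> x = \<zero>\<^bsub>W\<^esub>" using * by (auto simp flip: img)
    fix r assume r: "r \<in> carrier K"
    with * show "r \<odot>\<^bsub>W\<^esub> x \<in> carrier W" by (simp flip: smult img)
    fix s assume s: "s \<in> carrier K"
    show "(r \<oplus>\<^bsub>K\<^esub> s) \<odot>\<^bsub>W\<^esub> x = r \<odot>\<^bsub>W\<^esub> x \<oplus>\<^bsub>W\<^esub> s \<odot>\<^bsub>W\<^esub> x"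
      using * r s by (simp add: smult_l_distr flip: add smult)
    show "(r \<otimes>\<^bsub>K\<^esub> s) \<odot>\<^bsub>W\<^esub> x = r \<odot>\<^bsub>W\<^esub> (s \<odot>\<^bsub>W\<^esub> x)"
      using * r s by (simp add: smult_assoc1 flip: smult)
  next
    show "\<zero>\<^bsub>W\<^esub> \<in> carrier W" using img zero M.zero_closed by (metis imageI)
    show "cring K" using V unfolding vectorspace_def module_def by blast
    show "field K" by (rule field_axioms)
  qed
  then show ?thesis
    unfolding linear_map_iff using V img add smult by (auto intro!: module_homI)
qed

lemma linear_map_image_subspace:
  assumes f: "linear_map K V W f" and U: "subspace K U V"
  shows "subspace K (f ` U) W"
proof -
  interpret W: vectorspace K W using f by (rule linear_mapD)
  note l = linear_mapD[OF f] and u = subspaceD[OF U]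
  show ?thesis
  proof (rule W.subspaceI)
    show "f ` U \<subseteq> carrier W" using l(4) u(4) by blast
    show "\<zero>\<^bsub>W\<^esub> \<in> f ` U" using l(7) u(3) by (metis imageI)
    show "\<And>c x. \<lbrakk>c \<in> carrier K; x \<in> f ` U\<rbrakk> \<Longrightarrow> c \<odot>\<^bsub>W\<^esub> x \<in> f ` U"
      using u(4,6) by (auto simp flip: l(6))
    show "\<And>x y. \<lbrakk>x \<in> f ` U; y \<in> f ` U\<rbrakk> \<Longrightarrow> x \<oplus>\<^bsub>W\<^esub> y \<in> f ` U"
      using u(4,5) by (auto simp flip: l(5))
  qed
qed

lemma linear_map_vimage_subspace:
  assumes f: "linear_map K V W f" and U: "subspace K U W"
  shows "subspace K {x \<in> carrier V. f x \<in> U} V"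
proof -
  interpret V: vectorspace K V using f by (rule linear_mapD)
  note l = linear_mapD[OF f] and u = subspaceD[OF U]
  show ?thesis
    by (rule V.subspaceI) (auto simp: l(5-7) u(3,5,6))
qed

lemma linear_map_image_span:
  assumes f: "linear_map K V W f" and S: "S \<subseteq> carrier V"
  shows "f ` module.span K V S = module.span K W (f ` S)"
proof -
  interpret V: vectorspace K V using f by (rule linear_mapD)
  interpret W: vectorspace K W using f by (rule linear_mapD)
  have fS: "f ` S \<subseteq> carrier W" using linear_mapD(4)[OF f] S by blast
  have "W.span (f ` S) \<subseteq> f ` V.span S"
    using V.in_own_span[OF S]
    by (intro W.span_le linear_map_image_subspace[OF f] V.span_subspace S) blast
  moreover have "V.span S \<subseteq> {x \<in> carrier V. f x \<in> W.span (f ` S)}"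
    using W.in_own_span[OF fS] S
    by (intro V.span_le linear_map_vimage_subspace[OF f] W.span_subspace fS) blast
  ultimately show ?thesis by blast
qed

lemma linear_map_restrict:
  assumes f: "linear_map K V W f" and A: "subspace K A V" and B: "subspace K B W"
    and AB: "\<And>x. x \<in> A \<Longrightarrow> f x \<in> B"
  shows "linear_map K (V\<lparr>carrier := A\<rparr>) (W\<lparr>carrier := B\<rparr>) f"
  unfolding linear_map_iff
  by (intro conjI module_homI subspaceD(7)[OF A] subspaceD(7)[OF B])
    (simp_all add: AB linear_mapD(5,6)[OF f] subspaceD(4)[OF A])

lemma linear_map_compose:
  assumes "linear_map K V W f" "linear_map K W U g"
  shows "linear_map K V U (\<lambda>x. g (f x))"
  unfolding linear_map_iff
  by (intro conjI module_homI linear_mapD(1)[OF assms(1)] linear_mapD(2)[OF assms(2)])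
    (simp_all add: linear_mapD(4-6)[OF assms(1)] linear_mapD(4-6)[OF assms(2)])

text \<open>Lifts of a finite generating set of \<open>W\<close>, together with \<open>P\<close>,
  span \<open>V\<close>. The set \<open>P\<close> may reach outside the kernel: in the application
  it consists of products of chosen lifts.\<close>

lemma fin_dim_if_kernel_in_finite_span:
  assumes f: "linear_map K V W f" and surj: "f ` carrier V = carrier W"
    and W: "vectorspace.fin_dim K W" and P: "finite P" "P \<subseteq> carrier V"
    and ker: "\<And>x. \<lbrakk>x \<in> carrier V; f x = \<zero>\<^bsub>W\<^esub>\<rbrakk> \<Longrightarrow> x \<in> module.span K V P"
  shows "vectorspace.fin_dim K V"
proof -
  interpret V: vectorspace K V using f by (rule linear_mapD)
  interpret W: vectorspace K W using f by (rule linear_mapD)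
  note l = linear_mapD[OF f]
  obtain G where G: "finite G" "G \<subseteq> carrier W" "W.span G = carrier W"
    using W unfolding W.fin_dim_def by blast
  obtain B where B: "finite B" "B \<subseteq> carrier V" "f ` B = G"
    using finite_subset_image[OF G(1) G(2)[folded surj]] by metis
  have BP: "B \<union> P \<subseteq> carrier V" using B P by blast
  note sub = V.span_subspace[OF BP]
  have "carrier V \<subseteq> V.span (B \<union> P)"
  proof
    fix x assume x: "x \<in> carrier V"
    then have "f x \<in> f ` V.span B"
      unfolding linear_map_image_span[OF f B(2)] B(3) G(3) using l(4) by blast
    then obtain y where y: "y \<in> V.span B" "f x = f y" by blast
    have yc: "y \<in> carrier V" using y B V.span_closed by blast
    have "x \<ominus>\<^bsub>V\<^esub> y \<in> V.span P"
      using l x yc y by (intro ker) (auto simp: a_minus_def W.M.r_neg)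
    then have "x \<ominus>\<^bsub>V\<^esub> y \<in> V.span (B \<union> P)" "y \<in> V.span (B \<union> P)"
      using V.span_is_monotone y by blast+
    then have "(x \<ominus>\<^bsub>V\<^esub> y) \<oplus>\<^bsub>V\<^esub> y \<in> V.span (B \<union> P)"
      using subspaceD(5)[OF sub] by blast
    moreover have "(x \<ominus>\<^bsub>V\<^esub> y) \<oplus>\<^bsub>V\<^esub> y = x"
      using x yc by (simp add: a_minus_def V.M.a_assoc V.M.l_neg)
    ultimately show "x \<in> V.span (B \<union> P)" by simp
  qed
  then have "V.span (B \<union> P) = carrier V" using subspaceD(2)[OF sub] by blast
  then show ?thesis unfolding V.fin_dim_def using B(1) P(1) BP by blast
qed

lemma dim_surj:
  assumes f: "linear_map K V W f" and surj: "f ` carrier V = carrier W"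
    and fd: "vectorspace.fin_dim K V"
  shows "vectorspace.dim K V = vectorspace.dim K W +
    vectorspace.dim K (V\<lparr>carrier := {x \<in> carrier V. f x = \<zero>\<^bsub>W\<^esub>}\<rparr>)"
proof -
  interpret linear_map K V W f by fact
  show ?thesis
    using rank_nullity[OF fd] surj unfolding im_def ker_def by simp
qed


section \<open>Quotient spaces\<close>

text \<open>Quotients occur both as plain modules (\<open>quot_space\<close>) and as algebras
  (\<open>quot_algebra\<close>), which are records of different types. Fixing just the fields
  relevant to linear algebra lets one set of lemmas serve both.\<close>

definition is_quotient ::
  "('a, 'v, 'm) module_scheme \<Rightarrow> 'v set \<Rightarrow> ('a, 'v set, 'n) module_scheme \<Rightarrow> bool" where
  "is_quotient V U Q \<longleftrightarrow> carrier Q = a_rcosets\<^bsub>V\<^esub> U \<and> add Q = set_add V \<and> zero Q = U \<and>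
    smult Q = (\<lambda>c A. \<Union>a\<in>A. U +>\<^bsub>V\<^esub> (c \<odot>\<^bsub>V\<^esub> a))"

lemma is_quotient_quot_space: "is_quotient V U (quot_space V U)"
  by (simp add: is_quotient_def quot_space_def)

lemma is_quotient_quot_algebra: "is_quotient L I (quot_algebra L I)"
  by (simp add: is_quotient_def)

text \<open>Cosets depend only on the addition, so the elements of
  \<open>mult_of_presentation\<close> are literally cosets in \<open>F\<close>, although the
  quotient is taken of a subspace of \<open>F\<close>.\<close>

lemma a_r_coset_carrier_update [simp]: "U +>\<^bsub>V\<lparr>carrier := A\<rparr>\<^esub> x = U +>\<^bsub>V\<^esub> x"
  by (simp add: a_r_coset_def')

lemma set_add_carrier_update [simp]: "set_add (V\<lparr>carrier := A\<rparr>) = set_add V"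
  by (intro ext) (simp add: set_add_def')

lemma a_rcosets_eq_image: "a_rcosets\<^bsub>V\<^esub> U = (\<lambda>x. U +>\<^bsub>V\<^esub> x) ` carrier V"
  by (auto simp: A_RCOSETS_def' a_r_coset_def')

lemma induced_map_coset:
  assumes "U \<noteq> {}" "\<And>u. u \<in> U \<Longrightarrow> f (u \<oplus>\<^bsub>V\<^esub> x) = y"
  shows "induced_map f (U +>\<^bsub>V\<^esub> x) = y"
proof -
  have "f ` (U +>\<^bsub>V\<^esub> x) = {y}" using assms by (auto simp: a_r_coset_def')
  then show ?thesis by (simp add: induced_map_def)
qed

context vectorspace
begin

lemma subspace_abelian_subgroup:
  assumes "subspace K U V"
  shows "abelian_subgroup U V"
proof (rule abelian_subgroupI3)
  show "abelian_group V" by (rule M.abelian_group_axioms)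
  show "additive_subgroup U V"
  proof (rule additive_subgroupI, rule subgroup.intro)
    fix x assume x: "x \<in> U"
    show "inv\<^bsub>add_monoid V\<^esub> x \<in> U"
      using subspace_uminus[OF assms x] by (simp add: a_inv_def)
  qed (use subspaceD[OF assms] in auto)
qed

lemma coset_mem:
  assumes U: "subspace K U V" and x: "x \<in> carrier V"
  shows "x \<in> U +>\<^bsub>V\<^esub> x"
  using abelian_subgroup.a_rcos_self[OF subspace_abelian_subgroup[OF U]] x .

lemma coset_eq_iff:
  assumes U: "subspace K U V" and x: "x \<in> carrier V" and y: "y \<in> carrier V"
  shows "U +>\<^bsub>V\<^esub> x = U +>\<^bsub>V\<^esub> y \<longleftrightarrow> x \<ominus>\<^bsub>V\<^esub> y \<in> U"
proof -
  interpret U: abelian_subgroup U V by (rule subspace_abelian_subgroup[OF U])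
  have "x \<in> U +>\<^bsub>V\<^esub> y \<longleftrightarrow> x \<ominus>\<^bsub>V\<^esub> y \<in> U"
    using U.a_rcos_module[OF y x] by (simp add: a_minus_def)
  then show ?thesis
    using U.a_repr_independence'[OF _ y] coset_mem[OF U x] by metis
qed

lemma coset_eqI:
  assumes U: "subspace K U V" and u: "u \<in> U" and x: "x \<in> carrier V"
  shows "U +>\<^bsub>V\<^esub> (u \<oplus>\<^bsub>V\<^esub> x) = U +>\<^bsub>V\<^esub> x"
  using coset_eq_iff[OF U _ x, of "u \<oplus>\<^bsub>V\<^esub> x"] subspaceD(4)[OF U u] u x
  by (simp add: a_minus_def M.a_assoc M.r_neg)

lemma coset_zero_iff:
  assumes U: "subspace K U V" and x: "x \<in> carrier V"
  shows "U +>\<^bsub>V\<^esub> x = U \<longleftrightarrow> x \<in> U"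
proof -
  have "U +>\<^bsub>V\<^esub> \<zero>\<^bsub>V\<^esub> = U"
    using M.a_coset_add_zero subspaceD(2)[OF U] by blast
  moreover have "x \<ominus>\<^bsub>V\<^esub> \<zero>\<^bsub>V\<^esub> = x"
    using M.r_neg1[of "\<zero>\<^bsub>V\<^esub>" "\<ominus>\<^bsub>V\<^esub> \<zero>\<^bsub>V\<^esub>"] x by (simp add: a_minus_def M.r_neg)
  ultimately show ?thesis using coset_eq_iff[OF U x, of "\<zero>\<^bsub>V\<^esub>"] by simp
qed

lemma quotient_map_linear:
  assumes U: "subspace K U V" and Q: "is_quotient V U Q"
  shows "linear_map K V Q (\<lambda>x. U +>\<^bsub>V\<^esub> x)"
proof (rule linear_map_onto)
  interpret U: abelian_subgroup U V by (rule subspace_abelian_subgroup[OF U])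
  note q = Q[unfolded is_quotient_def]
  show "vectorspace K V" ..
  show "(\<lambda>x. U +>\<^bsub>V\<^esub> x) ` carrier V = carrier Q" using q by (simp add: a_rcosets_eq_image)
  show "U +>\<^bsub>V\<^esub> (x \<oplus>\<^bsub>V\<^esub> y) = (U +>\<^bsub>V\<^esub> x) \<oplus>\<^bsub>Q\<^esub> (U +>\<^bsub>V\<^esub> y)"
    if "x \<in> carrier V" "y \<in> carrier V" for x y
    using q U.a_rcos_sum[OF that] by simp
  show "U +>\<^bsub>V\<^esub> \<zero>\<^bsub>V\<^esub> = \<zero>\<^bsub>Q\<^esub>" using q coset_zero_iff[OF U] subspaceD(3)[OF U] by simp
  show "U +>\<^bsub>V\<^esub> (c \<odot>\<^bsub>V\<^esub> x) = c \<odot>\<^bsub>Q\<^esub> (U +>\<^bsub>V\<^esub> x)"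
    if c: "c \<in> carrier K" and x: "x \<in> carrier V" for c x
  proof -
    \<comment> \<open>The scalar multiple of a coset is defined as a union over all representatives;
      each of them contributes the same coset.\<close>
    have "U +>\<^bsub>V\<^esub> (c \<odot>\<^bsub>V\<^esub> a) = U +>\<^bsub>V\<^esub> (c \<odot>\<^bsub>V\<^esub> x)" if a: "a \<in> U +>\<^bsub>V\<^esub> x" for a
    proof -
      obtain u where u: "u \<in> U" "a = u \<oplus>\<^bsub>V\<^esub> x" using a by (auto simp: a_r_coset_def')
      then have "c \<odot>\<^bsub>V\<^esub> a = c \<odot>\<^bsub>V\<^esub> u \<oplus>\<^bsub>V\<^esub> c \<odot>\<^bsub>V\<^esub> x"
        using c x subspaceD(4)[OF U] by (simp add: smult_r_distr)
      then show ?thesis using coset_eqI[OF U] subspaceD(6)[OF U c u(1)] c x by simp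
    qed
    moreover have "x \<in> U +>\<^bsub>V\<^esub> x" using coset_mem[OF U x] .
    ultimately have "(\<Union>a\<in>U +>\<^bsub>V\<^esub> x. U +>\<^bsub>V\<^esub> (c \<odot>\<^bsub>V\<^esub> a)) = U +>\<^bsub>V\<^esub> (c \<odot>\<^bsub>V\<^esub> x)"
      by blast
    then show ?thesis using q by simp
  qed
qed

lemma is_quotient_carrier:
  "is_quotient V U Q \<Longrightarrow> carrier Q = (\<lambda>x. U +>\<^bsub>V\<^esub> x) ` carrier V"
  by (simp add: is_quotient_def a_rcosets_eq_image)

lemma linear_induced_map:
  assumes U: "subspace K U V" and f: "linear_map K V W f"
    and ker: "\<And>u. u \<in> U \<Longrightarrow> f u = \<zero>\<^bsub>W\<^esub>" and x: "x \<in> carrier V"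
  shows "induced_map f (U +>\<^bsub>V\<^esub> x) = f x"
proof (rule induced_map_coset)
  interpret W: vectorspace K W using f by (rule linear_mapD)
  show "U \<noteq> {}" using subspaceD(3)[OF U] by blast
  show "f (u \<oplus>\<^bsub>V\<^esub> x) = f x" if "u \<in> U" for u
    using that ker x linear_mapD[OF f] subspaceD(4)[OF U] by simp
qed

lemma induced_map_linear:
  assumes U: "subspace K U V" and Q: "is_quotient V U Q" and f: "linear_map K V W f"
    and ker: "\<And>u. u \<in> U \<Longrightarrow> f u = \<zero>\<^bsub>W\<^esub>"
  shows "linear_map K Q W (induced_map f)"
proof -
  note q = linear_mapD[OF quotient_map_linear[OF U Q]] and l = linear_mapD[OF f]
  note i = linear_induced_map[OF U f ker]
  show ?thesis
    unfolding linear_map_iff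
  proof (intro conjI module_homI)
    show "induced_map f A \<in> carrier W" if "A \<in> carrier Q" for A
      using that i l(4) unfolding is_quotient_carrier[OF Q] by auto
    show "induced_map f (A \<oplus>\<^bsub>Q\<^esub> B) = induced_map f A \<oplus>\<^bsub>W\<^esub> induced_map f B"
      if "A \<in> carrier Q" "B \<in> carrier Q" for A B
      using that i l(5) unfolding is_quotient_carrier[OF Q] by (auto simp flip: q(5))
    show "induced_map f (c \<odot>\<^bsub>Q\<^esub> A) = c \<odot>\<^bsub>W\<^esub> induced_map f A"
      if "c \<in> carrier K" "A \<in> carrier Q" for c A
      using that i l(6) unfolding is_quotient_carrier[OF Q] by (auto simp flip: q(6))
  qed (use q l in auto)
qed

end

section \<open>Tensor products\<close>

lemma free_space_simps:
  assumes "field K"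
  shows "carrier (free_space K S) = {p \<in> S \<rightarrow>\<^sub>E carrier K. finite {s \<in> S. p s \<noteq> \<zero>\<^bsub>K\<^esub>}}"
    "add (free_space K S) = (\<lambda>f g. \<lambda>s\<in>S. f s \<oplus>\<^bsub>K\<^esub> g s)"
    "zero (free_space K S) = (\<lambda>s\<in>S. \<zero>\<^bsub>K\<^esub>)"
    "smult (free_space K S) = (\<lambda>c f. \<lambda>s\<in>S. c \<otimes>\<^bsub>K\<^esub> f s)"
proof -
  interpret field K by fact
  show "carrier (free_space K S) = {p \<in> S \<rightarrow>\<^sub>E carrier K. finite {s \<in> S. p s \<noteq> \<zero>\<^bsub>K\<^esub>}}"
    "add (free_space K S) = (\<lambda>f g. \<lambda>s\<in>S. f s \<oplus>\<^bsub>K\<^esub> g s)"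
    "zero (free_space K S) = (\<lambda>s\<in>S. \<zero>\<^bsub>K\<^esub>)"
    "smult (free_space K S) = (\<lambda>c f. \<lambda>s\<in>S. c \<otimes>\<^bsub>K\<^esub> f s)"
    by (simp_all add: free_space_def func_space_def)
qed

lemma free_space_vectorspace:
  assumes "field K"
  shows "vectorspace K (free_space K S)"
proof -
  interpret field K by fact
  let ?P = "{p \<in> S \<rightarrow>\<^sub>E carrier K. finite {s \<in> S. p s \<noteq> \<zero>\<^bsub>K\<^esub>}}"
  interpret F: module K "func_space S" by (rule func_space_is_module)
  have "submodule K ?P (func_space S)"
  proof (rule submodule.intro)
    fix p q assume p: "p \<in> ?P" and q: "q \<in> ?P"
    have "finite {s \<in> S. p s \<oplus>\<^bsub>K\<^esub> q s \<noteq> \<zero>\<^bsub>K\<^esub>}"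
      by (rule finite_subset[of _ "{s \<in> S. p s \<noteq> \<zero>\<^bsub>K\<^esub>} \<union> {s \<in> S. q s \<noteq> \<zero>\<^bsub>K\<^esub>}"]) (use p q in auto)
    moreover have "{s \<in> S. (p \<oplus>\<^bsub>func_space S\<^esub> q) s \<noteq> \<zero>\<^bsub>K\<^esub>} = {s \<in> S. p s \<oplus>\<^bsub>K\<^esub> q s \<noteq> \<zero>\<^bsub>K\<^esub>}"
      by (auto simp: func_space_def)
    ultimately show "p \<oplus>\<^bsub>func_space S\<^esub> q \<in> ?P"
      using p q F.a_closed[of p q] by (auto simp: func_space_def)
  next
    fix c p assume c: "c \<in> carrier K" and p: "p \<in> ?P"
    have "finite {s \<in> S. c \<otimes>\<^bsub>K\<^esub> p s \<noteq> \<zero>\<^bsub>K\<^esub>}"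
      by (rule finite_subset[of _ "{s \<in> S. p s \<noteq> \<zero>\<^bsub>K\<^esub>}"]) (use c p in auto)
    moreover have "{s \<in> S. (c \<odot>\<^bsub>func_space S\<^esub> p) s \<noteq> \<zero>\<^bsub>K\<^esub>} = {s \<in> S. c \<otimes>\<^bsub>K\<^esub> p s \<noteq> \<zero>\<^bsub>K\<^esub>}"
      by (auto simp: func_space_def)
    ultimately show "c \<odot>\<^bsub>func_space S\<^esub> p \<in> ?P"
      using c p F.smult_closed[of c p] by (auto simp: func_space_def)
  next
    have "{s \<in> S. \<zero>\<^bsub>func_space S\<^esub> s \<noteq> \<zero>\<^bsub>K\<^esub>} = {}" by (auto simp: func_space_def)
    then show "\<zero>\<^bsub>func_space S\<^esub> \<in> ?P"
      using F.M.zero_closed by (auto simp: func_space_def)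
  qed (auto simp: func_space_def F.module_axioms[unfolded func_space_def])
  then have "module K (free_space K S)"
    unfolding free_space_def by (rule F.submodule_is_module)
  then show ?thesis unfolding vectorspace_def using assms by blast
qed

lemma free_gen_closed:
  assumes "field K" "s \<in> S"
  shows "free_gen K S s \<in> carrier (free_space K S)"
proof -
  interpret field K by fact
  have "finite {t \<in> S. free_gen K S s t \<noteq> \<zero>\<^bsub>K\<^esub>}"
    by (rule finite_subset[of _ "{s}"]) (auto simp: free_gen_def)
  then show ?thesis
    by (auto simp: free_space_simps[OF assms(1)] free_gen_def)
qed

text \<open>This is the expression under \<open>induced_map\<close> in \<open>tensor_lift\<close>,
  isolated so that it can be studied on the free space before descending to the tensor
  product.\<close>

definition linear_extension ::
  "('a, 'r) ring_scheme \<Rightarrow> 's set \<Rightarrow> ('a, 'u, 'm) module_scheme \<Rightarrow> ('s \<Rightarrow> 'u) \<Rightarrow> ('s \<Rightarrow> 'a) \<Rightarrow> 'u" where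
  "linear_extension K S U \<beta> p = (\<Oplus>\<^bsub>U\<^esub>s \<in> {s \<in> S. p s \<noteq> \<zero>\<^bsub>K\<^esub>}. p s \<odot>\<^bsub>U\<^esub> \<beta> s)"

context vectorspace
begin

text \<open>The defining sum runs over the support, which changes with \<open>p\<close>. Enlarging
  it by zero terms to any finite \<open>A\<close> gives different functions a common index set, as
  additivity requires.\<close>

lemma linear_extension_eq:
  assumes \<beta>: "\<beta> \<in> S \<rightarrow> carrier V" and p: "p \<in> S \<rightarrow> carrier K"
    and A: "finite A" "A \<subseteq> S" "{s \<in> S. p s \<noteq> \<zero>\<^bsub>K\<^esub>} \<subseteq> A"
  shows "linear_extension K S V \<beta> p = (\<Oplus>\<^bsub>V\<^esub>s\<in>A. p s \<odot>\<^bsub>V\<^esub> \<beta> s)"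
  unfolding linear_extension_def
proof (rule M.add.finprod_mono_neutral_cong_left[OF A(1,3)])
  show "\<And>i. i \<in> A - {s \<in> S. p s \<noteq> \<zero>\<^bsub>K\<^esub>} \<Longrightarrow> p i \<odot>\<^bsub>V\<^esub> \<beta> i = \<zero>\<^bsub>V\<^esub>" using \<beta> A(2) by (auto simp: Pi_iff subset_iff)
  show "(\<lambda>s. p s \<odot>\<^bsub>V\<^esub> \<beta> s) \<in> A \<rightarrow> carrier V" using \<beta> p A(2) by (auto simp: Pi_iff subset_iff)
qed simp

lemma linear_extension_linear:
  assumes \<beta>: "\<beta> \<in> S \<rightarrow> carrier V"
  shows "linear_map K (free_space K S) V (linear_extension K S V \<beta>)"
  unfolding linear_map_iff
proof (intro conjI module_homI)
  have K: "field K" by (rule field_axioms)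
  note P = free_space_simps[OF K, of S]
  show "vectorspace K (free_space K S)" by (rule free_space_vectorspace[OF K])
  show "vectorspace K V" ..
  fix p assume "p \<in> carrier (free_space K S)"
  then have p: "p \<in> S \<rightarrow> carrier K" "finite {s \<in> S. p s \<noteq> \<zero>\<^bsub>K\<^esub>}" unfolding P by auto
  show "linear_extension K S V \<beta> p \<in> carrier V"
    unfolding linear_extension_def using \<beta> p by (intro M.finsum_closed) auto
  {
    fix q assume "q \<in> carrier (free_space K S)"
    then have q: "q \<in> S \<rightarrow> carrier K" "finite {s \<in> S. q s \<noteq> \<zero>\<^bsub>K\<^esub>}" unfolding P by auto
    define A where "A = {s \<in> S. p s \<noteq> \<zero>\<^bsub>K\<^esub>} \<union> {s \<in> S. q s \<noteq> \<zero>\<^bsub>K\<^esub>}"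
    have A: "finite A" "A \<subseteq> S" using p q by (auto simp: A_def)
    have pq: "(p \<oplus>\<^bsub>free_space K S\<^esub> q) s = p s \<oplus>\<^bsub>K\<^esub> q s" if "s \<in> S" for s using that by (simp add: P)
    have "linear_extension K S V \<beta> (p \<oplus>\<^bsub>free_space K S\<^esub> q)
        = (\<Oplus>\<^bsub>V\<^esub>s\<in>A. (p \<oplus>\<^bsub>free_space K S\<^esub> q) s \<odot>\<^bsub>V\<^esub> \<beta> s)"
      by (rule linear_extension_eq[OF \<beta> _ A]) (use p q in \<open>auto simp: A_def P\<close>)
    also have "\<dots> = (\<Oplus>\<^bsub>V\<^esub>s\<in>A. p s \<odot>\<^bsub>V\<^esub> \<beta> s \<oplus>\<^bsub>V\<^esub> q s \<odot>\<^bsub>V\<^esub> \<beta> s)"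
      using p q \<beta> A by (intro M.finsum_cong') (auto simp: pq smult_l_distr Pi_iff subset_iff)
    also have "\<dots> = (\<Oplus>\<^bsub>V\<^esub>s\<in>A. p s \<odot>\<^bsub>V\<^esub> \<beta> s) \<oplus>\<^bsub>V\<^esub> (\<Oplus>\<^bsub>V\<^esub>s\<in>A. q s \<odot>\<^bsub>V\<^esub> \<beta> s)"
      using p q \<beta> A by (intro M.finsum_addf) (auto simp: Pi_iff subset_iff)
    also have "(\<Oplus>\<^bsub>V\<^esub>s\<in>A. p s \<odot>\<^bsub>V\<^esub> \<beta> s) = linear_extension K S V \<beta> p"
      by (rule linear_extension_eq[OF \<beta> p(1) A, symmetric]) (auto simp: A_def)
    also have "(\<Oplus>\<^bsub>V\<^esub>s\<in>A. q s \<odot>\<^bsub>V\<^esub> \<beta> s) = linear_extension K S V \<beta> q"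
      by (rule linear_extension_eq[OF \<beta> q(1) A, symmetric]) (auto simp: A_def)
    finally show "linear_extension K S V \<beta> (p \<oplus>\<^bsub>free_space K S\<^esub> q)
      = linear_extension K S V \<beta> p \<oplus>\<^bsub>V\<^esub> linear_extension K S V \<beta> q" .
  }
  fix c assume c: "c \<in> carrier K"
  define A where "A = {s \<in> S. p s \<noteq> \<zero>\<^bsub>K\<^esub>}"
  have A: "finite A" "A \<subseteq> S" using p by (auto simp: A_def)
  have cp: "(c \<odot>\<^bsub>free_space K S\<^esub> p) s = c \<otimes>\<^bsub>K\<^esub> p s" if "s \<in> S" for s using that by (simp add: P)
  have "linear_extension K S V \<beta> (c \<odot>\<^bsub>free_space K S\<^esub> p)
      = (\<Oplus>\<^bsub>V\<^esub>s\<in>A. (c \<odot>\<^bsub>free_space K S\<^esub> p) s \<odot>\<^bsub>V\<^esub> \<beta> s)"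
    by (rule linear_extension_eq[OF \<beta> _ A]) (use p c in \<open>auto simp: A_def P\<close>)
  also have "\<dots> = (\<Oplus>\<^bsub>V\<^esub>s\<in>A. c \<odot>\<^bsub>V\<^esub> (p s \<odot>\<^bsub>V\<^esub> \<beta> s))"
    using p c \<beta> A by (intro M.finsum_cong') (auto simp: cp smult_assoc1 Pi_iff subset_iff)
  also have "\<dots> = c \<odot>\<^bsub>V\<^esub> (\<Oplus>\<^bsub>V\<^esub>s\<in>A. p s \<odot>\<^bsub>V\<^esub> \<beta> s)"
    using p c \<beta> A by (intro finsum_smult[symmetric]) (auto simp: Pi_iff subset_iff)
  finally show "linear_extension K S V \<beta> (c \<odot>\<^bsub>free_space K S\<^esub> p) = c \<odot>\<^bsub>V\<^esub> linear_extension K S V \<beta> p"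
    unfolding linear_extension_def A_def .
qed

lemma linear_extension_gen:
  assumes \<beta>: "\<beta> \<in> S \<rightarrow> carrier V" and s: "s \<in> S"
  shows "linear_extension K S V \<beta> (free_gen K S s) = \<beta> s"
proof -
  have "linear_extension K S V \<beta> (free_gen K S s) = (\<Oplus>\<^bsub>V\<^esub>t\<in>{s}. free_gen K S s t \<odot>\<^bsub>V\<^esub> \<beta> t)"
    by (rule linear_extension_eq[OF \<beta>]) (use s in \<open>auto simp: free_gen_def\<close>)
  also have "\<dots> = \<beta> s"
    using s \<beta> by (auto simp: free_gen_def Pi_iff)
  finally show ?thesis .
qed

lemma finsum_in_subspace:
  assumes N: "subspace K N V" and f: "\<And>s. s \<in> A \<Longrightarrow> f s \<in> N"
  shows "(\<Oplus>\<^bsub>V\<^esub>s\<in>A. f s) \<in> N"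
  using f
\<comment> \<open>Over an infinite index set the sum has the default value zero, which lies in
  \<open>N\<close> just as the empty sum does.\<close>
proof (induction A rule: infinite_finite_induct)
  case (insert a A)
  then have "(\<Oplus>\<^bsub>V\<^esub>s\<in>insert a A. f s) = f a \<oplus>\<^bsub>V\<^esub> (\<Oplus>\<^bsub>V\<^esub>s\<in>A. f s)"
    using subspaceD(4)[OF N] by (intro M.finsum_insert) auto
  then show ?case using insert subspaceD(5)[OF N] by simp
qed (use subspaceD(3)[OF N] in auto)

end

definition bilinear_on ::
  "('a, 'r) ring_scheme \<Rightarrow> ('a, 'v, 'm) module_scheme \<Rightarrow> ('a, 'w, 'n) module_scheme
    \<Rightarrow> ('a, 'u, 'l) module_scheme \<Rightarrow> ('v \<Rightarrow> 'w \<Rightarrow> 'u) \<Rightarrow> bool" where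
  "bilinear_on K V W U b \<longleftrightarrow>
     (\<forall>v\<in>carrier V. (\<lambda>w. b v w) \<in> module_hom K W U) \<and> (\<forall>w\<in>carrier W. (\<lambda>v. b v w) \<in> module_hom K V U)"

lemma bilinear_onD:
  assumes "bilinear_on K V W U b"
  shows "\<And>v w. \<lbrakk>v \<in> carrier V; w \<in> carrier W\<rbrakk> \<Longrightarrow> b v w \<in> carrier U"
    "\<And>v v' w. \<lbrakk>v \<in> carrier V; v' \<in> carrier V; w \<in> carrier W\<rbrakk> \<Longrightarrow> b (v \<oplus>\<^bsub>V\<^esub> v') w = b v w \<oplus>\<^bsub>U\<^esub> b v' w"
    "\<And>v w w'. \<lbrakk>v \<in> carrier V; w \<in> carrier W; w' \<in> carrier W\<rbrakk> \<Longrightarrow> b v (w \<oplus>\<^bsub>W\<^esub> w') = b v w \<oplus>\<^bsub>U\<^esub> b v w'"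
    "\<And>c v w. \<lbrakk>c \<in> carrier K; v \<in> carrier V; w \<in> carrier W\<rbrakk> \<Longrightarrow> b (c \<odot>\<^bsub>V\<^esub> v) w = c \<odot>\<^bsub>U\<^esub> b v w"
    "\<And>c v w. \<lbrakk>c \<in> carrier K; v \<in> carrier V; w \<in> carrier W\<rbrakk> \<Longrightarrow> b v (c \<odot>\<^bsub>W\<^esub> w) = c \<odot>\<^bsub>U\<^esub> b v w"
  using assms by (auto simp: bilinear_on_def module_hom_def Pi_iff)

text \<open>The universal property of the tensor product. The image is the span of the values of
  \<open>b\<close>, since a general tensor is a sum of pure ones; this span is what identifies the
  image of \<theta> later.\<close>

lemma tensor_lift_linear:
  assumes V: "vectorspace K V" and W: "vectorspace K W" and U: "vectorspace K U"
    and b: "bilinear_on K V W U b"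
  shows "linear_map K (tensor K V W) U (tensor_lift K V W U b)"
    and "tensor_lift K V W U b ` carrier (tensor K V W)
      = module.span K U {b v w | v w. v \<in> carrier V \<and> w \<in> carrier W}"
proof -
  interpret V: vectorspace K V by fact
  interpret W: vectorspace K W by fact
  interpret U: vectorspace K U by fact
  have K: "field K" using U unfolding vectorspace_def by blast
  let ?S = "carrier V \<times> carrier W"
  let ?\<beta> = "\<lambda>s. b (fst s) (snd s)"
  let ?\<Lambda> = "linear_extension K ?S U ?\<beta>"
  let ?P = "free_space K ?S"
  let ?e = "free_gen K ?S"
  let ?B = "{b v w | v w. v \<in> carrier V \<and> w \<in> carrier W}"
  interpret P: vectorspace K ?P by (rule free_space_vectorspace[OF K])
  note bD = bilinear_onD[OF b]
  have \<beta>: "?\<beta> \<in> ?S \<rightarrow> carrier U" using bD(1) by auto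
  have \<Lambda>: "linear_map K ?P U ?\<Lambda>" by (rule U.linear_extension_linear[OF \<beta>])
  note l = linear_mapD[OF \<Lambda>]
  have e: "?e s \<in> carrier ?P" if "s \<in> ?S" for s by (rule free_gen_closed[OF K that])
  have \<Lambda>e: "?\<Lambda> (?e (v, w)) = b v w" if "v \<in> carrier V" "w \<in> carrier W" for v w
    using U.linear_extension_gen[OF \<beta>, of "(v, w)"] that by simp
  let ?J = "bilinear_relations K V W"
  \<comment> \<open>Each of the four families of relations is killed by one bilinearity law, so the
    extension vanishes on their span and descends to the quotient.\<close>
  have J: "r \<in> carrier ?P \<and> ?\<Lambda> r = \<zero>\<^bsub>U\<^esub>" if "r \<in> ?J" for r
    using that unfolding bilinear_relations_def Let_def
  proof (elim UnE CollectE exE conjE, goal_cases)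
    case (1 v v' w)
    then show ?case using e bD by (simp add: l \<Lambda>e)
  next
    case (2 v w w')
    then show ?case using e bD by (simp add: l \<Lambda>e)
  next
    case (3 c v w)
    then show ?case using e bD by (simp add: l \<Lambda>e)
  next
    case (4 c v w)
    then show ?case using e bD by (simp add: l \<Lambda>e)
  qed
  then have JP: "?J \<subseteq> carrier ?P" by blast
  have sub: "subspace K (P.span ?J) ?P" by (rule P.span_subspace[OF JP])
  have zero: "subspace K {\<zero>\<^bsub>U\<^esub>} U" by (rule U.subspaceI) auto
  have ker: "?\<Lambda> x = \<zero>\<^bsub>U\<^esub>" if "x \<in> P.span ?J" for x
    using P.span_le[OF _ linear_map_vimage_subspace[OF \<Lambda> zero], of ?J] J that by auto
  have T: "is_quotient ?P (P.span ?J) (tensor K V W)"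
    unfolding tensor_def Let_def by (rule is_quotient_quot_space)
  have lift: "tensor_lift K V W U b = induced_map ?\<Lambda>"
    unfolding tensor_lift_def linear_extension_def ..
  show "linear_map K (tensor K V W) U (tensor_lift K V W U b)"
    unfolding lift by (rule P.induced_map_linear[OF sub T \<Lambda> ker])
  have img: "tensor_lift K V W U b ` carrier (tensor K V W) = ?\<Lambda> ` carrier ?P"
    unfolding P.is_quotient_carrier[OF T] lift image_image
    using P.linear_induced_map[OF sub \<Lambda> ker] by (intro image_cong) auto
  have B: "?B \<subseteq> carrier U" using bD(1) by blast
  have "?\<Lambda> p \<in> U.span ?B" if "p \<in> carrier ?P" for p
    unfolding linear_extension_def
  proof (rule U.finsum_in_subspace[OF U.span_subspace[OF B]])
    fix s assume "s \<in> {s \<in> ?S. p s \<noteq> \<zero>\<^bsub>K\<^esub>}"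
    then have s: "s \<in> ?S" by simp
    then have "p s \<in> carrier K" "?\<beta> s \<in> ?B"
      using that unfolding free_space_simps[OF K] by (blast, force)
    then show "p s \<odot>\<^bsub>U\<^esub> ?\<beta> s \<in> U.span ?B"
      using U.in_own_span[OF B] subspaceD(6)[OF U.span_subspace[OF B]] by blast
  qed
  moreover have "?B \<subseteq> ?\<Lambda> ` carrier ?P"
  proof
    fix x assume "x \<in> ?B"
    then obtain v w where "v \<in> carrier V" "w \<in> carrier W" "x = ?\<Lambda> (?e (v, w))" using \<Lambda>e by auto
    then show "x \<in> ?\<Lambda> ` carrier ?P" using e by blast
  qed
  then have "U.span ?B \<subseteq> ?\<Lambda> ` carrier ?P"
    by (rule U.span_le[OF _ linear_map_image_subspace[OF \<Lambda> P.carrier_subspace]])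
  ultimately show "tensor_lift K V W U b ` carrier (tensor K V W) = U.span ?B"
    unfolding img by blast
qed

section \<open>Ideals, quotients and homomorphisms of triassociative algebras\<close>

lemma tri_productsI [simp]:
  "vd L \<in> tri_products L" "dv L \<in> tri_products L" "pp L \<in> tri_products L"
  by (auto simp: tri_products_def)

lemma tri_products_carrier_update [simp]: "tri_products (L\<lparr>carrier := A\<rparr>) = tri_products L"
  by (simp add: tri_products_def)

text \<open>Putting all three products into one generating set turns the sum of three spans in
  \<open>lozenge\<close> into a single span.\<close>

definition product_set :: "('a, 'v) triassoc \<Rightarrow> 'v set \<Rightarrow> 'v set \<Rightarrow> 'v set" where
  "product_set L S T = {op s t | op s t. op \<in> tri_products L \<and> s \<in> S \<and> t \<in> T}"

lemma product_setI: "\<lbrakk>op \<in> tri_products L; s \<in> S; t \<in> T\<rbrakk> \<Longrightarrow> op s t \<in> product_set L S T"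
  by (auto simp: product_set_def)

lemma triassoc_homD:
  assumes "f \<in> triassoc_hom K A B"
  shows "f \<in> module_hom K A B"
    "\<lbrakk>x \<in> carrier A; y \<in> carrier A\<rbrakk> \<Longrightarrow> f (vd A x y) = vd B (f x) (f y)"
    "\<lbrakk>x \<in> carrier A; y \<in> carrier A\<rbrakk> \<Longrightarrow> f (dv A x y) = dv B (f x) (f y)"
    "\<lbrakk>x \<in> carrier A; y \<in> carrier A\<rbrakk> \<Longrightarrow> f (pp A x y) = pp B (f x) (f y)"
  using assms by (auto simp: triassoc_hom_def)

text \<open>Lets later arguments run uniformly over the products instead of splitting into three
  kinds. Only existence of a partner is claimed, because different products of \<open>A\<close> may
  coincide as functions.\<close>

lemma triassoc_hom_product:
  assumes f: "f \<in> triassoc_hom K A B" and op: "op \<in> tri_products A"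
  obtains op' where "op' \<in> tri_products B"
    "\<And>x y. \<lbrakk>x \<in> carrier A; y \<in> carrier A\<rbrakk> \<Longrightarrow> f (op x y) = op' (f x) (f y)"
  using op triassoc_homD(2-4)[OF f] tri_productsI[of B] unfolding tri_products_def[of A] by blast

lemma triassoc_hom_product':
  assumes f: "f \<in> triassoc_hom K A B" and op: "op' \<in> tri_products B"
  obtains op where "op \<in> tri_products A"
    "\<And>x y. \<lbrakk>x \<in> carrier A; y \<in> carrier A\<rbrakk> \<Longrightarrow> f (op x y) = op' (f x) (f y)"
  using op triassoc_homD(2-4)[OF f] tri_productsI[of A] unfolding tri_products_def[of B] by blast

lemma tri_idealD:
  assumes "tri_ideal K I L"
  shows "subspace K I L"
    "\<And>op x i. \<lbrakk>op \<in> tri_products L; x \<in> carrier L; i \<in> I\<rbrakk> \<Longrightarrow> op x i \<in> I"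
    "\<And>op x i. \<lbrakk>op \<in> tri_products L; x \<in> carrier L; i \<in> I\<rbrakk> \<Longrightarrow> op i x \<in> I"
  using assms by (auto simp: tri_ideal_def)

section \<open>The derived algebra, the ideal \<open>C(R)\<close> and quotient algebras\<close>

context triassociative_algebra
begin

lemma op_linear:
  assumes "op \<in> tri_products L" "x \<in> carrier L"
  shows "linear_map K L L (\<lambda>y. op x y)" "linear_map K L L (\<lambda>y. op y x)"
  using bilinear_right[OF assms] bilinear_left[OF assms] vectorspace_axioms
  by (simp_all add: linear_map_iff)

lemma op_simps:
  assumes "op \<in> tri_products L" "x \<in> carrier L" "y \<in> carrier L"
  shows "op x y \<in> carrier L"
    "z \<in> carrier L \<Longrightarrow> op x (y \<oplus>\<^bsub>L\<^esub> z) = op x y \<oplus>\<^bsub>L\<^esub> op x z"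
    "z \<in> carrier L \<Longrightarrow> op (y \<oplus>\<^bsub>L\<^esub> z) x = op y x \<oplus>\<^bsub>L\<^esub> op z x"
    "z \<in> carrier L \<Longrightarrow> op x (y \<ominus>\<^bsub>L\<^esub> z) = op x y \<ominus>\<^bsub>L\<^esub> op x z"
    "z \<in> carrier L \<Longrightarrow> op (y \<ominus>\<^bsub>L\<^esub> z) x = op y x \<ominus>\<^bsub>L\<^esub> op z x"
    "c \<in> carrier K \<Longrightarrow> op x (c \<odot>\<^bsub>L\<^esub> y) = c \<odot>\<^bsub>L\<^esub> op x y"
    "c \<in> carrier K \<Longrightarrow> op (c \<odot>\<^bsub>L\<^esub> y) x = c \<odot>\<^bsub>L\<^esub> op y x"
  using linear_mapD(4-6,8)[OF op_linear(1)[OF assms(1,2)]]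
    linear_mapD(4-6,8)[OF op_linear(2)[OF assms(1,2)]] assms(3) by simp_all

lemma op_zero:
  assumes "op \<in> tri_products L" "x \<in> carrier L"
  shows "op x \<zero>\<^bsub>L\<^esub> = \<zero>\<^bsub>L\<^esub>" "op \<zero>\<^bsub>L\<^esub> x = \<zero>\<^bsub>L\<^esub>"
  using linear_mapD(7)[OF op_linear(1)[OF assms]] linear_mapD(7)[OF op_linear(2)[OF assms]] by simp_all

lemma product_set_closed:
  assumes "S \<subseteq> carrier L" "T \<subseteq> carrier L"
  shows "product_set L S T \<subseteq> carrier L"
  unfolding product_set_def using assms by (auto intro: op_simps(1))

lemma lozenge_eq_span:
  assumes "S \<subseteq> carrier L" "T \<subseteq> carrier L"
  shows "lozenge K L S T = span (product_set L S T)"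
proof -
  let ?X = "\<lambda>op. {op s t | s t. s \<in> S \<and> t \<in> T}"
  have *: "?X op \<subseteq> carrier L" if "op \<in> tri_products L" for op
    using assms by (auto intro: op_simps(1)[OF that])
  note X = *[OF tri_productsI(1)] *[OF tri_productsI(2)] *[OF tri_productsI(3)]
  have "lozenge K L S T = span (?X (vd L) \<union> ?X (dv L) \<union> ?X (pp L))"
    unfolding lozenge_def product_span_def using X by (simp add: set_add_span)
  also have "?X (vd L) \<union> ?X (dv L) \<union> ?X (pp L) = product_set L S T"
    by (auto simp: product_set_def tri_products_def)
  finally show ?thesis .
qed

lemma derived_eq_span: "derived K L = span (product_set L (carrier L) (carrier L))"
  unfolding derived_def by (rule lozenge_eq_span) auto

lemma derived_subspace: "subspace K (derived K L) L"
  unfolding derived_eq_span by (intro span_subspace product_set_closed) auto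

lemma op_in_derived:
  assumes "op \<in> tri_products L" "x \<in> carrier L" "y \<in> carrier L"
  shows "op x y \<in> derived K L"
  unfolding derived_eq_span
  using in_own_span[OF product_set_closed, OF subset_refl subset_refl] product_setI[OF assms] by blast

lemma derived_le:
  assumes "subspace K N L"
    and "\<And>op x y. \<lbrakk>op \<in> tri_products L; x \<in> carrier L; y \<in> carrier L\<rbrakk> \<Longrightarrow> op x y \<in> N"
  shows "derived K L \<subseteq> N"
  unfolding derived_eq_span by (rule span_le) (use assms in \<open>auto simp: product_set_def\<close>)

lemma comm_ideal_eq_span:
  assumes "R \<subseteq> carrier L"
  shows "comm_ideal K L R = span (product_set L (carrier L) R \<union> product_set L R (carrier L))"
  unfolding comm_ideal_def
  by (simp add: lozenge_eq_span assms set_add_span product_set_closed)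

lemma comm_ideal_subspace:
  assumes "R \<subseteq> carrier L"
  shows "subspace K (comm_ideal K L R) L"
  unfolding comm_ideal_eq_span[OF assms] by (intro span_subspace Un_least product_set_closed assms) auto

lemma op_in_comm_ideal:
  assumes R: "R \<subseteq> carrier L" and op: "op \<in> tri_products L" and x: "x \<in> carrier L" and r: "r \<in> R"
  shows "op x r \<in> comm_ideal K L R" "op r x \<in> comm_ideal K L R"
proof -
  have "product_set L (carrier L) R \<union> product_set L R (carrier L) \<subseteq> comm_ideal K L R"
    unfolding comm_ideal_eq_span[OF R] by (intro in_own_span Un_least product_set_closed R) auto
  then show "op x r \<in> comm_ideal K L R" "op r x \<in> comm_ideal K L R"
    using product_setI[OF op x r] product_setI[OF op r x] by blast+
qed

lemma comm_ideal_le: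
  assumes "R \<subseteq> carrier L" "subspace K N L"
    and "\<And>op x r. \<lbrakk>op \<in> tri_products L; x \<in> carrier L; r \<in> R\<rbrakk> \<Longrightarrow> op x r \<in> N \<and> op r x \<in> N"
  shows "comm_ideal K L R \<subseteq> N"
  unfolding comm_ideal_eq_span[OF assms(1)]
  by (rule span_le) (use assms in \<open>auto simp: product_set_def\<close>)

text \<open>Expanding \<open>(u + x) * (v + y)\<close> leaves \<open>x * y\<close> plus
  \<open>u * (v + y) + x * v\<close>, and the latter lies in \<open>I\<close> by absorption on both
  sides.\<close>

lemma coset_op_coset:
  assumes I: "tri_ideal K I L" and op: "op \<in> tri_products L"
    and x: "x \<in> carrier L" and y: "y \<in> carrier L"
  shows "coset_op L I op (I +>\<^bsub>L\<^esub> x) (I +>\<^bsub>L\<^esub> y) = I +>\<^bsub>L\<^esub> op x y"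
proof -
  note i = tri_idealD[OF I]
  have "I +>\<^bsub>L\<^esub> op a b = I +>\<^bsub>L\<^esub> op x y" if ab: "a \<in> I +>\<^bsub>L\<^esub> x" "b \<in> I +>\<^bsub>L\<^esub> y" for a b
  proof -
    obtain u v where uv: "u \<in> I" "v \<in> I" "a = u \<oplus>\<^bsub>L\<^esub> x" "b = v \<oplus>\<^bsub>L\<^esub> y"
      using ab by (auto simp: a_r_coset_def')
    have c: "u \<in> carrier L" "v \<in> carrier L" using uv subspaceD(4)[OF i(1)] by auto
    have "op a b = op u (v \<oplus>\<^bsub>L\<^esub> y) \<oplus>\<^bsub>L\<^esub> (op x v \<oplus>\<^bsub>L\<^esub> op x y)"
      using c x y by (simp add: uv op_simps[OF op] M.a_ac)
    also have "\<dots> = (op u (v \<oplus>\<^bsub>L\<^esub> y) \<oplus>\<^bsub>L\<^esub> op x v) \<oplus>\<^bsub>L\<^esub> op x y"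
      using c x y by (simp add: op_simps[OF op] M.a_assoc)
    finally have "op a b = (op u (v \<oplus>\<^bsub>L\<^esub> y) \<oplus>\<^bsub>L\<^esub> op x v) \<oplus>\<^bsub>L\<^esub> op x y" .
    moreover have "op u (v \<oplus>\<^bsub>L\<^esub> y) \<oplus>\<^bsub>L\<^esub> op x v \<in> I"
      using subspaceD(5)[OF i(1) i(3)[OF op _ uv(1)] i(2)[OF op x uv(2)]] c y by simp
    ultimately show ?thesis
      using coset_eqI[OF i(1)] op_simps(1)[OF op x y] by simp
  qed
  moreover have "x \<in> I +>\<^bsub>L\<^esub> x" "y \<in> I +>\<^bsub>L\<^esub> y" using coset_mem[OF i(1)] x y by auto
  ultimately show ?thesis unfolding coset_op_def by blast
qed

lemma quot_hom:
  assumes I: "tri_ideal K I L"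
  shows "(\<lambda>x. I +>\<^bsub>L\<^esub> x) \<in> triassoc_hom K L (quot_algebra L I)"
  unfolding triassoc_hom_def
  using linear_mapD(3)[OF quotient_map_linear[OF tri_idealD(1)[OF I] is_quotient_quot_algebra]]
  by (simp add: coset_op_coset[OF I])

text \<open>Bilinearity and the associativity laws are identities, so they pass to homomorphic
  images. Quotient algebras inherit them along the coset map.\<close>

lemma triassociative_image:
  assumes f: "f \<in> triassoc_hom K L B" and B: "vectorspace K B" and surj: "f ` carrier L = carrier B"
  shows "triassociative_algebra K B"
proof -
  have lin: "linear_map K L B f"
    using triassoc_homD(1)[OF f] B vectorspace_axioms by (simp add: linear_map_iff)
  note l = linear_mapD[OF lin]
  show ?thesis
  proof (intro triassociative_algebra.intro triassociative_algebra_axioms.intro B)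
    fix op' x assume op': "op' \<in> tri_products B" and x: "x \<in> carrier B"
    obtain op where op: "op \<in> tri_products L"
      "\<And>x y. \<lbrakk>x \<in> carrier L; y \<in> carrier L\<rbrakk> \<Longrightarrow> f (op x y) = op' (f x) (f y)"
      using triassoc_hom_product'[OF f op'] by metis
    obtain a where a: "a \<in> carrier L" "x = f a" using x surj by blast
    note o = op_simps[OF op(1)]
    show "(\<lambda>y. op' x y) \<in> module_hom K B B"
      by (rule module_homI; unfold surj[symmetric] a(2); elim imageE; hypsubst)
        (simp_all add: o a(1) flip: op(2) l(5,6))
    show "(\<lambda>y. op' y x) \<in> module_hom K B B"
      by (rule module_homI; unfold surj[symmetric] a(2); elim imageE; hypsubst)
        (simp_all add: o a(1) flip: op(2) l(5,6))
  next
    fix x y z assume "x \<in> carrier B" "y \<in> carrier B" "z \<in> carrier B"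
    then obtain a b c where abc: "a \<in> carrier L" "b \<in> carrier L" "c \<in> carrier L"
      and xyz: "x = f a" "y = f b" "z = f c"
      unfolding surj[symmetric] by (elim imageE)
    note cl = op_simps(1)[OF tri_productsI(1)] op_simps(1)[OF tri_productsI(2)]
      op_simps(1)[OF tri_productsI(3)]
    show "(x \<turnstile>\<^bsub>B\<^esub> y) \<turnstile>\<^bsub>B\<^esub> z = x \<turnstile>\<^bsub>B\<^esub> (y \<turnstile>\<^bsub>B\<^esub> z)"
      "(x \<stileturn>\<^bsub>B\<^esub> y) \<stileturn>\<^bsub>B\<^esub> z = x \<stileturn>\<^bsub>B\<^esub> (y \<stileturn>\<^bsub>B\<^esub> z)"
      "(x \<stileturn>\<^bsub>B\<^esub> y) \<turnstile>\<^bsub>B\<^esub> z = x \<turnstile>\<^bsub>B\<^esub> (y \<turnstile>\<^bsub>B\<^esub> z)"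
      "(x \<stileturn>\<^bsub>B\<^esub> y) \<stileturn>\<^bsub>B\<^esub> z = x \<stileturn>\<^bsub>B\<^esub> (y \<turnstile>\<^bsub>B\<^esub> z)"
      "(x \<turnstile>\<^bsub>B\<^esub> y) \<stileturn>\<^bsub>B\<^esub> z = x \<turnstile>\<^bsub>B\<^esub> (y \<stileturn>\<^bsub>B\<^esub> z)"
      "(x \<bottom>\<^bsub>B\<^esub> y) \<turnstile>\<^bsub>B\<^esub> z = x \<turnstile>\<^bsub>B\<^esub> (y \<turnstile>\<^bsub>B\<^esub> z)"
      "(x \<stileturn>\<^bsub>B\<^esub> y) \<stileturn>\<^bsub>B\<^esub> z = x \<stileturn>\<^bsub>B\<^esub> (y \<bottom>\<^bsub>B\<^esub> z)"
      "(x \<turnstile>\<^bsub>B\<^esub> y) \<bottom>\<^bsub>B\<^esub> z = x \<turnstile>\<^bsub>B\<^esub> (y \<bottom>\<^bsub>B\<^esub> z)"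
      "(x \<bottom>\<^bsub>B\<^esub> y) \<stileturn>\<^bsub>B\<^esub> z = x \<bottom>\<^bsub>B\<^esub> (y \<stileturn>\<^bsub>B\<^esub> z)"
      "(x \<stileturn>\<^bsub>B\<^esub> y) \<bottom>\<^bsub>B\<^esub> z = x \<bottom>\<^bsub>B\<^esub> (y \<turnstile>\<^bsub>B\<^esub> z)"
      "(x \<bottom>\<^bsub>B\<^esub> y) \<bottom>\<^bsub>B\<^esub> z = x \<bottom>\<^bsub>B\<^esub> (y \<bottom>\<^bsub>B\<^esub> z)"
      \<comment> \<open>Reading the homomorphism equations backwards turns each side into
        \<open>f\<close> of an element of \<open>L\<close>, where the corresponding axiom
        applies.\<close>
      unfolding xyz
      by (simp add: abc cl flip: triassoc_homD(2-4)[OF f]; rule arg_cong[of _ _ f]; rule triassoc[OF abc])+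
  qed
qed

end

lemma triassoc_hom_linear:
  assumes "triassociative_algebra K A" "triassociative_algebra K B" "f \<in> triassoc_hom K A B"
  shows "linear_map K A B f"
  using assms triassoc_homD(1)[OF assms(3)]
  by (simp add: linear_map_iff triassociative_algebra_def)

lemma triassoc_hom_compose:
  assumes f: "f \<in> triassoc_hom K A B" and g: "g \<in> triassoc_hom K B C"
  shows "(\<lambda>x. g (f x)) \<in> triassoc_hom K A C"
  using assms by (auto simp: triassoc_hom_def module_hom_def Pi_iff)

lemma tri_ideal_kernel:
  assumes A: "triassociative_algebra K A" and B: "triassociative_algebra K B"
    and p: "p \<in> triassoc_hom K A B"
  shows "tri_ideal K {x \<in> carrier A. p x = \<zero>\<^bsub>B\<^esub>} A"
proof -
  interpret A: triassociative_algebra K A by fact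
  interpret B: triassociative_algebra K B by fact
  note l = linear_mapD[OF triassoc_hom_linear[OF A B p]]
  have "subspace K {x \<in> carrier A. p x \<in> {\<zero>\<^bsub>B\<^esub>}} A"
    by (intro linear_map_vimage_subspace[OF triassoc_hom_linear[OF A B p]] B.subspaceI) auto
  moreover have "op x i \<in> {x \<in> carrier A. p x = \<zero>\<^bsub>B\<^esub>} \<and> op i x \<in> {x \<in> carrier A. p x = \<zero>\<^bsub>B\<^esub>}"
    if op: "op \<in> tri_products A" and x: "x \<in> carrier A" and i: "i \<in> {x \<in> carrier A. p x = \<zero>\<^bsub>B\<^esub>}"
    for op x i
  proof -
    obtain op' where op': "op' \<in> tri_products B"
      "\<And>x y. \<lbrakk>x \<in> carrier A; y \<in> carrier A\<rbrakk> \<Longrightarrow> p (op x y) = op' (p x) (p y)"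
      using triassoc_hom_product[OF p op] by metis
    show ?thesis
      using x i l(4) A.op_simps(1)[OF op] B.op_zero[OF op'(1)] by (simp add: op'(2))
  qed
  ultimately show ?thesis unfolding tri_ideal_def by simp
qed

lemma image_derived:
  assumes A: "triassociative_algebra K A" and B: "triassociative_algebra K B"
    and p: "p \<in> triassoc_hom K A B" and surj: "p ` carrier A = carrier B"
  shows "p ` derived K A = derived K B"
proof -
  interpret A: triassociative_algebra K A by fact
  interpret B: triassociative_algebra K B by fact
  have "p ` product_set A (carrier A) (carrier A) = product_set B (carrier B) (carrier B)"
  proof (intro equalityI subsetI)
    fix z assume "z \<in> p ` product_set A (carrier A) (carrier A)"
    then obtain op x y where op: "op \<in> tri_products A" and xy: "x \<in> carrier A" "y \<in> carrier A"
      and z: "z = p (op x y)"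
      unfolding product_set_def by blast
    obtain op' where "op' \<in> tri_products B" "p (op x y) = op' (p x) (p y)"
      using triassoc_hom_product[OF p op] xy by metis
    then show "z \<in> product_set B (carrier B) (carrier B)"
      unfolding z surj[symmetric] using xy by (auto intro: product_setI)
  next
    fix z assume "z \<in> product_set B (carrier B) (carrier B)"
    then obtain op' x y where op': "op' \<in> tri_products B" and xy: "x \<in> carrier A" "y \<in> carrier A"
      and z: "z = op' (p x) (p y)"
      unfolding product_set_def surj[symmetric] by blast
    obtain op where "op \<in> tri_products A" "p (op x y) = op' (p x) (p y)"
      using triassoc_hom_product'[OF p op'] xy by metis
    then show "z \<in> p ` product_set A (carrier A) (carrier A)"
      unfolding z using xy by (metis imageI product_setI)
  qed
  then show ?thesis
    unfolding A.derived_eq_span B.derived_eq_span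
    using linear_map_image_span[OF triassoc_hom_linear[OF A B p]] A.product_set_closed by simp
qed

context triassociative_algebra
begin

lemma quot_triassociative:
  assumes I: "tri_ideal K I L"
  shows "triassociative_algebra K (quot_algebra L I)"
proof (rule triassociative_image[OF quot_hom[OF I]])
  show "vectorspace K (quot_algebra L I)"
    by (rule linear_mapD[OF quotient_map_linear[OF tri_idealD(1)[OF I] is_quotient_quot_algebra]])
  show "(\<lambda>x. I +>\<^bsub>L\<^esub> x) ` carrier L = carrier (quot_algebra L I)"
    by (simp add: a_rcosets_eq_image)
qed

lemma induced_hom:
  assumes I: "tri_ideal K I L" and B: "triassociative_algebra K B" and p: "p \<in> triassoc_hom K L B"
    and ker: "\<And>i. i \<in> I \<Longrightarrow> p i = \<zero>\<^bsub>B\<^esub>"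
  shows "induced_map p \<in> triassoc_hom K (quot_algebra L I) B"
proof -
  have A: "triassociative_algebra K L" ..
  note sub = tri_idealD(1)[OF I] and lin = triassoc_hom_linear[OF A B p]
  note ind = linear_induced_map[OF sub lin ker]
  have "linear_map K (quot_algebra L I) B (induced_map p)"
    by (rule induced_map_linear[OF sub is_quotient_quot_algebra lin ker])
  then show ?thesis
    unfolding triassoc_hom_def
    by (auto simp: linear_map_iff a_rcosets_eq_image coset_op_coset[OF I] ind op_simps(1)
        triassoc_homD(2-4)[OF p])
qed

lemma first_isomorphism:
  assumes B: "triassociative_algebra K B" and p: "p \<in> triassoc_hom K L B"
    and surj: "p ` carrier L = carrier B"
  shows "triassoc_isomorphic K (quot_algebra L {x \<in> carrier L. p x = \<zero>\<^bsub>B\<^esub>}) B"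
proof -
  interpret B: triassociative_algebra K B by fact
  have A: "triassociative_algebra K L" ..
  let ?I = "{x \<in> carrier L. p x = \<zero>\<^bsub>B\<^esub>}"
  have I: "tri_ideal K ?I L" by (rule tri_ideal_kernel[OF A B p])
  note sub = tri_idealD(1)[OF I] and lin = triassoc_hom_linear[OF A B p]
  have ind: "induced_map p (?I +>\<^bsub>L\<^esub> x) = p x" if "x \<in> carrier L" for x
    by (rule linear_induced_map[OF sub lin _ that]) simp
  have "bij_betw (induced_map p) (carrier (quot_algebra L ?I)) (carrier B)"
    unfolding bij_betw_def
  proof
    show "induced_map p ` carrier (quot_algebra L ?I) = carrier B"
      by (simp add: a_rcosets_eq_image image_image ind surj cong: image_cong)
    show "inj_on (induced_map p) (carrier (quot_algebra L ?I))"
    proof (rule inj_onI)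
      fix X Y assume "X \<in> carrier (quot_algebra L ?I)" "Y \<in> carrier (quot_algebra L ?I)"
        and eq: "induced_map p X = induced_map p Y"
      then obtain x y where xy: "x \<in> carrier L" "y \<in> carrier L" "X = ?I +>\<^bsub>L\<^esub> x" "Y = ?I +>\<^bsub>L\<^esub> y"
        by (auto simp: a_rcosets_eq_image)
      then have "p x = p y" using eq ind by simp
      then have "x \<ominus>\<^bsub>L\<^esub> y \<in> ?I"
        using xy linear_mapD(4,8)[OF lin] by simp
      then show "X = Y" using coset_eq_iff[OF sub] xy by simp
    qed
  qed
  then show ?thesis
    unfolding triassoc_isomorphic_def using induced_hom[OF I B p] by blast
qed

section \<open>Defining pairs as surjections with kernel in the centre and the derived
  algebra\<close>

lemma defining_pairI:
  assumes "triassociative_algebra K B" "p \<in> triassoc_hom K L B" "p ` carrier L = carrier B"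
    and "M = {x \<in> carrier L. p x = \<zero>\<^bsub>B\<^esub>}" "M \<subseteq> tri_center L" "M \<subseteq> derived K L"
  shows "defining_pair K B L M"
  unfolding defining_pair_def
  using first_isomorphism[OF assms(1-3)] tri_ideal_kernel[OF _ assms(1,2)] assms(4-6)
    triassociative_algebra_axioms by simp

end

text \<open>Composing the coset map with the given isomorphism replaces the quotient
  \<open>E / M\<close> by a surjection with kernel \<open>M\<close>, the form in which lifting and
  dimension counting apply.\<close>

lemma defining_pairE:
  assumes B: "triassociative_algebra K B" and "defining_pair K B E M"
  obtains p where "triassociative_algebra K E" "p \<in> triassoc_hom K E B" "p ` carrier E = carrier B"
    "M = {x \<in> carrier E. p x = \<zero>\<^bsub>B\<^esub>}" "M \<subseteq> tri_center E" "M \<subseteq> derived K E"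
proof -
  have E: "triassociative_algebra K E" and M: "tri_ideal K M E"
    and c: "M \<subseteq> tri_center E" "M \<subseteq> derived K E"
    using assms(2) by (auto simp: defining_pair_def)
  obtain \<phi> where \<phi>: "\<phi> \<in> triassoc_hom K (quot_algebra E M) B"
    and bij: "bij_betw \<phi> (carrier (quot_algebra E M)) (carrier B)"
    using assms(2) by (auto simp: defining_pair_def triassoc_isomorphic_def)
  interpret E: triassociative_algebra K E by fact
  interpret B: triassociative_algebra K B by fact
  have Q: "triassociative_algebra K (quot_algebra E M)" by (rule E.quot_triassociative[OF M])
  interpret Q: triassociative_algebra K "quot_algebra E M" by (rule Q)
  note l = linear_mapD[OF triassoc_hom_linear[OF Q B \<phi>]]
  note sub = tri_idealD(1)[OF M]
  let ?p = "\<lambda>x. \<phi> (M +>\<^bsub>E\<^esub> x)"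
  have car: "carrier (quot_algebra E M) = (\<lambda>x. M +>\<^bsub>E\<^esub> x) ` carrier E" by (simp add: a_rcosets_eq_image)
  show ?thesis
  proof (rule that[OF E _ _ _ c])
    show "?p \<in> triassoc_hom K E B" by (rule triassoc_hom_compose[OF E.quot_hom[OF M] \<phi>])
    show "?p ` carrier E = carrier B" using bij unfolding bij_betw_def car by (simp add: image_image)
    show "M = {x \<in> carrier E. ?p x = \<zero>\<^bsub>B\<^esub>}"
    proof (intro equalityI subsetI)
      fix x assume x: "x \<in> M"
      then have "M +>\<^bsub>E\<^esub> x = M" using E.coset_zero_iff[OF sub] subspaceD(4)[OF sub] by blast
      then show "x \<in> {x \<in> carrier E. ?p x = \<zero>\<^bsub>B\<^esub>}"
        using l(7) subspaceD(4)[OF sub x] by simp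
    next
      fix x assume x: "x \<in> {x \<in> carrier E. ?p x = \<zero>\<^bsub>B\<^esub>}"
      then have "\<phi> (M +>\<^bsub>E\<^esub> x) = \<phi> M" using l(7) by simp
      moreover have "M +>\<^bsub>E\<^esub> x \<in> carrier (quot_algebra E M)" using x car by auto
      moreover have "M \<in> carrier (quot_algebra E M)" using Q.M.zero_closed by simp
      ultimately have "M +>\<^bsub>E\<^esub> x = M" using bij unfolding bij_betw_def inj_on_def by blast
      then show "x \<in> M" using E.coset_zero_iff[OF sub] x by simp
    qed
  qed
qed

lemma stem_extension_fin_dim:
  assumes E: "triassociative_algebra K E" and B: "triassociative_algebra K B"
    and p: "p \<in> triassoc_hom K E B" and surj: "p ` carrier E = carrier B"
    and M: "M = {x \<in> carrier E. p x = \<zero>\<^bsub>B\<^esub>}" "M \<subseteq> tri_center E" "M \<subseteq> derived K E"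
    and fd: "vectorspace.fin_dim K B"
  shows "vectorspace.fin_dim K E"
proof -
  interpret E: triassociative_algebra K E by fact
  interpret B: triassociative_algebra K B by fact
  have lin: "linear_map K E B p" by (rule triassoc_hom_linear[OF E B p])
  note l = linear_mapD[OF lin]
  obtain G where G: "finite G" "G \<subseteq> carrier B" "B.span G = carrier B"
    using fd unfolding B.fin_dim_def by blast
  obtain H where H: "finite H" "H \<subseteq> carrier E" "p ` H = G"
    using finite_subset_image[OF G(1) G(2)[folded surj]] by metis
  let ?P = "product_set E H H"
  have P: "?P \<subseteq> carrier E" by (rule E.product_set_closed[OF H(2) H(2)])
  have "?P = (\<Union>op\<in>tri_products E. (\<lambda>(x, y). op x y) ` (H \<times> H))"
    by (auto simp: product_set_def)
  then have finP: "finite ?P" using H(1) by (simp add: tri_products_def)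
  note subP = E.span_subspace[OF P]
  have spanH: "E.span H \<subseteq> carrier E" using E.span_subspace[OF H(2)] subspaceD(2) by blast
  have prod_span: "op a b \<in> E.span ?P"
    if op: "op \<in> tri_products E" and a: "a \<in> E.span H" and b: "b \<in> E.span H" for op a b
  proof -
    \<comment> \<open>Bilinearity is used one argument at a time: the left factor is first a chosen
      lift, then any element of their span.\<close>
    have "op h b \<in> E.span ?P" if h: "h \<in> H" for h
    proof -
      have "E.span H \<subseteq> {y \<in> carrier E. op h y \<in> E.span ?P}"
        using E.in_own_span[OF P] product_setI[OF op h] H(2) h
        by (intro E.span_le linear_map_vimage_subspace[OF E.op_linear(1)[OF op] subP]) auto
      then show ?thesis using b by blast
    qed
    then have "E.span H \<subseteq> {x \<in> carrier E. op x b \<in> E.span ?P}"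
      using H(2) b spanH
      by (intro E.span_le linear_map_vimage_subspace[OF E.op_linear(2)[OF op] subP]) auto
    then show ?thesis using a by blast
  qed
  have lift: "\<exists>h\<in>E.span H. x \<ominus>\<^bsub>E\<^esub> h \<in> M" if x: "x \<in> carrier E" for x
  proof -
    have "p x \<in> p ` E.span H"
      unfolding linear_map_image_span[OF lin H(2)] H(3) G(3) using l(4) x by blast
    then obtain h where h: "h \<in> E.span H" "p x = p h" by blast
    then have "x \<ominus>\<^bsub>E\<^esub> h \<in> M" unfolding M(1) using x spanH l(4,8) by auto
    then show ?thesis using h by blast
  qed
  have "derived K E \<subseteq> E.span ?P"
  proof (rule E.derived_le[OF subP])
    fix op x y assume op: "op \<in> tri_products E" and x: "x \<in> carrier E" and y: "y \<in> carrier E"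
    obtain a b where a: "a \<in> E.span H" "x \<ominus>\<^bsub>E\<^esub> a \<in> M" and b: "b \<in> E.span H" "y \<ominus>\<^bsub>E\<^esub> b \<in> M"
      using lift[OF x] lift[OF y] by blast
    have ac: "a \<in> carrier E" and bc: "b \<in> carrier E" using a b spanH by auto
    \<comment> \<open>The differences are central, so replacing \<open>x\<close> by \<open>a\<close>
      and \<open>y\<close> by \<open>b\<close> leaves the product unchanged.\<close>
    have "op (x \<ominus>\<^bsub>E\<^esub> a) y = \<zero>\<^bsub>E\<^esub>" "op a (y \<ominus>\<^bsub>E\<^esub> b) = \<zero>\<^bsub>E\<^esub>"
      using a(2) b(2) M(2) op y ac unfolding tri_center_def by blast+
    then have "op x y = op a y" "op a y = op a b"
      using x y ac bc by (simp_all add: E.op_simps[OF op])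
    then show "op x y \<in> E.span ?P" using prod_span[OF op a(1) b(1)] by simp
  qed
  then have "x \<in> E.span ?P" if "x \<in> carrier E" "p x = \<zero>\<^bsub>B\<^esub>" for x
    using that M by blast
  then show ?thesis
    by (rule fin_dim_if_kernel_in_finite_span[OF lin surj fd finP P])
qed

section \<open>The multiplier of a free presentation\<close>

lemma subspace_carrier_update:
  assumes "subspace K A V" "subspace K U V" "U \<subseteq> A"
  shows "subspace K U (V\<lparr>carrier := A\<rparr>)"
  using subspaceD(7)[OF assms(1)] subspaceD[OF assms(2)] assms(3)
  by (intro vectorspace.subspaceI) auto

lemma coset_op_carrier_update [simp]: "coset_op (L\<lparr>carrier := A\<rparr>) I op = coset_op L I op"
  by (intro ext) (simp add: coset_op_def)

lemma (in triassociative_algebra) subalgebra: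
  assumes S: "subspace K S L"
    and cl: "\<And>op x y. \<lbrakk>op \<in> tri_products L; x \<in> S; y \<in> S\<rbrakk> \<Longrightarrow> op x y \<in> S"
  shows "triassociative_algebra K (L\<lparr>carrier := S\<rparr>)"
proof (intro triassociative_algebra.intro triassociative_algebra_axioms.intro)
  note s = subspaceD[OF S]
  show "vectorspace K (L\<lparr>carrier := S\<rparr>)" by (rule s(7))
  fix op x assume *: "op \<in> tri_products (L\<lparr>carrier := S\<rparr>)" "x \<in> carrier (L\<lparr>carrier := S\<rparr>)"
  then have op: "op \<in> tri_products L" and x: "x \<in> S" by simp_all
  show "(\<lambda>y. op x y) \<in> module_hom K (L\<lparr>carrier := S\<rparr>) (L\<lparr>carrier := S\<rparr>)"
    by (rule module_homI) (simp_all add: cl op x s(4) op_simps[OF op])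
  show "(\<lambda>y. op y x) \<in> module_hom K (L\<lparr>carrier := S\<rparr>) (L\<lparr>carrier := S\<rparr>)"
    by (rule module_homI) (simp_all add: cl op x s(4) op_simps[OF op])
qed (simp, rule triassoc; erule subspaceD(4)[OF S])+

section \<open>Homomorphisms out of a free algebra\<close>

lemma free_onD:
  fixes A :: "('a, 'c) triassoc"
  assumes free: "free_on K X F TYPE('c)" and A: "triassociative_algebra K A"
    and g: "g \<in> X \<rightarrow> carrier A"
  shows "\<exists>h\<in>triassoc_hom K F A. (\<forall>x\<in>X. h x = g x) \<and>
      (\<forall>h'\<in>triassoc_hom K F A. (\<forall>x\<in>X. h' x = g x) \<longrightarrow> (\<forall>y\<in>carrier F. h' y = h y))"
  using assms unfolding free_on_def by simp

lemma free_on_lift: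
  fixes A :: "('a, 'c) triassoc"
  assumes "free_on K X F TYPE('c)" "triassociative_algebra K A" "g \<in> X \<rightarrow> carrier A"
  obtains h where "h \<in> triassoc_hom K F A" "\<And>x. x \<in> X \<Longrightarrow> h x = g x"
proof -
  from free_onD[OF assms] obtain h where "h \<in> triassoc_hom K F A" "\<forall>x\<in>X. h x = g x"
    by (elim bexE conjE)
  then show ?thesis using that[of h] by simp
qed

text \<open>Both \<open>h\<close> and the identity extend the inclusion of \<open>X\<close> into
  \<open>F\<close>, so the uniqueness clause with target \<open>F\<close> makes them agree.\<close>

lemma free_on_endomorphism:
  fixes F :: "('a, 'f) triassoc"
  assumes free: "free_on K X F TYPE('f)" and h: "h \<in> triassoc_hom K F F"
    and hX: "\<And>x. x \<in> X \<Longrightarrow> h x = x" and y: "y \<in> carrier F"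
  shows "h y = y"
proof -
  have F: "triassociative_algebra K F" and X: "(\<lambda>x. x) \<in> X \<rightarrow> carrier F"
    using free by (auto simp: free_on_def)
  obtain i where
    i: "\<forall>h'\<in>triassoc_hom K F F. (\<forall>x\<in>X. h' x = x) \<longrightarrow> (\<forall>y\<in>carrier F. h' y = i y)"
    using free_onD[OF free F X] by (elim bexE conjE)
  have "(\<lambda>x. x) \<in> triassoc_hom K F F" by (auto simp: triassoc_hom_def module_hom_def)
  from bspec[OF i this] bspec[OF i h] show ?thesis using hX y by simp
qed

text \<open>The equalizer of two homomorphisms is a subalgebra of \<open>F\<close>, so the universal property for
  targets of the type of \<open>F\<close> alone yields uniqueness for targets of every type.\<close>

lemma free_hom_unique:
  fixes F :: "('a, 'f) triassoc" and B :: "('a, 'l) triassoc"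
  assumes free: "free_on K X F TYPE('f)" and B: "triassociative_algebra K B"
    and h: "h1 \<in> triassoc_hom K F B" "h2 \<in> triassoc_hom K F B"
    and eq: "\<And>x. x \<in> X \<Longrightarrow> h1 x = h2 x" and y: "y \<in> carrier F"
  shows "h1 y = h2 y"
proof -
  have F: "triassociative_algebra K F" and X: "X \<subseteq> carrier F"
    using free by (auto simp: free_on_def)
  interpret F: triassociative_algebra K F by fact
  interpret B: triassociative_algebra K B by fact
  note l1 = linear_mapD[OF triassoc_hom_linear[OF F B h(1)]]
    and l2 = linear_mapD[OF triassoc_hom_linear[OF F B h(2)]]
  define S where "S = {x \<in> carrier F. h1 x = h2 x}"
  have S: "subspace K S F"
    unfolding S_def by (rule F.subspaceI) (auto simp: l1 l2)
  have clS: "op a b \<in> S" if op: "op \<in> tri_products F" and ab: "a \<in> S" "b \<in> S" for op a b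
    using op ab triassoc_homD(2-4)[OF h(1)] triassoc_homD(2-4)[OF h(2)] F.op_simps(1)[OF op]
    unfolding S_def tri_products_def by auto
  have FS: "triassociative_algebra K (F\<lparr>carrier := S\<rparr>)" by (rule F.subalgebra[OF S]) (rule clS)
  have "(\<lambda>x. x) \<in> X \<rightarrow> carrier (F\<lparr>carrier := S\<rparr>)" using X eq by (auto simp: S_def)
  then obtain h where h: "h \<in> triassoc_hom K F (F\<lparr>carrier := S\<rparr>)" "\<And>x. x \<in> X \<Longrightarrow> h x = x"
    by (rule free_on_lift[OF free FS]) blast
  have hS: "h x \<in> S" if "x \<in> carrier F" for x
    using triassoc_homD(1)[OF h(1)] that by (auto simp: module_hom_def)
  \<comment> \<open>The extension into the equalizer \<open>S\<close>, regarded as an endomorphism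
    of \<open>F\<close>, fixes \<open>X\<close> and is therefore the identity. Its values lie in
    \<open>S\<close>, so \<open>S\<close> is all of \<open>F\<close>.\<close>
  have "h \<in> triassoc_hom K F F"
    using h(1) hS subspaceD(4)[OF S] by (auto simp: triassoc_hom_def module_hom_def)
  then have "h y = y" using h(2) y by (rule free_on_endomorphism[OF free])
  then show ?thesis using hS[OF y] by (simp add: S_def)
qed

text \<open>Instantiated twice: for \<open>L\<close> with kernel \<open>R\<close>, and for
  \<open>L / Z\<close> with kernel \<open>T\<close>. Freeness is added as a hypothesis where a lift
  or its uniqueness is needed.\<close>

locale presentation = F: triassociative_algebra K F + L: triassociative_algebra K L
  for K :: "('a, 'r) ring_scheme" and F :: "('a, 'f) triassoc" and L :: "('a, 'l) triassoc" +
  fixes \<pi> :: "'f \<Rightarrow> 'l" and R :: "'f set"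
  assumes hom: "\<pi> \<in> triassoc_hom K F L" and surj: "\<pi> ` carrier F = carrier L"
    and R_eq: "R = {x \<in> carrier F. \<pi> x = \<zero>\<^bsub>L\<^esub>}"
begin

abbreviation "D \<equiv> derived K F"
abbreviation "C \<equiv> comm_ideal K F R"
abbreviation "Mult \<equiv> mult_of_presentation K F R"

lemma pi_linear: "linear_map K F L \<pi>"
  by (rule triassoc_hom_linear[OF F.triassociative_algebra_axioms L.triassociative_algebra_axioms hom])

lemma R_ideal: "tri_ideal K R F"
  unfolding R_eq
  by (rule tri_ideal_kernel[OF F.triassociative_algebra_axioms L.triassociative_algebra_axioms hom])

lemmas R_sub = tri_idealD(1)[OF R_ideal]

lemma R_carrier: "R \<subseteq> carrier F"
  by (rule subspaceD(2)[OF R_sub])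

lemma C_sub: "subspace K C F"
  by (rule F.comm_ideal_subspace[OF R_carrier])

lemma C_le_R: "C \<subseteq> R"
  using tri_idealD(2,3)[OF R_ideal] by (intro F.comm_ideal_le[OF R_carrier R_sub]) auto

lemma C_le_D: "C \<subseteq> D"
  using R_carrier by (intro F.comm_ideal_le[OF R_carrier F.derived_subspace]) (auto intro: F.op_in_derived)

text \<open>Any product with a factor in \<open>R\<close> already lies in \<open>C\<close>, so
  absorption is automatic for a subspace between \<open>C\<close> and \<open>R\<close>. Hence a
  complement found by linear algebra alone is an ideal.\<close>

lemma ideal_between:
  assumes "subspace K S F" "C \<subseteq> S" "S \<subseteq> R"
  shows "tri_ideal K S F"
  unfolding tri_ideal_def using assms F.op_in_comm_ideal[OF R_carrier] by blast

lemma C_ideal: "tri_ideal K C F"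
  by (rule ideal_between[OF C_sub subset_refl C_le_R])

lemma RD_sub: "subspace K (R \<inter> D) F"
  by (rule F.subspace_Int[OF R_sub F.derived_subspace])

lemma C_sub_RD: "subspace K C (F\<lparr>carrier := R \<inter> D\<rparr>)"
  using C_le_R C_le_D by (intro subspace_carrier_update[OF RD_sub C_sub]) auto

lemma Mult_quotient: "is_quotient (F\<lparr>carrier := R \<inter> D\<rparr>) C Mult"
  unfolding mult_of_presentation_def by (rule is_quotient_quot_algebra)

lemma RD_vs: "vectorspace K (F\<lparr>carrier := R \<inter> D\<rparr>)"
  by (rule subspaceD(7)[OF RD_sub])

lemma Mult_linear: "linear_map K (F\<lparr>carrier := R \<inter> D\<rparr>) Mult (\<lambda>x. C +>\<^bsub>F\<^esub> x)"
  using vectorspace.quotient_map_linear[OF RD_vs C_sub_RD Mult_quotient] by simp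

lemma Mult_carrier: "carrier Mult = (\<lambda>x. C +>\<^bsub>F\<^esub> x) ` (R \<inter> D)"
  using vectorspace.is_quotient_carrier[OF RD_vs Mult_quotient] by simp

lemma Mult_vs: "vectorspace K Mult"
  by (rule linear_mapD(2)[OF Mult_linear])

lemma Mult_zero: "\<zero>\<^bsub>Mult\<^esub> = C"
  using Mult_quotient by (simp add: is_quotient_def)

text \<open>Two elements of \<open>D\<close> in one coset of \<open>S\<close> differ by an element
  of \<open>S \<inter> D = C\<close>. Intersecting with \<open>D\<close> is thus a concrete inverse
  of the map from cosets of \<open>C\<close> to cosets of \<open>S\<close>, with no choice of
  representatives.\<close>

lemma coset_inter_derived:
  assumes S: "subspace K S F" and SD: "S \<inter> D = C" and d: "d \<in> D"
  shows "(S +>\<^bsub>F\<^esub> d) \<inter> D = C +>\<^bsub>F\<^esub> d"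
proof (intro equalityI subsetI)
  note D = F.derived_subspace
  have dc: "d \<in> carrier F" using d subspaceD(4)[OF D] by blast
  fix x assume "x \<in> (S +>\<^bsub>F\<^esub> d) \<inter> D"
  then obtain s where s: "s \<in> S" "x = s \<oplus>\<^bsub>F\<^esub> d" "x \<in> D" by (auto simp: a_r_coset_def')
  then have "x \<ominus>\<^bsub>F\<^esub> d \<in> D" using F.subspace_minus[OF D] d by blast
  moreover have "x \<ominus>\<^bsub>F\<^esub> d = s"
    using s dc subspaceD(4)[OF S] by (simp add: a_minus_def F.M.a_assoc F.M.r_neg)
  ultimately have "s \<in> C" using s SD by auto
  then show "x \<in> C +>\<^bsub>F\<^esub> d" using s by (auto simp: a_r_coset_def')
next
  fix x assume "x \<in> C +>\<^bsub>F\<^esub> d"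
  then show "x \<in> (S +>\<^bsub>F\<^esub> d) \<inter> D"
    using SD d subspaceD(5)[OF F.derived_subspace] by (auto simp: a_r_coset_def')
qed

text \<open>Produces the defining pair that will attain the maximal dimension. Its algebra consists
  of cosets of \<open>S\<close> in \<open>F\<close>, whence the carrier type
  \<open>'f set\<close>.\<close>

lemma stem_extension_exists:
  obtains E :: "('a, 'f set) triassoc" and N p where
    "triassociative_algebra K E" "p \<in> triassoc_hom K E L" "p ` carrier E = carrier L"
    "N = {x \<in> carrier E. p x = \<zero>\<^bsub>L\<^esub>}" "N \<subseteq> tri_center E" "N \<subseteq> derived K E"
    "triassoc_isomorphic K (E\<lparr>carrier := N\<rparr>) Mult"
proof -
  obtain S where S: "subspace K S F" "C \<subseteq> S" "S \<subseteq> R" "S \<inter> D = C"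
    and dec: "\<And>u. u \<in> R \<Longrightarrow> \<exists>s\<in>S. \<exists>d\<in>R \<inter> D. u = s \<oplus>\<^bsub>F\<^esub> d"
    by (rule F.relative_complement[OF R_sub F.derived_subspace C_sub C_le_R C_le_D]) blast
  have SI: "tri_ideal K S F" by (rule ideal_between[OF S(1-3)])
  define E where "E = quot_algebra F S"
  define q where "q x = S +>\<^bsub>F\<^esub> x" for x
  define p where "p = induced_map \<pi>"
  define N where "N = {x \<in> carrier E. p x = \<zero>\<^bsub>L\<^esub>}"
  have E: "triassociative_algebra K E" unfolding E_def by (rule F.quot_triassociative[OF SI])
  interpret E: triassociative_algebra K E by (rule E)
  have q: "q \<in> triassoc_hom K F E"
    using F.quot_hom[OF SI] unfolding E_def q_def[abs_def] .
  note ql = linear_mapD[OF triassoc_hom_linear[OF F.triassociative_algebra_axioms E q]]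
  have car: "carrier E = q ` carrier F" by (simp add: E_def q_def a_rcosets_eq_image)
  have \<pi>S: "\<pi> s = \<zero>\<^bsub>L\<^esub>" if "s \<in> S" for s using that S(3) R_eq by auto
  have p: "p \<in> triassoc_hom K E L"
    unfolding p_def E_def by (rule F.induced_hom[OF SI L.triassociative_algebra_axioms hom \<pi>S])
  have pq: "p (q x) = \<pi> x" if "x \<in> carrier F" for x
    unfolding p_def q_def by (rule F.linear_induced_map[OF S(1) pi_linear \<pi>S that])
  have psurj: "p ` carrier E = carrier L"
    unfolding car image_image using pq surj by (simp cong: image_cong)
  have Nq: "N = q ` R" using pq by (auto simp: N_def car R_eq)
  \<comment> \<open>Since \<open>R = S + (R \<inter> D)\<close>, every class in \<open>N\<close> has
    a representative in \<open>D\<close>. This places \<open>N\<close> in the derived algebra and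
    supplies the representatives for the isomorphism with \<open>Mult\<close>.\<close>
  have qD: "\<exists>d\<in>R \<inter> D. q r = q d" if r: "r \<in> R" for r
  proof -
    obtain s d where sd: "s \<in> S" "d \<in> R \<inter> D" "r = s \<oplus>\<^bsub>F\<^esub> d" using dec[OF r] by blast
    then have "q r = q d"
      unfolding q_def using F.coset_eqI[OF S(1) sd(1)] subspaceD(4)[OF RD_sub] by simp
    then show ?thesis using sd by blast
  qed
  have NRD: "N = q ` (R \<inter> D)" using qD unfolding Nq by blast
  have "q ` D = derived K E"
    using image_derived[OF F.triassociative_algebra_axioms E q] car by simp
  then have Nder: "N \<subseteq> derived K E" using NRD by blast
  have Ncen: "N \<subseteq> tri_center E"
  proof
    fix n assume "n \<in> N"
    then obtain r where r: "r \<in> R" "n = q r" unfolding Nq by blast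
    have rc: "r \<in> carrier F" using r R_carrier by blast
    have "op' n x = \<zero>\<^bsub>E\<^esub> \<and> op' x n = \<zero>\<^bsub>E\<^esub>" if x: "x \<in> carrier E" and op': "op' \<in> tri_products E" for x op'
    proof -
      obtain op where op: "op \<in> tri_products F"
        "\<And>x y. \<lbrakk>x \<in> carrier F; y \<in> carrier F\<rbrakk> \<Longrightarrow> q (op x y) = op' (q x) (q y)"
        using triassoc_hom_product'[OF q op'] by metis
      obtain a where a: "a \<in> carrier F" "x = q a" using x car by blast
      \<comment> \<open>Products with \<open>r\<close> fall into \<open>C\<close>, which
        \<open>S\<close> contains, so they vanish in \<open>E\<close>; this is the centrality of
        \<open>N\<close>.\<close>
      have "op a r \<in> S" "op r a \<in> S"
        using F.op_in_comm_ideal[OF R_carrier op(1) a(1) r(1)] S(2) by auto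
      then have "q (op a r) = S" "q (op r a) = S"
        unfolding q_def using F.coset_zero_iff[OF S(1)] subspaceD(4)[OF S(1)] by blast+
      then show ?thesis using op(2) a r rc by (simp add: E_def)
    qed
    moreover have "n \<in> carrier E" using r rc ql(4) by simp
    ultimately show "n \<in> tri_center E" unfolding tri_center_def by blast
  qed
  have f: "q d \<inter> D = C +>\<^bsub>F\<^esub> d" if "d \<in> R \<inter> D" for d
    unfolding q_def using coset_inter_derived[OF S(1,4)] that by blast
  note m = linear_mapD[OF Mult_linear] and rd = subspaceD[OF RD_sub]
  have prod: "op x y \<in> R \<inter> D" if "op \<in> tri_products F" "x \<in> R \<inter> D" "y \<in> R \<inter> D" for op x y
    using that tri_idealD(2)[OF R_ideal] F.op_in_derived rd(4) by simp
  \<comment> \<open>On \<open>N\<close> each coset \<open>q d\<close> with \<open>d\<close> in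
    \<open>R \<inter> D\<close> meets \<open>D\<close> in the coset of \<open>C\<close> through
    \<open>d\<close>, so all laws reduce to representatives.\<close>
  have "(\<lambda>A. A \<inter> D) \<in> triassoc_hom K (E\<lparr>carrier := N\<rparr>) Mult"
    unfolding triassoc_hom_def
  proof (intro CollectI conjI module_homI ballI)
    fix A assume "A \<in> carrier (E\<lparr>carrier := N\<rparr>)"
    then obtain d where d: "d \<in> R \<inter> D" "A = q d" unfolding NRD by auto
    show "A \<inter> D \<in> carrier Mult" unfolding d(2) f[OF d(1)] Mult_carrier using d(1) by blast
    {
      fix c assume c: "c \<in> carrier K"
      have "c \<odot>\<^bsub>E\<^esub> q d = q (c \<odot>\<^bsub>F\<^esub> d)" using ql(6) c rd(4)[OF d(1)] by simp
      then show "(c \<odot>\<^bsub>E\<lparr>carrier := N\<rparr>\<^esub> A) \<inter> D = c \<odot>\<^bsub>Mult\<^esub> (A \<inter> D)"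
        unfolding d(2) f[OF d(1)] using f[OF rd(6)[OF c d(1)]] m(6)[OF c, of d] d(1) by simp
    }
    fix B assume "B \<in> carrier (E\<lparr>carrier := N\<rparr>)"
    then obtain e where e: "e \<in> R \<inter> D" "B = q e" unfolding NRD by auto
    have "q d \<oplus>\<^bsub>E\<^esub> q e = q (d \<oplus>\<^bsub>F\<^esub> e)" using ql(5) rd(4) d(1) e(1) by simp
    then show "(A \<oplus>\<^bsub>E\<lparr>carrier := N\<rparr>\<^esub> B) \<inter> D = (A \<inter> D) \<oplus>\<^bsub>Mult\<^esub> (B \<inter> D)"
      unfolding d(2) e(2) f[OF d(1)] f[OF e(1)]
      using f[OF rd(5)[OF d(1) e(1)]] m(5)[of d e] d(1) e(1) by simp
    have c: "d \<in> carrier F" "e \<in> carrier F" using d(1) e(1) rd(4) by auto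
    show "vd (E\<lparr>carrier := N\<rparr>) A B \<inter> D = vd Mult (A \<inter> D) (B \<inter> D)"
      "dv (E\<lparr>carrier := N\<rparr>) A B \<inter> D = dv Mult (A \<inter> D) (B \<inter> D)"
      "pp (E\<lparr>carrier := N\<rparr>) A B \<inter> D = pp Mult (A \<inter> D) (B \<inter> D)"
      unfolding d(2) e(2) f[OF d(1)] f[OF e(1)]
      using f[OF prod[OF tri_productsI(1) d(1) e(1)]] f[OF prod[OF tri_productsI(2) d(1) e(1)]]
        f[OF prod[OF tri_productsI(3) d(1) e(1)]]
      by (simp_all add: mult_of_presentation_def F.coset_op_coset[OF C_ideal] c
          triassoc_homD(2-4)[OF q, symmetric])
  qed
  moreover have "bij_betw (\<lambda>A. A \<inter> D) N (carrier Mult)"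
    unfolding bij_betw_def
  proof
    show "inj_on (\<lambda>A. A \<inter> D) N"
    proof (rule inj_onI)
      fix A B assume "A \<in> N" "B \<in> N" and eq: "A \<inter> D = B \<inter> D"
      then obtain d e where de: "d \<in> R \<inter> D" "e \<in> R \<inter> D" "A = q d" "B = q e" unfolding NRD by blast
      then have "C +>\<^bsub>F\<^esub> d = C +>\<^bsub>F\<^esub> e" using eq f by simp
      then have "d \<ominus>\<^bsub>F\<^esub> e \<in> S" using F.coset_eq_iff[OF C_sub] de rd(4) S(2) by blast
      then show "A = B" unfolding de(3,4) q_def using F.coset_eq_iff[OF S(1)] de(1,2) rd(4) by blast
    qed
    show "(\<lambda>A. A \<inter> D) ` N = carrier Mult"
      unfolding NRD Mult_carrier image_image using f by (intro image_cong) auto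
  qed
  ultimately have "triassoc_isomorphic K (E\<lparr>carrier := N\<rparr>) Mult"
    unfolding triassoc_isomorphic_def by auto
  then show ?thesis by (rule that[OF E p psurj N_def Ncen Nder])
qed

text \<open>Freeness at \<open>'k\<close> lifts the presentation to
  \<open>h : F \<rightarrow> E\<close>, and freeness at \<open>'f\<close> gives
  \<open>p \<circ> h = \<pi>\<close>. Then \<open>h\<close> maps \<open>R\<close> into
  \<open>M\<close> and, \<open>M\<close> being central, kills \<open>C\<close>; so it descends to
  \<open>Mult\<close>.\<close>

lemma Mult_onto_kernel:
  fixes E :: "('a, 'k) triassoc"
  assumes free: "free_on K X F TYPE('f)" "free_on K X F TYPE('k)"
    and E: "triassociative_algebra K E" and p: "p \<in> triassoc_hom K E L"
    and psurj: "p ` carrier E = carrier L"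
    and M: "M = {x \<in> carrier E. p x = \<zero>\<^bsub>L\<^esub>}" "M \<subseteq> tri_center E" "M \<subseteq> derived K E"
  obtains t where "linear_map K Mult (E\<lparr>carrier := M\<rparr>) t" "t ` carrier Mult = M"
proof -
  interpret E: triassociative_algebra K E by fact
  note pl = linear_mapD[OF triassoc_hom_linear[OF E L.triassociative_algebra_axioms p]]
    and l = linear_mapD[OF pi_linear]
  have X: "X \<subseteq> carrier F" using free by (auto simp: free_on_def)
  \<comment> \<open>Values on the generators: an arbitrary preimage under the surjection
    \<open>p\<close> of the element prescribed by \<open>\<pi>\<close>.\<close>
  define g where "g x = (SOME e. e \<in> carrier E \<and> p e = \<pi> x)" for x
  have g: "g x \<in> carrier E \<and> p (g x) = \<pi> x" if "x \<in> carrier F" for x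
  proof -
    have "\<exists>e. e \<in> carrier E \<and> p e = \<pi> x" using l(4)[OF that] unfolding psurj[symmetric] by auto
    then show ?thesis unfolding g_def by (rule someI_ex)
  qed
  have "g \<in> X \<rightarrow> carrier E" using g X by auto
  then obtain h where h: "h \<in> triassoc_hom K F E" and hg: "\<And>x. x \<in> X \<Longrightarrow> h x = g x"
    by (rule free_on_lift[OF free(2) E]) blast
  have ph: "p (h x) = \<pi> x" if "x \<in> carrier F" for x
    by (rule free_hom_unique[OF free(1) L.triassociative_algebra_axioms triassoc_hom_compose[OF h p] hom _ that])
      (use hg g X in auto)
  have hlin: "linear_map K F E h" by (rule triassoc_hom_linear[OF F.triassociative_algebra_axioms E h])
  note hl = linear_mapD[OF hlin]
  have hR: "h x \<in> M" if "x \<in> R" for x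
    using that ph hl(4) unfolding R_eq M(1) by auto
  have Msub: "subspace K M E"
    unfolding M(1) by (rule tri_idealD(1)[OF tri_ideal_kernel[OF E L.triassociative_algebra_axioms p]])
  have "C \<subseteq> {x \<in> carrier F. h x \<in> {\<zero>\<^bsub>E\<^esub>}}"
  proof (rule F.comm_ideal_le[OF R_carrier])
    show "subspace K {x \<in> carrier F. h x \<in> {\<zero>\<^bsub>E\<^esub>}} F"
      by (intro linear_map_vimage_subspace[OF hlin] E.subspaceI) auto
    fix op x r assume op: "op \<in> tri_products F" and x: "x \<in> carrier F" and r: "r \<in> R"
    have rc: "r \<in> carrier F" using r R_carrier by blast
    obtain op' where op': "op' \<in> tri_products E"
      "\<And>x y. \<lbrakk>x \<in> carrier F; y \<in> carrier F\<rbrakk> \<Longrightarrow> h (op x y) = op' (h x) (h y)"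
      using triassoc_hom_product[OF h op] by metis
    have "op' (h x) (h r) = \<zero>\<^bsub>E\<^esub>" "op' (h r) (h x) = \<zero>\<^bsub>E\<^esub>"
      using hR[OF r] M(2) op'(1) hl(4)[OF x] unfolding tri_center_def by blast+
    then show "op x r \<in> {x \<in> carrier F. h x \<in> {\<zero>\<^bsub>E\<^esub>}} \<and> op r x \<in> {x \<in> carrier F. h x \<in> {\<zero>\<^bsub>E\<^esub>}}"
      using op'(2) x rc F.op_simps(1)[OF op] by simp
  qed
  then have hC: "h c = \<zero>\<^bsub>E\<^esub>" if "c \<in> C" for c using that by blast
  \<comment> \<open>Every element of \<open>E\<close> is congruent modulo the central
    \<open>M\<close> to a value of \<open>h\<close>, so every product in \<open>E\<close> is already
    a product of values of \<open>h\<close>. Surjectivity onto \<open>M\<close> follows because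
    \<open>M\<close> lies in the derived algebra.\<close>
  have "derived K E \<subseteq> h ` D"
  proof (rule E.derived_le[OF linear_map_image_subspace[OF hlin F.derived_subspace]])
    fix op' x y assume op': "op' \<in> tri_products E" and x: "x \<in> carrier E" and y: "y \<in> carrier E"
    obtain a b where a: "a \<in> carrier F" "\<pi> a = p x" and b: "b \<in> carrier F" "\<pi> b = p y"
      using pl(4)[OF x] pl(4)[OF y] unfolding surj[symmetric] by auto
    have "x \<ominus>\<^bsub>E\<^esub> h a \<in> M" "y \<ominus>\<^bsub>E\<^esub> h b \<in> M"
      unfolding M(1) using a b x y pl(4,8) hl(4) ph by auto
    then have "op' (x \<ominus>\<^bsub>E\<^esub> h a) y = \<zero>\<^bsub>E\<^esub>" "op' (h a) (y \<ominus>\<^bsub>E\<^esub> h b) = \<zero>\<^bsub>E\<^esub>"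
      using M(2) op' y hl(4)[OF a(1)] unfolding tri_center_def by blast+
    then have "op' x y = op' (h a) (h b)"
      using x y hl(4)[OF a(1)] hl(4)[OF b(1)] by (simp add: E.op_simps[OF op'])
    moreover obtain op where op: "op \<in> tri_products F" "h (op a b) = op' (h a) (h b)"
      using triassoc_hom_product'[OF h op'] a b by metis
    ultimately show "op' x y \<in> h ` D"
      using F.op_in_derived[OF op(1) a(1) b(1)] by (metis imageI)
  qed
  then have "M \<subseteq> h ` D" using M(3) by blast
  have MRD: "h ` (R \<inter> D) = M"
  proof (intro equalityI subsetI)
    fix m assume m: "m \<in> M"
    then obtain d where d: "d \<in> D" "m = h d" using \<open>M \<subseteq> h ` D\<close> by blast
    have dc: "d \<in> carrier F" using d subspaceD(4)[OF F.derived_subspace] by blast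
    then have "\<pi> d = \<zero>\<^bsub>L\<^esub>" using ph[OF dc] m d M(1) by simp
    then show "m \<in> h ` (R \<inter> D)" using d dc R_eq by blast
  qed (use hR in blast)
  have "linear_map K (F\<lparr>carrier := R \<inter> D\<rparr>) (E\<lparr>carrier := M\<rparr>) h"
    by (rule linear_map_restrict[OF hlin RD_sub Msub]) (use hR in blast)
  note t = vectorspace.induced_map_linear[OF RD_vs C_sub_RD Mult_quotient this]
    and i = vectorspace.linear_induced_map[OF RD_vs C_sub_RD this]
  have "linear_map K Mult (E\<lparr>carrier := M\<rparr>) (induced_map h)"
    by (rule t) (use hC in simp)
  moreover have "induced_map h ` carrier Mult = M"
    unfolding Mult_carrier image_image MRD[symmetric]
    by (rule image_cong[OF refl]) (use i hC in simp)
  ultimately show ?thesis by (rule that)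
qed

text \<open>By rank-nullity every defining pair has dimension \<open>dim L\<close> plus that of its
  kernel, so maximality is a comparison of kernels: \<open>N\<close>, being isomorphic to
  \<open>Mult\<close>, maps onto each competing kernel \<open>M'\<close>.\<close>

theorem is_multiplier_of_presentation:
  assumes free: "free_on K X F TYPE('f)" "free_on K X F TYPE('k)"
    and fd: "vectorspace.fin_dim K L"
  shows "is_multiplier K L Mult TYPE('f set) TYPE('k)"
proof -
  note L = L.triassociative_algebra_axioms
  obtain E :: "('a, 'f set) triassoc" and N p where E: "triassociative_algebra K E"
    and p: "p \<in> triassoc_hom K E L" "p ` carrier E = carrier L"
    and N: "N = {x \<in> carrier E. p x = \<zero>\<^bsub>L\<^esub>}" "N \<subseteq> tri_center E" "N \<subseteq> derived K E"
    and iso: "triassoc_isomorphic K (E\<lparr>carrier := N\<rparr>) Mult"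
    by (rule stem_extension_exists)
  interpret E: triassociative_algebra K E by fact
  have Efd: "E.fin_dim" by (rule stem_extension_fin_dim[OF E L p N fd])
  have Nsub: "subspace K N E" unfolding N(1) by (rule tri_idealD(1)[OF tri_ideal_kernel[OF E L p(1)]])
  have Nfd: "vectorspace.fin_dim K (E\<lparr>carrier := N\<rparr>)" by (rule E.subspace_fin_dim[OF Efd Nsub])
  obtain f where f: "f \<in> triassoc_hom K (E\<lparr>carrier := N\<rparr>) Mult" "f ` N = carrier Mult"
    using iso by (auto simp: triassoc_isomorphic_def bij_betw_def)
  have flin: "linear_map K (E\<lparr>carrier := N\<rparr>) Mult f"
    using triassoc_homD(1)[OF f(1)] Mult_vs subspaceD(7)[OF Nsub] by (simp add: linear_map_iff)
  have "vectorspace.fin_dim K E' \<and> vectorspace.dim K E' \<le> E.dim"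
    if dp: "defining_pair K L E' M'" for E' :: "('a, 'k) triassoc" and M'
  proof -
    obtain p' where E': "triassociative_algebra K E'"
      and p': "p' \<in> triassoc_hom K E' L" "p' ` carrier E' = carrier L"
      and M': "M' = {x \<in> carrier E'. p' x = \<zero>\<^bsub>L\<^esub>}" "M' \<subseteq> tri_center E'" "M' \<subseteq> derived K E'"
      by (rule defining_pairE[OF L dp])
    have E'fd: "vectorspace.fin_dim K E'" by (rule stem_extension_fin_dim[OF E' L p' M' fd])
    obtain t where t: "linear_map K Mult (E'\<lparr>carrier := M'\<rparr>) t" "t ` carrier Mult = M'"
      by (rule Mult_onto_kernel[OF free E' p' M'])
    have "(\<lambda>x. t (f x)) ` carrier (E\<lparr>carrier := N\<rparr>) = carrier (E'\<lparr>carrier := M'\<rparr>)"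
      using f(2) t(2) by (simp flip: image_image)
    then have "vectorspace.dim K (E'\<lparr>carrier := M'\<rparr>) \<le> vectorspace.dim K (E\<lparr>carrier := N\<rparr>)"
      using dim_surj[OF linear_map_compose[OF flin t(1)] _ Nfd] by simp
    moreover have "E.dim = L.dim + vectorspace.dim K (E\<lparr>carrier := N\<rparr>)"
      unfolding N(1) by (rule dim_surj[OF triassoc_hom_linear[OF E L p(1)] p(2) Efd])
    moreover have "vectorspace.dim K E' = L.dim + vectorspace.dim K (E'\<lparr>carrier := M'\<rparr>)"
      unfolding M'(1) by (rule dim_surj[OF triassoc_hom_linear[OF E' L p'(1)] p'(2) E'fd])
    ultimately show ?thesis using E'fd by simp
  qed
  then have "maximal_defining_pair K L E N TYPE('k)"
    unfolding maximal_defining_pair_def using E.defining_pairI[OF L p N] Efd by blast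
  then show ?thesis unfolding is_multiplier_def using iso by blast
qed

end

section \<open>The exact sequence\<close>

lemma linear_map_cong:
  assumes "linear_map K V W f" "\<And>x. x \<in> carrier V \<Longrightarrow> g x = f x"
  shows "linear_map K V W g"
proof -
  interpret V: vectorspace K V by (rule linear_mapD(1)[OF assms(1)])
  show ?thesis
    unfolding linear_map_iff
    by (intro conjI module_homI linear_mapD(1,2)[OF assms(1)])
      (simp_all add: assms(2) linear_mapD(4-6)[OF assms(1)])
qed

lemma linear_map_copair:
  assumes f: "linear_map K A V f" and g: "linear_map K B V g"
  shows "linear_map K (direct_sum A B) V (\<lambda>(a, b). f a \<oplus>\<^bsub>V\<^esub> g b)"
proof -
  interpret V: vectorspace K V by (rule linear_mapD(2)[OF f])
  note fl = linear_mapD[OF f] and gl = linear_mapD[OF g]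
  show ?thesis
    unfolding linear_map_iff
    by (intro conjI module_homI direct_sum_is_vs fl(1,2) gl(1))
      (auto simp: direct_sum_def fl(4-6) gl(4-6) V.M.a_ac V.smult_r_distr)
qed

lemma image_copair:
  assumes V: "vectorspace K V" and f: "f ` carrier A = module.span K V S" and g: "g ` carrier B = module.span K V T"
    and ST: "S \<subseteq> carrier V" "T \<subseteq> carrier V"
  shows "(\<lambda>(a, b). f a \<oplus>\<^bsub>V\<^esub> g b) ` carrier (direct_sum A B) = module.span K V (S \<union> T)"
  unfolding vectorspace.set_add_span[OF V ST, symmetric] f[symmetric] g[symmetric]
  by (auto simp: direct_sum_def set_add_def' image_iff)

lemma bilinear_on_flip: "bilinear_on K V W U b \<Longrightarrow> bilinear_on K W V U (\<lambda>w v. b v w)"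
  by (auto simp: bilinear_on_def)

context triassociative_algebra
begin

text \<open>The axioms cover all nine left-bracketed and all nine right-bracketed combinations of
  two products. Which products result is irrelevant later; it only matters that the bracket can be
  moved either way.\<close>

lemma reassociate:
  assumes "op \<in> tri_products L" "op' \<in> tri_products L" "x \<in> carrier L" "y \<in> carrier L" "z \<in> carrier L"
  shows "\<exists>op1\<in>tri_products L. \<exists>op2\<in>tri_products L. op (op' x y) z = op1 x (op2 y z)"
    and "\<exists>op1\<in>tri_products L. \<exists>op2\<in>tri_products L. op x (op' y z) = op1 (op2 x y) z"
proof -
  note a = triassoc[OF assms(3-5)]
  show "\<exists>op1\<in>tri_products L. \<exists>op2\<in>tri_products L. op (op' x y) z = op1 x (op2 y z)"
    using assms(1,2) a unfolding tri_products_def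
    by (elim insertE emptyE; hypsubst; simp; metis)
  show "\<exists>op1\<in>tri_products L. \<exists>op2\<in>tri_products L. op x (op' y z) = op1 (op2 x y) z"
    using assms(1,2) a unfolding tri_products_def
    by (elim insertE emptyE; hypsubst; simp; metis)
qed

end

section \<open>The maps \<beta> and \<gamma>\<close>

locale central_presentation = presentation K F L \<pi> R
  for K :: "('a, 'r) ring_scheme" and F :: "('a, 'f) triassoc" and L :: "('a, 'l) triassoc"
    and \<pi> :: "'f \<Rightarrow> 'l" and R +
  fixes Z :: "'l set" and T :: "'f set"
  assumes Z_central: "central_ideal K Z L" and T_eq: "T = {t \<in> carrier F. \<pi> t \<in> Z}"
begin

lemma Z_ideal: "tri_ideal K Z L"
  using Z_central by (simp add: central_ideal_def)

lemmas Z_sub = tri_idealD(1)[OF Z_ideal]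

text \<open>The composite of \<open>\<pi>\<close> with the coset map of \<open>Z\<close> has kernel
  \<open>T\<close>. Thus \<open>Q.C\<close> is \<open>C(T)\<close> and \<open>Q.Mult\<close> the
  candidate for the multiplier of \<open>L / Z\<close>.\<close>

sublocale Q: presentation K F "quot_algebra L Z" "\<lambda>x. Z +>\<^bsub>L\<^esub> \<pi> x" T
proof (rule presentation.intro[OF F.triassociative_algebra_axioms L.quot_triassociative[OF Z_ideal]
      presentation_axioms.intro])
  show "(\<lambda>x. Z +>\<^bsub>L\<^esub> \<pi> x) \<in> triassoc_hom K F (quot_algebra L Z)"
    by (rule triassoc_hom_compose[OF hom L.quot_hom[OF Z_ideal]])
  show "(\<lambda>x. Z +>\<^bsub>L\<^esub> \<pi> x) ` carrier F = carrier (quot_algebra L Z)"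
    by (simp add: a_rcosets_eq_image image_image flip: surj)
  show "T = {x \<in> carrier F. Z +>\<^bsub>L\<^esub> \<pi> x = \<zero>\<^bsub>quot_algebra L Z\<^esub>}"
    using L.coset_zero_iff[OF Z_sub] linear_mapD(4)[OF pi_linear] unfolding T_eq by auto
qed

lemma central_product:
  assumes "op \<in> tri_products L" "x \<in> carrier L" "z \<in> Z"
  shows "op x z = \<zero>\<^bsub>L\<^esub>" "op z x = \<zero>\<^bsub>L\<^esub>"
  using assms Z_central by (auto simp: central_ideal_def tri_center_def)

lemma R_le_T: "R \<subseteq> T"
  using subspaceD(3)[OF Z_sub] by (auto simp: R_eq T_eq)

text \<open>\<open>\<pi>\<close> sends a product with a factor in \<open>T\<close> to a product with
  a factor in the central ideal \<open>Z\<close>, hence to zero.\<close>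

lemma CT_le_R: "Q.C \<subseteq> R"
proof (rule F.comm_ideal_le[OF Q.R_carrier R_sub])
  fix op x t assume op: "op \<in> tri_products F" and x: "x \<in> carrier F" and t: "t \<in> T"
  have tc: "t \<in> carrier F" using t Q.R_carrier by blast
  obtain op' where op': "op' \<in> tri_products L"
    "\<And>x y. \<lbrakk>x \<in> carrier F; y \<in> carrier F\<rbrakk> \<Longrightarrow> \<pi> (op x y) = op' (\<pi> x) (\<pi> y)"
    using triassoc_hom_product[OF hom op] by metis
  have "\<pi> x \<in> carrier L" "\<pi> t \<in> Z" using linear_mapD(4)[OF pi_linear x] t by (auto simp: T_eq)
  then show "op x t \<in> R \<and> op t x \<in> R"
    using op' x tc F.op_simps(1)[OF op] central_product[OF op'(1)] by (simp add: R_eq)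
qed

lemma CT_le_RD: "Q.C \<subseteq> R \<inter> D"
  using CT_le_R Q.C_le_D by blast

lemma CR_le_CT: "C \<subseteq> Q.C"
proof (rule F.comm_ideal_le[OF R_carrier Q.C_sub])
  fix op x r assume *: "op \<in> tri_products F" "x \<in> carrier F" "r \<in> R"
  then have "r \<in> T" using R_le_T by blast
  then show "op x r \<in> Q.C \<and> op r x \<in> Q.C" using F.op_in_comm_ideal[OF Q.R_carrier *(1,2)] by blast
qed

lemma beta_linear: "linear_map K Mult Q.Mult (beta_map K F T)"
  and beta_coset: "x \<in> R \<inter> D \<Longrightarrow> beta_map K F T (C +>\<^bsub>F\<^esub> x) = Q.C +>\<^bsub>F\<^esub> x"
proof -
  have f: "linear_map K (F\<lparr>carrier := R \<inter> D\<rparr>) Q.Mult (\<lambda>x. Q.C +>\<^bsub>F\<^esub> x)"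
    unfolding linear_map_iff
    by (intro conjI module_homI RD_vs Q.Mult_vs)
      (simp_all add: subsetD[OF R_le_T] linear_mapD(4-6)[OF Q.Mult_linear, simplified])
  have ker: "Q.C +>\<^bsub>F\<^esub> u = \<zero>\<^bsub>Q.Mult\<^esub>" if "u \<in> C" for u
    using that CR_le_CT F.coset_zero_iff[OF Q.C_sub] subspaceD(4)[OF Q.C_sub] unfolding Q.Mult_zero by blast
  show "linear_map K Mult Q.Mult (beta_map K F T)"
    unfolding beta_map_def by (rule vectorspace.induced_map_linear[OF RD_vs C_sub_RD Mult_quotient f ker])
  show "beta_map K F T (C +>\<^bsub>F\<^esub> x) = Q.C +>\<^bsub>F\<^esub> x" if "x \<in> R \<inter> D"
    using vectorspace.linear_induced_map[OF RD_vs C_sub_RD f ker] that unfolding beta_map_def by simp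
qed

lemma derived_Z_sub: "subspace K (derived K L \<inter> Z) L"
  by (rule L.subspace_Int[OF L.derived_subspace Z_sub])

lemma image_D: "\<pi> ` D = derived K L"
  by (rule image_derived[OF F.triassociative_algebra_axioms L.triassociative_algebra_axioms hom surj])

lemma gamma_linear: "linear_map K Q.Mult (L\<lparr>carrier := derived K L \<inter> Z\<rparr>) (gamma_map \<pi>)"
  and gamma_coset: "x \<in> T \<inter> D \<Longrightarrow> gamma_map \<pi> (Q.C +>\<^bsub>F\<^esub> x) = \<pi> x"
proof -
  have f: "linear_map K (F\<lparr>carrier := T \<inter> D\<rparr>) (L\<lparr>carrier := derived K L \<inter> Z\<rparr>) \<pi>"
    by (rule linear_map_restrict[OF pi_linear Q.RD_sub derived_Z_sub])
      (use image_D in \<open>auto simp: T_eq\<close>)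
  have ker: "\<pi> u = \<zero>\<^bsub>L\<lparr>carrier := derived K L \<inter> Z\<rparr>\<^esub>" if "u \<in> Q.C" for u
    using that CT_le_R by (auto simp: R_eq)
  show "linear_map K Q.Mult (L\<lparr>carrier := derived K L \<inter> Z\<rparr>) (gamma_map \<pi>)"
    unfolding gamma_map_def
    by (rule vectorspace.induced_map_linear[OF Q.RD_vs Q.C_sub_RD Q.Mult_quotient f ker])
  show "gamma_map \<pi> (Q.C +>\<^bsub>F\<^esub> x) = \<pi> x" if "x \<in> T \<inter> D"
    using vectorspace.linear_induced_map[OF Q.RD_vs Q.C_sub_RD f ker] that unfolding gamma_map_def by simp
qed

text \<open>\<open>\<pi>\<close> maps \<open>D\<close> onto the derived algebra of \<open>L\<close>,
  and \<open>T\<close> is the full preimage of \<open>Z\<close>; so a preimage in \<open>D\<close>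
  of an element of \<open>Z\<close> lies in \<open>T\<close> automatically.\<close>

lemma gamma_onto: "gamma_map \<pi> ` carrier Q.Mult = derived K L \<inter> Z"
proof -
  have "gamma_map \<pi> ` carrier Q.Mult = \<pi> ` (T \<inter> D)"
    unfolding Q.Mult_carrier image_image using gamma_coset by (intro image_cong) auto
  also have "\<dots> = derived K L \<inter> Z"
    unfolding image_D[symmetric] using subspaceD(4)[OF F.derived_subspace] by (auto simp: T_eq)
  finally show ?thesis .
qed

lemma exact_at_Mult_quotient:
  "exact_at K Mult (beta_map K F T) Q.Mult (gamma_map \<pi>) (L\<lparr>carrier := derived K L \<inter> Z\<rparr>)"
  unfolding exact_at_def
proof (intro conjI beta_linear gamma_linear)
  have "beta_map K F T ` carrier Mult = (\<lambda>x. Q.C +>\<^bsub>F\<^esub> x) ` (R \<inter> D)"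
    unfolding Mult_carrier image_image using beta_coset by (intro image_cong) auto
  also have "\<dots> = {v \<in> carrier Q.Mult. gamma_map \<pi> v = \<zero>\<^bsub>L\<^esub>}"
  proof (intro equalityI subsetI)
    fix v assume "v \<in> (\<lambda>x. Q.C +>\<^bsub>F\<^esub> x) ` (R \<inter> D)"
    then obtain x where x: "x \<in> R \<inter> D" "v = Q.C +>\<^bsub>F\<^esub> x" by blast
    then have xT: "x \<in> T \<inter> D" using R_le_T by blast
    then show "v \<in> {v \<in> carrier Q.Mult. gamma_map \<pi> v = \<zero>\<^bsub>L\<^esub>}"
      using x gamma_coset[OF xT] unfolding Q.Mult_carrier by (auto simp: R_eq)
  next
    fix v assume v: "v \<in> {v \<in> carrier Q.Mult. gamma_map \<pi> v = \<zero>\<^bsub>L\<^esub>}"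
    then obtain x where x: "x \<in> T \<inter> D" "v = Q.C +>\<^bsub>F\<^esub> x" unfolding Q.Mult_carrier by blast
    then have "\<pi> x = \<zero>\<^bsub>L\<^esub>" using v gamma_coset by simp
    then show "v \<in> (\<lambda>x. Q.C +>\<^bsub>F\<^esub> x) ` (R \<inter> D)" using x by (auto simp: R_eq T_eq)
  qed
  finally show "beta_map K F T ` carrier Mult
    = {v \<in> carrier Q.Mult. gamma_map \<pi> v = \<zero>\<^bsub>L\<lparr>carrier := derived K L \<inter> Z\<rparr>\<^esub>}" by simp
qed

abbreviation "\<kappa> x \<equiv> C +>\<^bsub>F\<^esub> x"

lemma kernel_beta: "{v \<in> carrier Mult. beta_map K F T v = \<zero>\<^bsub>Q.Mult\<^esub>} = \<kappa> ` Q.C"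
proof (intro equalityI subsetI)
  fix v assume v: "v \<in> {v \<in> carrier Mult. beta_map K F T v = \<zero>\<^bsub>Q.Mult\<^esub>}"
  then obtain x where x: "x \<in> R \<inter> D" "v = \<kappa> x" unfolding Mult_carrier by blast
  then have "x \<in> Q.C"
    using v beta_coset F.coset_zero_iff[OF Q.C_sub] subspaceD(4)[OF RD_sub] by (auto simp: Q.Mult_zero)
  then show "v \<in> \<kappa> ` Q.C" using x by blast
next
  fix v assume "v \<in> \<kappa> ` Q.C"
  then obtain x where x: "x \<in> Q.C" "v = \<kappa> x" by blast
  then have "x \<in> R \<inter> D" using CT_le_RD by blast
  then show "v \<in> {v \<in> carrier Mult. beta_map K F T v = \<zero>\<^bsub>Q.Mult\<^esub>}"
    using x beta_coset F.coset_zero_iff[OF Q.C_sub] subspaceD(4)[OF RD_sub]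
    by (auto simp: Q.Mult_zero Mult_carrier)
qed

end

section \<open>The maps \<alpha> and \<theta>, and the image of their sum\<close>

context central_presentation
begin

abbreviation "Ab \<equiv> abelianization K L"
abbreviation "Zs \<equiv> L\<lparr>carrier := Z\<rparr>"

lemma Ab_quotient: "is_quotient L (derived K L) Ab"
  unfolding abelianization_def by (rule is_quotient_quot_space)

lemma Ab_linear: "linear_map K F Ab (\<lambda>f. derived K L +>\<^bsub>L\<^esub> \<pi> f)"
  by (rule linear_map_compose[OF pi_linear L.quotient_map_linear[OF L.derived_subspace Ab_quotient]])

lemma Ab_carrier: "carrier Ab = (\<lambda>f. derived K L +>\<^bsub>L\<^esub> \<pi> f) ` carrier F"
  unfolding L.is_quotient_carrier[OF Ab_quotient] surj[symmetric] image_image ..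

lemma Ab_vs: "vectorspace K Ab"
  by (rule linear_mapD(2)[OF Ab_linear])

lemma Z_vs: "vectorspace K Zs"
  by (rule subspaceD(7)[OF Z_sub])

lemma Z_image: "Z = \<pi> ` T"
  using surj subspaceD(4)[OF Z_sub] by (auto simp: T_eq)

text \<open>This is the identification of \<open>L / L'\<close> with \<open>F / (R + F')\<close>:
  since \<open>\<pi>\<close> maps \<open>D\<close> onto the derived algebra, the
  \<open>L'\<close>-part of the difference lifts to some \<open>d\<close> in \<open>D\<close>, and
  the rest lies in the kernel \<open>R\<close>.\<close>

lemma pi_mem_coset:
  assumes f: "f \<in> carrier F" "f' \<in> carrier F" and mem: "\<pi> f' \<in> derived K L +>\<^bsub>L\<^esub> \<pi> f"
  shows "\<exists>r\<in>R. \<exists>d\<in>D. f' \<ominus>\<^bsub>F\<^esub> f = r \<oplus>\<^bsub>F\<^esub> d"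
proof -
  note l = linear_mapD[OF pi_linear]
  obtain y where y: "y \<in> derived K L" "\<pi> f' = y \<oplus>\<^bsub>L\<^esub> \<pi> f"
    using mem by (auto simp: a_r_coset_def')
  obtain d where d: "d \<in> D" "\<pi> d = y" using y(1) unfolding image_D[symmetric] by blast
  have dc: "d \<in> carrier F" using d subspaceD(4)[OF F.derived_subspace] by blast
  have "\<pi> ((f' \<ominus>\<^bsub>F\<^esub> f) \<ominus>\<^bsub>F\<^esub> d) = (\<pi> d \<oplus>\<^bsub>L\<^esub> \<pi> f) \<ominus>\<^bsub>L\<^esub> \<pi> f \<ominus>\<^bsub>L\<^esub> \<pi> d"
    using f dc y(2) d(2) by (simp add: l)
  also have "\<dots> = \<zero>\<^bsub>L\<^esub>"
    using l(4)[OF f(1)] l(4)[OF dc] by (simp add: a_minus_def L.M.a_assoc L.M.r_neg)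
  finally have "(f' \<ominus>\<^bsub>F\<^esub> f) \<ominus>\<^bsub>F\<^esub> d \<in> R" using f dc by (simp add: R_eq)
  moreover have "f' \<ominus>\<^bsub>F\<^esub> f = ((f' \<ominus>\<^bsub>F\<^esub> f) \<ominus>\<^bsub>F\<^esub> d) \<oplus>\<^bsub>F\<^esub> d"
    using f dc by (simp add: a_minus_def F.M.a_assoc F.M.l_neg)
  ultimately show ?thesis using d(1) by blast
qed

text \<open>Both \<open>(x, y) \<mapsto> x * y\<close> and \<open>(x, y) \<mapsto> y * x\<close> are pairings in this sense; the former gives the
  maps \<open>\<alpha>\<close>, the latter the maps \<open>\<theta>\<close>.\<close>

definition pairing :: "('f \<Rightarrow> 'f \<Rightarrow> 'f) \<Rightarrow> bool" where
  "pairing m \<longleftrightarrow>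
     (\<forall>x\<in>carrier F. linear_map K F F (\<lambda>y. m x y) \<and> linear_map K F F (\<lambda>y. m y x)) \<and>
     (\<forall>x\<in>carrier F. \<forall>r\<in>R. m x r \<in> C \<and> m r x \<in> C) \<and>
     (\<forall>d\<in>D. \<forall>t\<in>T. m d t \<in> C) \<and>
     (\<forall>x\<in>carrier F. \<forall>t\<in>T. m x t \<in> Q.C)"

definition induced_pairing :: "('f \<Rightarrow> 'f \<Rightarrow> 'f) \<Rightarrow> 'l set \<Rightarrow> 'l \<Rightarrow> 'f set" where
  "induced_pairing m c z =
     the_elem {\<kappa> (m f t) | f t. f \<in> carrier F \<and> t \<in> carrier F \<and> \<pi> f \<in> c \<and> \<pi> t = z}"

definition pairing_values :: "('f \<Rightarrow> 'f \<Rightarrow> 'f) \<Rightarrow> 'f set" where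
  "pairing_values m = {m f t | f t. f \<in> carrier F \<and> t \<in> T}"

lemma product_derived_T:
  assumes op: "op \<in> tri_products F" and d: "d \<in> D" and t: "t \<in> T"
  shows "op d t \<in> C" "op t d \<in> C"
proof -
  have tc: "t \<in> carrier F" using t Q.R_carrier by blast
  note CT = F.op_in_comm_ideal[OF Q.R_carrier _ _ t] and CR = F.op_in_comm_ideal[OF R_carrier]
  \<comment> \<open>The admissible \<open>d\<close> form a subspace, so products
    \<open>x * y\<close> suffice; for these \<open>(x * y) * t\<close> is rewritten with
    \<open>y * t\<close> as a factor.\<close>
  have "D \<subseteq> {d \<in> carrier F. op d t \<in> C}"
  proof (rule F.derived_le[OF linear_map_vimage_subspace[OF F.op_linear(2)[OF op tc] C_sub]])
    fix op' x y assume *: "op' \<in> tri_products F" "x \<in> carrier F" "y \<in> carrier F"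
    obtain op1 op2 where o: "op1 \<in> tri_products F" "op2 \<in> tri_products F"
      "op (op' x y) t = op1 x (op2 y t)"
      using F.reassociate(1)[OF op * tc] by blast
    have "op2 y t \<in> R" using CT(1)[OF o(2) *(3)] CT_le_R by blast
    then show "op' x y \<in> {d \<in> carrier F. op d t \<in> C}"
      using CR(1)[OF o(1) *(2)] F.op_simps(1)[OF *] o(3) by simp
  qed
  then show "op d t \<in> C" using d by blast
  have "D \<subseteq> {d \<in> carrier F. op t d \<in> C}"
  proof (rule F.derived_le[OF linear_map_vimage_subspace[OF F.op_linear(1)[OF op tc] C_sub]])
    fix op' x y assume *: "op' \<in> tri_products F" "x \<in> carrier F" "y \<in> carrier F"
    obtain op1 op2 where o: "op1 \<in> tri_products F" "op2 \<in> tri_products F"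
      "op t (op' x y) = op1 (op2 t x) y"
      using F.reassociate(2)[OF op *(1) tc *(2,3)] by blast
    have "op2 t x \<in> R" using CT(2)[OF o(2) *(2)] CT_le_R by blast
    then show "op' x y \<in> {d \<in> carrier F. op t d \<in> C}"
      using CR(2)[OF o(1) *(3)] F.op_simps(1)[OF *] o(3) by simp
  qed
  then show "op t d \<in> C" using d by blast
qed

lemma pairing_product:
  assumes "op \<in> tri_products F"
  shows "pairing op" "pairing (\<lambda>x y. op y x)"
  unfolding pairing_def
  using F.op_linear[OF assms] F.op_in_comm_ideal[OF R_carrier assms]
    F.op_in_comm_ideal[OF Q.R_carrier assms] product_derived_T[OF assms]
  by simp_all

context
  fixes m assumes m: "pairing m"
begin

lemma pairing_linear:
  assumes "x \<in> carrier F"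
  shows "linear_map K F F (\<lambda>y. m x y)" "linear_map K F F (\<lambda>y. m y x)"
  using m assms by (simp_all add: pairing_def)

lemma pairing_RD:
  assumes "f \<in> carrier F" "t \<in> T"
  shows "m f t \<in> R \<inter> D"
  using m assms CT_le_RD unfolding pairing_def by blast

lemma pairing_values_RD: "pairing_values m \<subseteq> R \<inter> D"
  using pairing_RD by (auto simp: pairing_values_def)

text \<open>The arguments change one at a time. Replacing \<open>t'\<close> by \<open>t\<close>
  costs \<open>m f' (t' - t)\<close> with \<open>t' - t\<close> in \<open>R\<close>; replacing
  \<open>f'\<close> by \<open>f\<close> costs \<open>m r t + m d t\<close> with \<open>r\<close> in
  \<open>R\<close> and \<open>d\<close> in \<open>D\<close>. All these values lie in
  \<open>C\<close>.\<close>

lemma pairing_well_defined: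
  assumes f: "f \<in> carrier F" "f' \<in> carrier F" and t: "t \<in> T" "t' \<in> carrier F"
    and "\<pi> f' \<in> derived K L +>\<^bsub>L\<^esub> \<pi> f" "\<pi> t' = \<pi> t"
  shows "\<kappa> (m f' t') = \<kappa> (m f t)"
proof -
  note l = linear_mapD[OF pi_linear]
  have tc: "t \<in> carrier F" using t(1) Q.R_carrier by blast
  note lin = linear_mapD[OF pairing_linear(1)] and lin' = linear_mapD[OF pairing_linear(2)]
  obtain r d where rd: "r \<in> R" "d \<in> D" "f' \<ominus>\<^bsub>F\<^esub> f = r \<oplus>\<^bsub>F\<^esub> d"
    using pi_mem_coset[OF f assms(5)] by blast
  have rdc: "r \<in> carrier F" "d \<in> carrier F"
    using rd R_carrier subspaceD(4)[OF F.derived_subspace] by auto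
  have "t' \<ominus>\<^bsub>F\<^esub> t \<in> R" using t(2) tc assms(6) l(4)[OF tc] by (simp add: R_eq l)
  then have 1: "m f' (t' \<ominus>\<^bsub>F\<^esub> t) \<in> C" using m f unfolding pairing_def by blast
  have "m r t \<in> C" "m d t \<in> C" using m rd tc t unfolding pairing_def by blast+
  then have 2: "m (f' \<ominus>\<^bsub>F\<^esub> f) t \<in> C"
    unfolding rd(3) using lin'(5)[OF tc rdc] subspaceD(5)[OF C_sub] by simp
  have c: "m f' t' \<in> carrier F" "m f' t \<in> carrier F" "m f t \<in> carrier F"
    using lin(4) f t(2) tc by auto
  have "\<kappa> (m f' t') = \<kappa> (m f' t)"
    using F.coset_eq_iff[OF C_sub c(1,2)] 1 lin(8)[OF f(2) t(2) tc] by simp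
  also have "\<dots> = \<kappa> (m f t)"
    using F.coset_eq_iff[OF C_sub c(2,3)] 2 lin'(8)[OF tc f(2,1)] by simp
  finally show ?thesis .
qed

lemma induced_pairing_coset:
  assumes f: "f \<in> carrier F" and t: "t \<in> T"
  shows "induced_pairing m (derived K L +>\<^bsub>L\<^esub> \<pi> f) (\<pi> t) = \<kappa> (m f t)"
proof -
  have tc: "t \<in> carrier F" using t Q.R_carrier by blast
  have "\<pi> f \<in> derived K L +>\<^bsub>L\<^esub> \<pi> f"
    by (rule L.coset_mem[OF L.derived_subspace linear_mapD(4)[OF pi_linear f]])
  then have "{\<kappa> (m f' t') | f' t'. f' \<in> carrier F \<and> t' \<in> carrier F \<and>
      \<pi> f' \<in> derived K L +>\<^bsub>L\<^esub> \<pi> f \<and> \<pi> t' = \<pi> t} = {\<kappa> (m f t)}"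
    using pairing_well_defined[OF f _ t] f tc by blast
  then show ?thesis unfolding induced_pairing_def by simp
qed

text \<open>Once classes are represented by elements of \<open>F\<close> and \<open>T\<close>, every
  law is that of \<open>m\<close> on representatives, carried over by the linear coset maps.\<close>

lemma induced_pairing_bilinear: "bilinear_on K Ab Zs Mult (induced_pairing m)"
proof -
  note k = linear_mapD(4-6)[OF Mult_linear, simplified] and a = linear_mapD(5,6)[OF Ab_linear]
    and p = linear_mapD(5,6)[OF pi_linear] and v = induced_pairing_coset
    and T = subspaceD[OF Q.R_sub] and rd = pairing_RD
  note lin = linear_mapD[OF pairing_linear(1)] and lin' = linear_mapD[OF pairing_linear(2)]
  show ?thesis
    unfolding bilinear_on_def
  proof (intro conjI ballI)
    fix c assume "c \<in> carrier Ab"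
    then obtain f where f: "f \<in> carrier F" "c = derived K L +>\<^bsub>L\<^esub> \<pi> f" unfolding Ab_carrier by blast
    show "(\<lambda>z. induced_pairing m c z) \<in> module_hom K Zs Mult"
    proof (rule module_homI)
      fix z assume "z \<in> carrier Zs"
      then obtain t where t: "t \<in> T" "z = \<pi> t" by (auto simp: Z_image)
      show "induced_pairing m c z \<in> carrier Mult"
        unfolding f t v[OF f(1) t(1)] Mult_carrier using rd[OF f(1) t(1)] by blast
      fix z' assume "z' \<in> carrier Zs"
      then obtain t' where t': "t' \<in> T" "z' = \<pi> t'" by (auto simp: Z_image)
      have "z \<oplus>\<^bsub>Zs\<^esub> z' = \<pi> (t \<oplus>\<^bsub>F\<^esub> t')" using p(1) T(4) t t' by simp
      then show "induced_pairing m c (z \<oplus>\<^bsub>Zs\<^esub> z') = induced_pairing m c z \<oplus>\<^bsub>Mult\<^esub> induced_pairing m c z'"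
        using v[OF f(1) T(5)[OF t(1) t'(1)]] v[OF f(1) t(1)] v[OF f(1) t'(1)] lin(5)[OF f(1) T(4)[OF t(1)] T(4)[OF t'(1)]]
          k(2)[of "m f t" "m f t'"] rd[OF f(1) t(1)] rd[OF f(1) t'(1)]
        by (simp add: f(2) t(2) t'(2))
    next
      fix e z assume e: "e \<in> carrier K" and "z \<in> carrier Zs"
      then obtain t where t: "t \<in> T" "z = \<pi> t" by (auto simp: Z_image)
      have "e \<odot>\<^bsub>Zs\<^esub> z = \<pi> (e \<odot>\<^bsub>F\<^esub> t)" using p(2) T(4) t e by simp
      then show "induced_pairing m c (e \<odot>\<^bsub>Zs\<^esub> z) = e \<odot>\<^bsub>Mult\<^esub> induced_pairing m c z"
        using v[OF f(1) T(6)[OF e t(1)]] v[OF f(1) t(1)] lin(6)[OF f(1) e T(4)[OF t(1)]]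
          k(3)[OF e, of "m f t"] rd[OF f(1) t(1)]
        by (simp add: f(2) t(2))
    qed
  next
    fix z assume "z \<in> carrier Zs"
    then obtain t where t: "t \<in> T" "z = \<pi> t" by (auto simp: Z_image)
    show "(\<lambda>c. induced_pairing m c z) \<in> module_hom K Ab Mult"
    proof (rule module_homI)
      fix c assume "c \<in> carrier Ab"
      then obtain f where f: "f \<in> carrier F" "c = derived K L +>\<^bsub>L\<^esub> \<pi> f" unfolding Ab_carrier by blast
      show "induced_pairing m c z \<in> carrier Mult"
        unfolding f t v[OF f(1) t(1)] Mult_carrier using rd[OF f(1) t(1)] by blast
      fix c' assume "c' \<in> carrier Ab"
      then obtain f' where f': "f' \<in> carrier F" "c' = derived K L +>\<^bsub>L\<^esub> \<pi> f'" unfolding Ab_carrier by blast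
      have ff: "f \<oplus>\<^bsub>F\<^esub> f' \<in> carrier F" using f f' by simp
      show "induced_pairing m (c \<oplus>\<^bsub>Ab\<^esub> c') z = induced_pairing m c z \<oplus>\<^bsub>Mult\<^esub> induced_pairing m c' z"
        unfolding f(2) f'(2) t(2) a(1)[OF f(1) f'(1), symmetric] v[OF ff t(1)] v[OF f(1) t(1)] v[OF f'(1) t(1)]
        using lin'(5)[OF T(4)[OF t(1)] f(1) f'(1)] k(2)[of "m f t" "m f' t"] rd[OF f(1) t(1)] rd[OF f'(1) t(1)]
        by simp
    next
      fix e c assume e: "e \<in> carrier K" and "c \<in> carrier Ab"
      then obtain f where f: "f \<in> carrier F" "c = derived K L +>\<^bsub>L\<^esub> \<pi> f" unfolding Ab_carrier by blast
      have ef: "e \<odot>\<^bsub>F\<^esub> f \<in> carrier F" using f e by simp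
      show "induced_pairing m (e \<odot>\<^bsub>Ab\<^esub> c) z = e \<odot>\<^bsub>Mult\<^esub> induced_pairing m c z"
        unfolding f(2) t(2) a(2)[OF e f(1), symmetric] v[OF ef t(1)] v[OF f(1) t(1)]
        using lin'(6)[OF T(4)[OF t(1)] e f(1)] k(3)[OF e, of "m f t"] rd[OF f(1) t(1)]
        by simp
    qed
  qed
qed

lemma induced_pairing_values:
  "{induced_pairing m c z | c z. c \<in> carrier Ab \<and> z \<in> carrier Zs} = \<kappa> ` pairing_values m"
proof (intro equalityI subsetI)
  fix x assume "x \<in> {induced_pairing m c z | c z. c \<in> carrier Ab \<and> z \<in> carrier Zs}"
  then obtain f t where "f \<in> carrier F" "t \<in> T" "x = induced_pairing m (derived K L +>\<^bsub>L\<^esub> \<pi> f) (\<pi> t)"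
    by (auto simp: Ab_carrier Z_image)
  then show "x \<in> \<kappa> ` pairing_values m"
    using induced_pairing_coset by (auto simp: pairing_values_def)
next
  fix x assume "x \<in> \<kappa> ` pairing_values m"
  then obtain f t where ft: "f \<in> carrier F" "t \<in> T" "x = \<kappa> (m f t)"
    by (auto simp: pairing_values_def)
  then have "x = induced_pairing m (derived K L +>\<^bsub>L\<^esub> \<pi> f) (\<pi> t)"
    using induced_pairing_coset by simp
  moreover have "derived K L +>\<^bsub>L\<^esub> \<pi> f \<in> carrier Ab" "\<pi> t \<in> carrier Zs"
    using ft by (auto simp: Ab_carrier Z_image)
  ultimately show "x \<in> {induced_pairing m c z | c z. c \<in> carrier Ab \<and> z \<in> carrier Zs}" by blast
qed

lemma pairing_lift:
  "linear_map K (tensor K Ab Zs) Mult (tensor_lift K Ab Zs Mult (induced_pairing m))"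
  "tensor_lift K Ab Zs Mult (induced_pairing m) ` carrier (tensor K Ab Zs)
    = module.span K Mult (\<kappa> ` pairing_values m)"
  using tensor_lift_linear[OF Ab_vs Z_vs Mult_vs induced_pairing_bilinear]
  unfolding induced_pairing_values .

lemma pairing_lift_flip:
  "linear_map K (tensor K Zs Ab) Mult (tensor_lift K Zs Ab Mult (\<lambda>z c. induced_pairing m c z))"
  "tensor_lift K Zs Ab Mult (\<lambda>z c. induced_pairing m c z) ` carrier (tensor K Zs Ab)
    = module.span K Mult (\<kappa> ` pairing_values m)"
proof -
  have "{induced_pairing m c z | z c. z \<in> carrier Zs \<and> c \<in> carrier Ab} = \<kappa> ` pairing_values m"
    unfolding induced_pairing_values[symmetric] by blast
  then show "linear_map K (tensor K Zs Ab) Mult (tensor_lift K Zs Ab Mult (\<lambda>z c. induced_pairing m c z))"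
    "tensor_lift K Zs Ab Mult (\<lambda>z c. induced_pairing m c z) ` carrier (tensor K Zs Ab)
      = module.span K Mult (\<kappa> ` pairing_values m)"
    using tensor_lift_linear[OF Z_vs Ab_vs Mult_vs bilinear_on_flip[OF induced_pairing_bilinear]] by simp_all
qed

end

lemma alpha_map_eq: "alpha_map K F L \<pi> R Z op = tensor_lift K Ab Zs Mult (induced_pairing op)"
  unfolding alpha_map_def induced_pairing_def[abs_def] ..

lemma theta_map_eq:
  "theta_map K F L \<pi> R Z op = tensor_lift K Zs Ab Mult (\<lambda>z c. induced_pairing (\<lambda>x y. op y x) c z)"
proof -
  have "{\<kappa> (op t f) | t f. t \<in> carrier F \<and> f \<in> carrier F \<and> \<pi> t = z \<and> \<pi> f \<in> c}
      = {\<kappa> (op t f) | f t. f \<in> carrier F \<and> t \<in> carrier F \<and> \<pi> f \<in> c \<and> \<pi> t = z}" for z c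
    by blast
  then show ?thesis unfolding theta_map_def induced_pairing_def[abs_def] by simp
qed

abbreviation "pair_values op \<equiv> \<kappa> ` (pairing_values op \<union> pairing_values (\<lambda>x y. op y x))"

definition alpha_theta where
  "alpha_theta op = (\<lambda>(a, b). alpha_map K F L \<pi> R Z op a \<oplus>\<^bsub>Mult\<^esub> theta_map K F L \<pi> R Z op b)"

lemma kappa_carrier: "S \<subseteq> R \<inter> D \<Longrightarrow> \<kappa> ` S \<subseteq> carrier Mult"
  unfolding Mult_carrier by blast

lemma pair_values_carrier:
  assumes "op \<in> tri_products F"
  shows "pair_values op \<subseteq> carrier Mult"
  using pairing_values_RD[OF pairing_product(1)[OF assms]] pairing_values_RD[OF pairing_product(2)[OF assms]]
  by (intro kappa_carrier Un_least)

lemma alpha_theta: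
  assumes "op \<in> tri_products F"
  shows "linear_map K (tensor_pair K L Z) Mult (alpha_theta op)"
    and "alpha_theta op ` carrier (tensor_pair K L Z) = module.span K Mult (pair_values op)"
proof -
  note A = pairing_lift[OF pairing_product(1)[OF assms], folded alpha_map_eq]
    and B = pairing_lift_flip[OF pairing_product(2)[OF assms], folded theta_map_eq]
  show "linear_map K (tensor_pair K L Z) Mult (alpha_theta op)"
    unfolding tensor_pair_def alpha_theta_def by (rule linear_map_copair[OF A(1) B(1)])
  show "alpha_theta op ` carrier (tensor_pair K L Z) = module.span K Mult (pair_values op)"
    unfolding tensor_pair_def alpha_theta_def image_Un
    by (rule image_copair[OF Mult_vs A(2) B(2)]) (use pair_values_carrier[OF assms] in blast)+
qed

text \<open>The values of the six pairings together are exactly the generators of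
  \<open>C(T)\<close>, which is why the image of \<theta> is the whole of
  \<open>C(T) / C(R)\<close>.\<close>

lemma pairing_values_Un:
  "(\<Union>op\<in>tri_products F. pairing_values op \<union> pairing_values (\<lambda>x y. op y x))
    = product_set F (carrier F) T \<union> product_set F T (carrier F)"
  unfolding pairing_values_def product_set_def by blast

lemma theta_bar:
  defines "U \<equiv> direct_sum (tensor_pair K L Z) (direct_sum (tensor_pair K L Z) (tensor_pair K L Z))"
  shows "linear_map K U Mult (theta_bar K F L \<pi> R Z)" "theta_bar K F L \<pi> R Z ` carrier U = \<kappa> ` Q.C"
proof -
  interpret M: vectorspace K Mult by (rule Mult_vs)
  \<comment> \<open>\<open>theta_bar\<close> adds its six terms from the left, whereas copairing
    along the nested direct sum brackets them in pairs. \<open>?g\<close> is the copairing form;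
    associativity in \<open>Mult\<close> identifies the two on the carrier.\<close>
  let ?g = "\<lambda>(u, v, w). alpha_theta (vd F) u \<oplus>\<^bsub>Mult\<^esub> (alpha_theta (dv F) v \<oplus>\<^bsub>Mult\<^esub> alpha_theta (pp F) w)"
  let ?h = "\<lambda>(v, w). alpha_theta (dv F) v \<oplus>\<^bsub>Mult\<^esub> alpha_theta (pp F) w"
  have g: "?g = (\<lambda>(u, x). alpha_theta (vd F) u \<oplus>\<^bsub>Mult\<^esub> ?h x)" by auto
  note lin = alpha_theta(1)[OF tri_productsI(1)] alpha_theta(1)[OF tri_productsI(2)]
    alpha_theta(1)[OF tri_productsI(3)]
  note img = alpha_theta(2)[OF tri_productsI(1)] alpha_theta(2)[OF tri_productsI(2)]
    alpha_theta(2)[OF tri_productsI(3)]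
  note car = pair_values_carrier[OF tri_productsI(1)] pair_values_carrier[OF tri_productsI(2)]
    pair_values_carrier[OF tri_productsI(3)]
  have glin: "linear_map K U Mult ?g"
    unfolding g U_def by (intro linear_map_copair lin)
  have "?g ` carrier U = M.span (pair_values (vd F) \<union> (pair_values (dv F) \<union> pair_values (pp F)))"
    unfolding g U_def using car by (intro image_copair[OF Mult_vs] img) auto
  also have "pair_values (vd F) \<union> (pair_values (dv F) \<union> pair_values (pp F))
      = \<kappa> ` (\<Union>op\<in>tri_products F. pairing_values op \<union> pairing_values (\<lambda>x y. op y x))"
    unfolding tri_products_def by blast
  also have "M.span \<dots> = \<kappa> ` Q.C"
  proof -
    let ?P = "product_set F (carrier F) T \<union> product_set F T (carrier F)"
    interpret RD: vectorspace K "F\<lparr>carrier := R \<inter> D\<rparr>" by (rule RD_vs)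
    have P: "?P \<subseteq> R \<inter> D"
      using F.op_in_comm_ideal[OF Q.R_carrier] CT_le_RD unfolding product_set_def by blast
    have "Q.C = F.span ?P" by (rule F.comm_ideal_eq_span[OF Q.R_carrier])
    also have "\<dots> = RD.span ?P"
      \<comment> \<open>The coset map into \<open>Mult\<close> is linear on
        \<open>R \<inter> D\<close>, so the span is first recomputed inside that subspace before
        taking images.\<close>
      using F.span_li_not_depend(1)[OF P] RD_sub by simp
    also have "\<kappa> ` \<dots> = M.span (\<kappa> ` ?P)"
      using linear_map_image_span[OF Mult_linear] P by simp
    finally show ?thesis unfolding pairing_values_Un ..
  qed
  finally have gimg: "?g ` carrier U = \<kappa> ` Q.C" .
  have eq: "theta_bar K F L \<pi> R Z x = ?g x" if x: "x \<in> carrier U" for x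
  proof -
    obtain a b c d e f where xx: "x = ((a, b), (c, d), (e, f))" by (metis surj_pair)
    have mem: "a \<in> carrier (tensor K Ab Zs)" "c \<in> carrier (tensor K Ab Zs)" "e \<in> carrier (tensor K Ab Zs)"
      "b \<in> carrier (tensor K Zs Ab)" "d \<in> carrier (tensor K Zs Ab)" "f \<in> carrier (tensor K Zs Ab)"
      using x unfolding xx U_def tensor_pair_def direct_sum_def by simp_all
    have "alpha_map K F L \<pi> R Z op y \<in> carrier Mult"
      if "op \<in> tri_products F" "y \<in> carrier (tensor K Ab Zs)" for op y
      using linear_mapD(4)[OF pairing_lift(1)[OF pairing_product(1)[OF that(1)]] that(2)]
      unfolding alpha_map_eq .
    moreover have "theta_map K F L \<pi> R Z op y \<in> carrier Mult"
      if "op \<in> tri_products F" "y \<in> carrier (tensor K Zs Ab)" for op y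
      using linear_mapD(4)[OF pairing_lift_flip(1)[OF pairing_product(2)[OF that(1)]] that(2)]
      unfolding theta_map_eq .
    ultimately show ?thesis
      unfolding xx theta_bar_def alpha_theta_def using mem by (simp add: M.M.a_assoc)
  qed
  show "linear_map K U Mult (theta_bar K F L \<pi> R Z)" by (rule linear_map_cong[OF glin eq])
  show "theta_bar K F L \<pi> R Z ` carrier U = \<kappa> ` Q.C"
    unfolding gimg[symmetric] using eq by (rule image_cong[OF refl])
qed

lemma exact_at_Mult:
  "exact_at K (direct_sum (tensor_pair K L Z) (direct_sum (tensor_pair K L Z) (tensor_pair K L Z)))
     (theta_bar K F L \<pi> R Z) Mult (beta_map K F T) Q.Mult"
  unfolding exact_at_def kernel_beta using theta_bar beta_linear by blast

end

theorem theorem5p2: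
  fixes K :: "('a, 'r) ring_scheme"
    and L :: "('a, 'l) triassoc" and Z :: "'l set"
    and F :: "('a, 'f) triassoc" and X :: "'f set" and \<pi> :: "'f \<Rightarrow> 'l" and R T :: "'f set"
  assumes "field K"
    and "triassociative_algebra K L" and "vectorspace.fin_dim K L"
    and "central_ideal K Z L"
    and "free_on K X F TYPE('f)" and "free_on K X F TYPE('k)"
    and "\<pi> \<in> triassoc_hom K F L" and "\<pi> ` carrier F = carrier L"
    and "R = a_kernel F L \<pi>"
    and "T = {t \<in> carrier F. \<pi> t \<in> Z}"
  shows "is_multiplier K L (mult_of_presentation K F R) TYPE('f set) TYPE('k) \<and>
         is_multiplier K (quot_algebra L Z) (mult_of_presentation K F T) TYPE('f set) TYPE('k) \<and>
         exact_at K
           (direct_sum (tensor_pair K L Z) (direct_sum (tensor_pair K L Z) (tensor_pair K L Z)))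
           (theta_bar K F L \<pi> R Z)
           (mult_of_presentation K F R)
           (beta_map K F T)
           (mult_of_presentation K F T) \<and>
         exact_at K
           (mult_of_presentation K F R)
           (beta_map K F T)
           (mult_of_presentation K F T)
           (gamma_map \<pi>)
           (L\<lparr>carrier := derived K L \<inter> Z\<rparr>) \<and>
         gamma_map \<pi> ` carrier (mult_of_presentation K F T) = derived K L \<inter> Z"
proof -
  have F: "triassociative_algebra K F" using assms(5) by (simp add: free_on_def)
  interpret central_presentation K F L \<pi> R Z T
    by (intro central_presentation.intro presentation.intro presentation_axioms.intro
        central_presentation_axioms.intro F assms)
      (simp add: assms(9) a_kernel_def')
  have "linear_map K L (quot_algebra L Z) (\<lambda>x. Z +>\<^bsub>L\<^esub> x)"
    by (rule L.quotient_map_linear[OF Z_sub is_quotient_quot_algebra])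
  then interpret q: linear_map K L "quot_algebra L Z" "\<lambda>x. Z +>\<^bsub>L\<^esub> x" .
  \<comment> \<open>The multiplier statement for \<open>L / Z\<close> needs finite dimension, which
    passes from \<open>L\<close> along the surjective coset map.\<close>
  have "vectorspace.fin_dim K (quot_algebra L Z)"
    by (rule q.surj_fin_dim[OF assms(3)]) (simp add: a_rcosets_eq_image)
  then show ?thesis
    using is_multiplier_of_presentation[OF assms(5,6,3)] Q.is_multiplier_of_presentation[OF assms(5,6)]
      exact_at_Mult exact_at_Mult_quotient gamma_onto by blast
qed

end
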